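(* In the setting described in the context (in particular $\mathcal X$ is reflexive, $\mathcal Y$ is uniformly smooth, and the stated assumptions on $\Theta$ and $F$ hold), let $\tau>1$ and $\bar\mu_0>0$ be chosen such that $$c_1:=1-\eta-\frac{1+\eta}{\tau}-\frac1{p^*}\left(\frac{\bar\mu_0}{2c_0}\right)^{p^*-1}>0 ,$$ and let $\nu>1$ be a constant. For each $\delta>0$ let $y^\delta\in\mathcal Y$ satisfy $\|y^\delta-y\|\le\delta$ and let the iterates of the two-point gradient method be computed with combination parameters $\lambda_n^\delta\ge0$ such that, for all $n\ge0$, $$\frac{1}{p^*(2c_0)^{p^*-1}}\left((\lambda_n^\delta)^{p^*}+\lambda_n^\delta\right)\|\xi_n^\delta-\xi_{n-1}^\delta\|^{p^*}\le c_0\rho^p$$ and $$\frac{1}{p^*(2c_0)^{p^*-1}}\left((\lambda_n^\delta)^{p^*}+\lambda_n^\delta\right)\|\xi_n^\delta-\xi_{n-1}^\delta\|^{p^*}-\frac{c_1}{\nu}\mu_n^\delta\|F(z_n^\delta)-y^\delta\|^s\le0 .$$ Assume that $\lambda_n^\delta$ depends continuously on $\delta$ as $\delta\to0$, i.e. there are numbers $\lambda_n\ge 0$ with $\lambda_n^\delta\to\lambda_n$ as $\delta\to0$ for every $n$, and that the noise-free iterates computed with $\{\lambda_n\}$ satisfy $\sum_{n=0}^\infty\lambda_n\|\xi_n-\xi_{n-1}\|<\infty$. Let $n_\delta$ be the integer determined by the discrepancy principle $$\|F(z_{n_\delta}^\delta)-y^\delta\|\le\tau\delta<\|F(z_n^\delta)-y^\delta\|,\qquad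 0\le n<n_\delta .$$ Then there exists a solution $x_*$ of $F(x)=y$ in $B_{2\rho}(x_0)\cap\mathscr D(\Theta)$ such that $$\lim_{\delta\to0}\|x_{n_\delta}^\delta-x_*\|=0\qquad\text{and}\qquad\lim_{\delta\to0}D_{\xi_{n_\delta}^\delta}\Theta(x_*,x_{n_\delta}^\delta)=0 .$$ If in addition $\mathcal N(L(x^\dagger))\subset\mathcal N(L(x))$ for all $x\in B_{3\rho}(x_0)$ ($\mathcal N$ denoting the null space), then $x_*=x^\dagger$.
   Context: **Setting.** $\mathcal X$ is a reflexive Banach space and $\mathcal Y$ is a uniformly smooth Banach space; $F:\mathscr D(F)\subset\mathcal X\to\mathcal Y$ is an operator, $y\in\mathcal Y$, and the equation to be solved is $F(x)=y$. $B_r(x_0)$ is the closed ball of radius $r$ around $x_0$. $\mathscr D(\Theta)=\{x:\Theta(x)<\infty\}$. For $\xi\in\partial\Theta(x)$ the Bregman distance is $D_\xi\Theta(\bar x,x)=\Theta(\bar x)-\Theta(x)-\langle\xi,\bar x-x\rangle$. Assumptions on $\Theta$: $\Theta:\mathcal X\to(-\infty,\infty]$ is proper, convex, weakly lower semi-continuous and $p$-convex with $p\ge2$: there is $c_0>0$ with $D_\xi\Theta(\bar x,x)\ge c_0\|\bar x-x\|^p$ for all $\bar x\in\mathcal X$, all $x$ with $\partial\Theta(x)\ne\emptyset$ and all $\xi\in\partial\Theta(x)$. Put $p^*=p/(p-1)$. The conjugate $\Theta^*$ is then Fréchet differentiable on $\mathcal X^*$ and $\nabla\Theta^*(\xi)=\arg\min_{z\in\mathcal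 X}\{\Theta(z)-\langle\xi,z\rangle\}$. Assumptions on $F$: (a) there are $\rho>0$, $x_0\in\mathcal X$, $\xi_0\in\partial\Theta(x_0)$ with $B_{3\rho}(x_0)\subset\mathscr D(F)$, and there is a solution $x^*\in\mathscr D(\Theta)$ of $F(x)=y$ with $D_{\xi_0}\Theta(x^*,x_0)\le c_0\rho^p$. (b) $F$ is weakly closed: if $x_n\in\mathscr D(F)$, $x_n\rightharpoonup x$ and $F(x_n)\rightharpoonup v$, then $x\in\mathscr D(F)$ and $F(x)=v$. (c) There are bounded linear operators $L(x):\mathcal X\to\mathcal Y$, $x\in B_{3\rho}(x_0)$, with $x\mapsto L(x)$ continuous on $B_{3\rho}(x_0)$, a number $0\le\eta<1$ with $\|F(x)-F(\bar x)-L(\bar x)(x-\bar x)\|\le\eta\|F(x)-F(\bar x)\|$ for all $x,\bar x\in B_{3\rho}(x_0)$, and $C_0>0$ with $\|L(x)\|\le C_0$ for all $x\in B_{3\rho}(x_0)$. $x^\dagger$ denotes the (unique) solution with $D_{\xi_0}\Theta(x^\dagger,x_0)=\min\{D_{\xi_0}\Theta(x,x_0):x\in\mathscr D(\Theta)\cap\mathscr D(F),\ F(x)=y\}$. For $1<s<\infty$, $J_s^{\mathcal Y}:\mathcal Y\to\mathcal Y^*$ is the (single-valued, continuous) duality mapping: $\|J_s^{\mathcal Y}(v)\|=\|v\|^{s-1}$, $\langle J_s^{\mathcal Y}(v),v\rangle=\|v\|^s$. **Two-point gradient method (noisy data).** Fix $s\in(1,\infty)$, $\tau>1$, $\bar\mu_0,\bar\mu_1>0$.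 With $\xi_{-1}^\delta=\xi_0^\delta=\xi_0$, $x_{-1}^\delta=x_0^\delta=x_0$, for $n\ge0$: $$\zeta_n^\delta=\xi_n^\delta+\lambda_n^\delta(\xi_n^\delta-\xi_{n-1}^\delta),\quad z_n^\delta=\nabla\Theta^*(\zeta_n^\delta),\quad \xi_{n+1}^\delta=\zeta_n^\delta-\mu_n^\delta L(z_n^\delta)^*J_s^{\mathcal Y}(r_n^\delta),\quad x_{n+1}^\delta=\nabla\Theta^*(\xi_{n+1}^\delta),$$ where $r_n^\delta=F(z_n^\delta)-y^\delta$, $\lambda_n^\delta\ge0$, and $$\mu_n^\delta=\min\left\{\frac{\bar\mu_0\|r_n^\delta\|^{p(s-1)}}{\|L(z_n^\delta)^*J_s^{\mathcal Y}(r_n^\delta)\|^p},\bar\mu_1\right\}\|r_n^\delta\|^{p-s}\ \text{ if }\|r_n^\delta\|>\tau\delta,\qquad \mu_n^\delta=0\ \text{ if }\|r_n^\delta\|\le\tau\delta .$$ **Noise-free iterates.** $\xi_n,x_n,\zeta_n,z_n,\mu_n$ are defined by the same formulas with $y^\delta$ replaced by $y$, $\lambda_n^\delta$ replaced by $\lambda_n$, and $\delta=0$ (so $\mu_n=0$ exactly when $F(z_n)=y$), starting from $\xi_{-1}=\xi_0$, $x_{-1}=x_0$. A quotient with zero denominator is read as $+\infty$. $F$ and $L$ are thought of as extended arbitrarily outside $\mathscr D(F)$ and $B_{3\rho}(x_0)$, so that the schemes are formally defined. *)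

theory Defs
  imports "HOL-Analysis.Analysis"
begin

text \<open>The dual of a space of type \<open>'a\<close> is \<open>'a \<Rightarrow>\<^sub>L real\<close> with its operator norm.\<close>

definition reflexive_space :: "'a::real_normed_vector itself \<Rightarrow> bool" where
  "reflexive_space _ \<longleftrightarrow>
     (\<forall>\<phi> :: ('a \<Rightarrow>\<^sub>L real) \<Rightarrow>\<^sub>L real. \<exists>x::'a. \<forall>f. blinfun_apply \<phi> f = blinfun_apply f x)"

text \<open>For \<open>t \<ge> 0\<close>, inserting \<open>0\<close> changes the supremum only for the zero space, which has no unit vectors.\<close>

definition smoothness_modulus :: "'a::real_normed_vector itself \<Rightarrow> real \<Rightarrow> real" where
  "smoothness_modulus _ t =
     Sup (insert 0 {(norm (u + v) + norm (u - v)) / 2 - 1 | u v :: 'a. norm u = 1 \<and> norm v \<le> t})"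

definition uniformly_smooth :: "'a::real_normed_vector itself \<Rightarrow> bool" where
  "uniformly_smooth T \<longleftrightarrow> ((\<lambda>t. smoothness_modulus T t / t) \<longlongrightarrow> 0) (at_right 0)"

definition weakly_converges :: "(nat \<Rightarrow> 'a::real_normed_vector) \<Rightarrow> 'a \<Rightarrow> bool" where
  "weakly_converges u x \<longleftrightarrow>
     (\<forall>f :: 'a \<Rightarrow>\<^sub>L real. (\<lambda>n. blinfun_apply f (u n)) \<longlonglongrightarrow> blinfun_apply f x)"

text \<open>The duality mapping with gauge \<open>t \<mapsto> t\<^bsup>s-1\<^esup>\<close>; it is single-valued on uniformly smooth
  spaces.\<close>

definition duality_map :: "real \<Rightarrow> 'a::real_normed_vector \<Rightarrow> ('a \<Rightarrow>\<^sub>L real)" where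
  "duality_map s v =
     (THE j. norm j = norm v powr (s - 1) \<and> blinfun_apply j v = norm v powr s)"

definition blinfun_kernel :: "('a::real_normed_vector \<Rightarrow>\<^sub>L 'b::real_normed_vector) \<Rightarrow> 'a set" where
  "blinfun_kernel A = {h. blinfun_apply A h = 0}"

definition proper_functional :: "('a \<Rightarrow> ereal) \<Rightarrow> bool" where
  "proper_functional \<Theta> \<longleftrightarrow> (\<forall>x. \<Theta> x \<noteq> -\<infinity>) \<and> (\<exists>x. \<Theta> x \<noteq> \<infinity>)"

definition convex_functional :: "('a::real_vector \<Rightarrow> ereal) \<Rightarrow> bool" where
  "convex_functional \<Theta> \<longleftrightarrow>
     (\<forall>x y t. 0 \<le> t \<longrightarrow> t \<le> 1 \<longrightarrow>
        \<Theta> ((1 - t) *\<^sub>R x + t *\<^sub>R y) \<le> ereal (1 - t) * \<Theta> x + ereal t * \<Theta> y)"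

text \<open>Weak lower semicontinuity is taken sequentially; for convex functionals this is the same as
  lower semicontinuity for the weak topology.\<close>

definition weakly_lsc :: "('a::real_normed_vector \<Rightarrow> ereal) \<Rightarrow> bool" where
  "weakly_lsc \<Theta> \<longleftrightarrow>
     (\<forall>u x. weakly_converges u x \<longrightarrow> \<Theta> x \<le> liminf (\<lambda>n. \<Theta> (u n)))"

definition eff_domain :: "('a \<Rightarrow> ereal) \<Rightarrow> 'a set" where
  "eff_domain \<Theta> = {x. \<Theta> x < \<infinity>}"

definition subdifferential ::
  "('a::real_normed_vector \<Rightarrow> ereal) \<Rightarrow> 'a \<Rightarrow> ('a \<Rightarrow>\<^sub>L real) set" where
  "subdifferential \<Theta> x = {\<xi>. \<forall>z. \<Theta> x + ereal (blinfun_apply \<xi> (z - x)) \<le> \<Theta> z}"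

definition bregman ::
  "('a::real_normed_vector \<Rightarrow> ereal) \<Rightarrow> ('a \<Rightarrow>\<^sub>L real) \<Rightarrow> 'a \<Rightarrow> 'a \<Rightarrow> ereal" where
  "bregman \<Theta> \<xi> z x = \<Theta> z - \<Theta> x - ereal (blinfun_apply \<xi> (z - x))"

definition p_convex ::
  "('a::real_normed_vector \<Rightarrow> ereal) \<Rightarrow> real \<Rightarrow> real \<Rightarrow> bool" where
  "p_convex \<Theta> p c0 \<longleftrightarrow>
     (\<forall>z x. \<forall>\<xi> \<in> subdifferential \<Theta> x. ereal (c0 * norm (z - x) powr p) \<le> bregman \<Theta> \<xi> z x)"

definition conjugate :: "('a::real_normed_vector \<Rightarrow> ereal) \<Rightarrow> ('a \<Rightarrow>\<^sub>L real) \<Rightarrow> ereal" where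
  "conjugate \<Theta> \<xi> = (SUP x. ereal (blinfun_apply \<xi> x) - \<Theta> x)"

text \<open>The Frechet derivative of the conjugate lies in the bidual; the gradient is the element of
  \<open>'a\<close> that represents it under the canonical embedding.\<close>

definition grad_conjugate :: "('a::real_normed_vector \<Rightarrow> ereal) \<Rightarrow> ('a \<Rightarrow>\<^sub>L real) \<Rightarrow> 'a" where
  "grad_conjugate \<Theta> \<xi> =
     (THE x. ((\<lambda>\<omega>. real_of_ereal (conjugate \<Theta> \<omega>)) has_derivative (\<lambda>h. blinfun_apply h x)) (at \<xi>))"

definition weakly_closed_operator ::
  "('x::real_normed_vector \<Rightarrow> 'y::real_normed_vector) \<Rightarrow> 'x set \<Rightarrow> bool" where
  "weakly_closed_operator F D \<longleftrightarrow>
     (\<forall>u x v. (\<forall>n. u n \<in> D) \<and> weakly_converges u x \<and> weakly_converges (\<lambda>n. F (u n)) v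
        \<longrightarrow> x \<in> D \<and> F x = v)"

definition solutions :: "('x \<Rightarrow> 'y) \<Rightarrow> 'x set \<Rightarrow> 'y \<Rightarrow> 'x set" where
  "solutions F D y = {x \<in> D. F x = y}"

definition bregman_min_solution ::
  "('x::real_normed_vector \<Rightarrow> ereal) \<Rightarrow> ('x \<Rightarrow> 'y) \<Rightarrow> 'x set \<Rightarrow> 'y \<Rightarrow> ('x \<Rightarrow>\<^sub>L real) \<Rightarrow> 'x \<Rightarrow> 'x \<Rightarrow> bool"
  where
  "bregman_min_solution \<Theta> F D y \<xi>0 x0 x \<longleftrightarrow>
     is_arg_min (\<lambda>z. bregman \<Theta> \<xi>0 z x0) (\<lambda>z. z \<in> eff_domain \<Theta> \<inter> solutions F D y) x"

text \<open>The step size for residual \<open>r\<close> and operator \<open>A\<close>. The inner case distinction reads a quotient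
  with zero denominator as \<open>+\<infinity>\<close>; the adjoint of \<open>A\<close> applied to \<open>j\<close> is \<open>j o\<^sub>L A\<close>.\<close>

definition tpg_step_size ::
  "real \<Rightarrow> real \<Rightarrow> real \<Rightarrow> real \<Rightarrow> real \<Rightarrow> real \<Rightarrow>
   'y::real_normed_vector \<Rightarrow> ('x::real_normed_vector \<Rightarrow>\<^sub>L 'y) \<Rightarrow> real" where
  "tpg_step_size p s \<tau> \<mu>0 \<mu>1 \<delta> r A =
     (if norm r > \<tau> * \<delta> then
        (let g = norm (duality_map s r o\<^sub>L A) in
           if g = 0 then \<mu>1 else min (\<mu>0 * norm r powr (p * (s - 1)) / g powr p) \<mu>1)
        * norm r powr (p - s)
      else 0)"

text \<open>\<open>\<xi> n\<close>, \<open>x n\<close>, \<open>\<zeta> n\<close>, \<open>z n\<close>, \<open>\<mu> n\<close> are the iterates for the data \<open>v\<close> with noise level \<open>\<delta>\<close>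
  (\<open>\<delta> = 0\<close> for exact data). The initialisation with equal elements at the indices \<open>-1\<close> and \<open>0\<close> is
  encoded by \<open>\<xi> (n - 1)\<close>, where \<open>0 - 1 = 0\<close> in type \<open>nat\<close>.\<close>

definition tpg_iterates ::
  "('x::real_normed_vector \<Rightarrow> ereal) \<Rightarrow> ('x \<Rightarrow> 'y::real_normed_vector) \<Rightarrow> ('x \<Rightarrow> ('x \<Rightarrow>\<^sub>L 'y)) \<Rightarrow>
   real \<Rightarrow> real \<Rightarrow> real \<Rightarrow> real \<Rightarrow> real \<Rightarrow> 'x \<Rightarrow> ('x \<Rightarrow>\<^sub>L real) \<Rightarrow> 'y \<Rightarrow> real \<Rightarrow> (nat \<Rightarrow> real) \<Rightarrow>
   (nat \<Rightarrow> ('x \<Rightarrow>\<^sub>L real)) \<Rightarrow> (nat \<Rightarrow> 'x) \<Rightarrow> (nat \<Rightarrow> ('x \<Rightarrow>\<^sub>L real)) \<Rightarrow> (nat \<Rightarrow> 'x) \<Rightarrow> (nat \<Rightarrow> real) \<Rightarrow> bool"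
  where
  "tpg_iterates \<Theta> F L p s \<tau> \<mu>0 \<mu>1 x0 \<xi>0 v \<delta> lam \<xi> x \<zeta> z \<mu> \<longleftrightarrow>
     \<xi> 0 = \<xi>0 \<and> x 0 = x0 \<and>
     (\<forall>n. \<zeta> n = \<xi> n + lam n *\<^sub>R (\<xi> n - \<xi> (n - 1)) \<and>
          z n = grad_conjugate \<Theta> (\<zeta> n) \<and>
          \<mu> n = tpg_step_size p s \<tau> \<mu>0 \<mu>1 \<delta> (F (z n) - v) (L (z n)) \<and>
          \<xi> (Suc n) = \<zeta> n - \<mu> n *\<^sub>R (duality_map s (F (z n) - v) o\<^sub>L L (z n)) \<and>
          x (Suc n) = grad_conjugate \<Theta> (\<xi> (Suc n)))"

definition discrepancy_index ::
  "('x \<Rightarrow> 'y::real_normed_vector) \<Rightarrow> (nat \<Rightarrow> 'x) \<Rightarrow> 'y \<Rightarrow> real \<Rightarrow> real \<Rightarrow> nat" where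
  "discrepancy_index F z v \<tau> \<delta> =
     (THE N. norm (F (z N) - v) \<le> \<tau> * \<delta> \<and> (\<forall>n<N. \<tau> * \<delta> < norm (F (z n) - v)))"

end

theory Submission
  imports Defs
begin

text \<open>By Ekeland's principle and the Hahn-Banach theorem every functional \<open>\<xi>\<close> is a subgradient of
  \<open>\<Theta>\<close> at exactly one point, which is the gradient of the conjugate at \<open>\<xi>\<close> and depends on \<open>\<xi>\<close> in a
  Hoelder continuous way. The conditions on the combination parameters and on the step size make the
  Bregman distance to any solution near \<open>x0\<close> nonincreasing along the iteration, with decrements that
  dominate \<open>\<mu> n \<parallel>F (z n) - v\<parallel>\<^sup>s\<close>; so the iterates stay in the ball and the discrepancy principle
  stops. For exact data the points \<open>z n\<close> at record indices of the residual form a Cauchy sequence.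
  Its limit is a solution, and by monotonicity the Bregman distances to it tend to zero along the
  whole sequence. Each single iterate depends continuously on \<open>\<delta>\<close> at zero, hence the conditions on
  the combination parameters pass to the exact run, and monotonicity carries the convergence over to
  noisy data.\<close>

section \<open>The Hahn-Banach theorem in sandwich form\<close>

text \<open>Adding the p-convexity inequalities at two points makes \<open>grad\<close> Hoelder
  continuous with exponent \<open>q - 1 = 1 / (p - 1)\<close>; integrating this bound along a
  segment gives \<open>\<kappa>\<close>, the constant in the conditions on the combination
  parameters. A gradient step lowers the Bregman distance by at least \<open>c1\<close> times its
  decrement: \<open>1 - \<eta> - (1 + \<eta>) / \<tau>\<close> is gained from the tangential cone
  condition and the discrepancy principle, and the last term of \<open>c1\<close> is lost to the
  remainder of the conjugate. The extrapolation may raise the distance, by at most the fraction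
  \<open>1 / \<nu>\<close> of that gain, but this bound uses that the previous step was a descent;
  so monotonicity is proved by induction together with ball membership. The obstacle to stability is
  that the step size need not be continuous where the residual vanishes. There the cap
  \<open>\<mu>1\<close> makes the whole update vanish with the residual; elsewhere the gradient
  cannot vanish, because its pairing with the direction to a solution is negative.\<close>

definition sublinear :: "('a::real_vector \<Rightarrow> real) \<Rightarrow> bool" where
  "sublinear q \<longleftrightarrow> (\<forall>u v. q (u + v) \<le> q u + q v) \<and> (\<forall>t u. 0 \<le> t \<longrightarrow> q (t *\<^sub>R u) = t * q u)"

lemma sublinearD:
  assumes "sublinear q"
  shows "q (u + v) \<le> q u + q v" and "0 \<le> t \<Longrightarrow> q (t *\<^sub>R u) = t * q u"
  using assms by (auto simp: sublinear_def)

lemma sublinear_zero: "sublinear q \<Longrightarrow> q 0 = 0"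
  using sublinearD(2)[of q 0 0] by simp

lemma sublinear_minus: "sublinear q \<Longrightarrow> - q (- u) \<le> q u"
  using sublinearD(1)[of q u "- u"] sublinear_zero[of q] by simp

text \<open>Homogeneity is only asked as an inequality: applied with the factor \<open>1 / t\<close>
  it yields the reverse one.\<close>

lemma sublinearI:
  assumes add: "\<And>u v. q (u + v) \<le> q u + q v"
    and hom: "\<And>t u. 0 < t \<Longrightarrow> q (t *\<^sub>R u) \<le> t * q u" and zero: "q 0 = 0"
  shows "sublinear q"
  unfolding sublinear_def
proof (intro conjI allI impI)
  fix t :: real and u assume "0 \<le> t"
  show "q (t *\<^sub>R u) = t * q u"
  proof (cases "t = 0")
    case False
    with \<open>0 \<le> t\<close> have t: "0 < t" by simp
    have "q ((1 / t) *\<^sub>R (t *\<^sub>R u)) \<le> (1 / t) * q (t *\<^sub>R u)"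
      using t by (intro hom) simp
    then have "t * q u \<le> q (t *\<^sub>R u)"
      using t by (simp add: field_simps)
    with hom[OF t, of u] show ?thesis by simp
  qed (simp add: zero)
qed (rule add)

text \<open>The function \<open>u \<mapsto> inf\<^sub>t (q (u + t v) - t q v)\<close> is sublinear and below \<open>q\<close>, hence
  equal to a minimal \<open>q\<close>; at \<open>u = - v\<close> this gives \<open>q (- v) \<le> - q v\<close>.\<close>

lemma minimal_sublinear_odd:
  assumes q: "sublinear q" and min: "\<And>r. sublinear r \<Longrightarrow> r \<le> q \<Longrightarrow> r = q"
  shows "q (- v) = - q v"
proof -
  define S where "S u = (\<lambda>t. q (u + t *\<^sub>R v) - t * q v) ` {0..}" for u
  define r where "r u = Inf (S u)" for u
  have lower: "- q (- u) \<le> q (u + t *\<^sub>R v) - t * q v" if "0 \<le> t" for u t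
  proof -
    have "q (t *\<^sub>R v) \<le> q (u + t *\<^sub>R v) + q (- u)"
      using sublinearD(1)[OF q, of "u + t *\<^sub>R v" "- u"] by simp
    then show ?thesis using sublinearD(2)[OF q that] by simp
  qed
  have bdd: "bdd_below (S u)" for u
    unfolding bdd_below_def S_def using lower by (intro exI[of _ "- q (- u)"]) auto
  have ne: "S u \<noteq> {}" for u by (auto simp: S_def)
  have le: "r u \<le> q (u + t *\<^sub>R v) - t * q v" if "0 \<le> t" for u t
    unfolding r_def by (rule cInf_lower[OF _ bdd]) (use that in \<open>auto simp: S_def\<close>)
  have ge: "c \<le> r u" if "\<And>t. 0 \<le> t \<Longrightarrow> c \<le> q (u + t *\<^sub>R v) - t * q v" for c u
    unfolding r_def by (rule cInf_greatest[OF ne]) (use that in \<open>auto simp: S_def\<close>)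
  have r_le: "r u \<le> q u" for u using le[of 0 u] by simp
  have "sublinear r"
  proof (rule sublinearI)
    fix u w
    have "r (u + w) - (q (u + t *\<^sub>R v) - t * q v) \<le> r w" if t: "0 \<le> t" for t
    proof (rule ge)
      fix t' :: real assume t': "0 \<le> t'"
      have "r (u + w) \<le> q (u + w + (t + t') *\<^sub>R v) - (t + t') * q v"
        using t t' by (intro le) simp
      also have "\<dots> \<le> q (u + t *\<^sub>R v) + q (w + t' *\<^sub>R v) - (t + t') * q v"
        using sublinearD(1)[OF q, of "u + t *\<^sub>R v" "w + t' *\<^sub>R v"]
        by (simp add: algebra_simps)
      finally show "r (u + w) - (q (u + t *\<^sub>R v) - t * q v) \<le> q (w + t' *\<^sub>R v) - t' * q v"
        by (simp add: algebra_simps)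
    qed
    then have "r (u + w) - r w \<le> r u" by (intro ge) (simp add: algebra_simps)
    then show "r (u + w) \<le> r u + r w" by simp
  next
    fix a :: real and u assume a: "0 < a"
    have "r (a *\<^sub>R u) / a \<le> r u"
    proof (rule ge)
      fix t :: real assume t: "0 \<le> t"
      have "r (a *\<^sub>R u) \<le> q (a *\<^sub>R u + (a * t) *\<^sub>R v) - a * t * q v"
        using le[of "a * t" "a *\<^sub>R u"] a t by simp
      also have "\<dots> = a * (q (u + t *\<^sub>R v) - t * q v)"
        using sublinearD(2)[OF q, of a "u + t *\<^sub>R v"] a by (simp add: algebra_simps)
      finally show "r (a *\<^sub>R u) / a \<le> q (u + t *\<^sub>R v) - t * q v"
        using a by (simp add: field_simps)
    qed
    then show "r (a *\<^sub>R u) \<le> a * r u" using a by (simp add: field_simps)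
  next
    show "r 0 = 0"
    proof (rule antisym)
      show "r 0 \<le> 0" using r_le[of 0] sublinear_zero[OF q] by simp
      show "0 \<le> r 0" by (rule ge) (use sublinearD(2)[OF q] in simp)
    qed
  qed
  then have "r = q" by (rule min) (use r_le in \<open>auto simp: le_fun_def\<close>)
  then have "q (- v) \<le> - q v"
    using le[of 1 "- v"] sublinear_zero[OF q] by simp
  then show ?thesis using sublinear_minus[OF q, of v] by simp
qed

text \<open>Zorn's lemma for the reversed pointwise order yields a minimal sublinear function below
  \<open>q\<close>. It is odd, and subadditivity at \<open>- u\<close> and \<open>- v\<close> then
  reads as superadditivity at \<open>u\<close> and \<open>v\<close>.\<close>

theorem sublinear_dominates_linear:
  fixes q :: "'a::real_vector \<Rightarrow> real"
  assumes q: "sublinear q"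
  obtains l where "linear l" "\<And>u. l u \<le> q u"
proof -
  define A where "A = {r. sublinear r \<and> r \<le> q}"
  have A: "sublinear r" "r \<le> q" if "r \<in> A" for r using that by (auto simp: A_def)
  \<comment> \<open>The bound is common to all of \<open>A\<close>, so pointwise infima over chains
    are finite.\<close>
  have lower: "- q (- u) \<le> r u" if "r \<in> A" for r u
    using sublinear_minus[OF A(1)[OF that], of u] A(2)[OF that] by (smt (verit) le_fun_def)
  have "\<exists>m\<in>A. \<forall>a\<in>A. m \<ge> a \<longrightarrow> a = m"
  proof (rule predicate_Zorn)
    show "partial_order_on A (relation_of (\<lambda>a b. a \<ge> b) A)"
      by (auto simp: partial_order_on_def preorder_on_def refl_on_def trans_def antisym_def
          relation_of_def)
  next
    fix C assume C: "C \<in> Chains (relation_of (\<lambda>a b. a \<ge> b) A)"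
    then have CA: "C \<subseteq> A" by (auto simp: Chains_def relation_of_def)
    have total: "a \<le> b \<or> b \<le> a" if "a \<in> C" "b \<in> C" for a b
      using C that by (auto simp: Chains_def relation_of_def)
    show "\<exists>u\<in>A. \<forall>a\<in>C. u \<le> a"
    proof (cases "C = {}")
      case True
      then show ?thesis using q by (auto simp: A_def)
    next
      case False
      define r where "r u = (INF a\<in>C. a u)" for u
      have bdd: "bdd_below ((\<lambda>a. a u) ` C)" for u
        using lower CA by (intro bdd_belowI[of _ "- q (- u)"]) auto
      have le: "r u \<le> a u" if "a \<in> C" for a u
        unfolding r_def by (rule cINF_lower[OF bdd that])
      have ge: "c \<le> r u" if "\<And>a. a \<in> C \<Longrightarrow> c \<le> a u" for c u
        unfolding r_def by (rule cINF_greatest[OF False that])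
      have subl: "sublinear a" if "a \<in> C" for a using A(1) CA that by auto
      have "sublinear r"
      proof (rule sublinearI)
        fix u w
        have "r (u + w) - a u \<le> r w" if a: "a \<in> C" for a
        proof (rule ge)
          fix b assume b: "b \<in> C"
          \<comment> \<open>The smaller of the two members can serve both summands, so subadditivity
            of a single member suffices.\<close>
          from total[OF a b] show "r (u + w) - a u \<le> b w"
          proof
            assume "a \<le> b"
            then show ?thesis
              using le[OF a, of "u + w"] sublinearD(1)[OF subl[OF a], of u w]
              by (smt (verit) le_fun_def)
          next
            assume "b \<le> a"
            then show ?thesis
              using le[OF b, of "u + w"] sublinearD(1)[OF subl[OF b], of u w]
              by (smt (verit) le_fun_def)
          qed
        qed
        then have "r (u + w) - r w \<le> r u" by (intro ge) (simp add: algebra_simps)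
        then show "r (u + w) \<le> r u + r w" by simp
      next
        fix t :: real and u assume t: "0 < t"
        have "r (t *\<^sub>R u) / t \<le> r u"
        proof (rule ge)
          fix a assume a: "a \<in> C"
          show "r (t *\<^sub>R u) / t \<le> a u"
            using le[OF a, of "t *\<^sub>R u"] sublinearD(2)[OF subl[OF a], of t u] t
            by (simp add: field_simps)
        qed
        then show "r (t *\<^sub>R u) \<le> t * r u" using t by (simp add: field_simps)
      next
        obtain a where "a \<in> C" using False by auto
        then show "r 0 = 0"
          using le[of a 0] ge[of 0 0] sublinear_zero[OF subl] by (smt (verit))
      qed
      moreover from False obtain a where a: "a \<in> C" by auto
      have "r \<le> q"
        using le[OF a] A(2)[of a] a CA by (auto simp: le_fun_def intro: order_trans)
      ultimately show ?thesis using le by (auto simp: A_def le_fun_def intro!: bexI[of _ r])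
    qed
  qed
  then obtain m where m: "m \<in> A" and min: "\<And>a. a \<in> A \<Longrightarrow> a \<le> m \<Longrightarrow> a = m" by auto
  have sm: "sublinear m" using A(1)[OF m] .
  have odd: "m (- v) = - m v" for v
  proof (rule minimal_sublinear_odd[OF sm])
    fix r assume "sublinear r" "r \<le> m"
    then show "r = m" using A(2)[OF m] by (intro min) (auto simp: A_def)
  qed
  have "linear m"
  proof (rule linearI)
    fix u v
    show "m (u + v) = m u + m v"
      using sublinearD(1)[OF sm, of u v] sublinearD(1)[OF sm, of "- u" "- v"] odd[of u] odd[of v]
        odd[of "u + v"] by simp
  next
    fix t :: real and u
    show "m (t *\<^sub>R u) = t *\<^sub>R m u"
      using sublinearD(2)[OF sm, of t u] sublinearD(2)[OF sm, of "- t" u] odd[of "t *\<^sub>R u"]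
      by (cases "0 \<le> t") auto
  qed
  then show ?thesis using A(2)[OF m] by (intro that[of m]) (auto simp: le_fun_def)
qed

text \<open>The functional is obtained below the sublinear function
  \<open>v \<mapsto> inf \<epsilon> \<parallel>v - t h\<parallel> + t \<phi> h\<close> over \<open>t \<ge> 0\<close> and \<open>h \<in> C\<close>.\<close>

theorem convex_sandwich:
  fixes \<phi> :: "'a::real_normed_vector \<Rightarrow> real"
  assumes conv: "convex_on C \<phi>" and ne: "C \<noteq> {}"
    and lower: "\<And>h. h \<in> C \<Longrightarrow> - \<epsilon> * norm h \<le> \<phi> h" and eps: "0 \<le> \<epsilon>"
  obtains e :: "'a \<Rightarrow>\<^sub>L real" where "norm e \<le> \<epsilon>" "\<And>h. h \<in> C \<Longrightarrow> blinfun_apply e h \<le> \<phi> h"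
proof -
  have conv': "\<phi> (a *\<^sub>R x + b *\<^sub>R y) \<le> a * \<phi> x + b * \<phi> y"
    if "x \<in> C" "y \<in> C" "0 \<le> a" "0 \<le> b" "a + b = 1" for x y a b
    using conv that by (auto simp: convex_on_def)
  define S where "S v = {\<epsilon> * norm (v - t *\<^sub>R h) + t * \<phi> h | t h. 0 \<le> t \<and> h \<in> C}" for v
  define q where "q v = Inf (S v)" for v
  have low: "- \<epsilon> * norm v \<le> \<epsilon> * norm (v - t *\<^sub>R h) + t * \<phi> h" if "0 \<le> t" "h \<in> C" for v t h
  proof -
    have "- (t * (\<epsilon> * norm h)) \<le> t * \<phi> h"
      using mult_left_mono[OF lower[OF that(2)] that(1)] by simp
    moreover have "norm (t *\<^sub>R h) \<le> norm (v - t *\<^sub>R h) + norm v"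
      by (metis norm_minus_commute norm_triangle_sub add.commute)
    then have "t * (\<epsilon> * norm h) \<le> \<epsilon> * norm (v - t *\<^sub>R h) + \<epsilon> * norm v"
      using mult_left_mono[OF _ eps] that(1) by (fastforce simp: algebra_simps)
    ultimately show ?thesis by simp
  qed
  have bdd: "bdd_below (S v)" for v
    unfolding S_def using low by (intro bdd_belowI[of _ "- \<epsilon> * norm v"]) auto
  have neS: "S v \<noteq> {}" for v
  proof -
    obtain h where "h \<in> C" using ne by auto
    then have "\<epsilon> * norm (v - 0 *\<^sub>R h) + 0 * \<phi> h \<in> S v"
      unfolding S_def by (intro CollectI exI[of _ 0] exI[of _ h] conjI) auto
    then show ?thesis by auto
  qed
  have le: "q v \<le> \<epsilon> * norm (v - t *\<^sub>R h) + t * \<phi> h" if "0 \<le> t" "h \<in> C" for v t h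
    unfolding q_def by (rule cInf_lower[OF _ bdd]) (use that in \<open>auto simp: S_def\<close>)
  have ge: "c \<le> q v" if "\<And>t h. 0 \<le> t \<Longrightarrow> h \<in> C \<Longrightarrow> c \<le> \<epsilon> * norm (v - t *\<^sub>R h) + t * \<phi> h"
    for c v
    unfolding q_def by (rule cInf_greatest[OF neS]) (use that in \<open>auto simp: S_def\<close>)
  obtain h0 where h0: "h0 \<in> C" using ne by auto
  \<comment> \<open>The choice \<open>t = 0\<close> will bound the norm of the functional, and
    \<open>t = 1\<close> with \<open>v = h\<close> will put it below \<open>\<phi>\<close> on
    \<open>C\<close>.\<close>
  have q_norm: "q v \<le> \<epsilon> * norm v" for v using le[of 0 h0 v] h0 by simp
  have q_phi: "q h \<le> \<phi> h" if "h \<in> C" for h using le[of 1 h h] that by simp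
  have "sublinear q"
  proof (rule sublinearI)
    fix u v
    have *: "q (u + v) \<le> (\<epsilon> * norm (u - t *\<^sub>R h) + t * \<phi> h) + (\<epsilon> * norm (v - r *\<^sub>R k) + r * \<phi> k)"
      if t: "0 \<le> t" and h: "h \<in> C" and r: "0 \<le> r" and k: "k \<in> C" for t h r k
    proof (cases "t + r = 0")
      case True
      then have "t = 0" "r = 0" using t r by auto
      then show ?thesis
        using q_norm[of "u + v"] mult_left_mono[OF norm_triangle_ineq eps, of u v]
        by (simp add: algebra_simps)
    next
      case False
      then have tr: "0 < t + r" using t r by simp
      \<comment> \<open>The two scalings merge into the single factor \<open>t + r\<close> applied
        to a point of \<open>C\<close>, where convexity of \<open>\<phi>\<close> compares the
        values.\<close>
      define w where "w = (t / (t + r)) *\<^sub>R h + (r / (t + r)) *\<^sub>R k"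
      have sum1: "t / (t + r) + r / (t + r) = 1" using tr by (simp add: add_divide_distrib[symmetric])
      have w: "w \<in> C" unfolding w_def
        using convex_on_imp_convex[OF conv] h k t r sum1 by (intro convexD) auto
      have "\<phi> w \<le> t / (t + r) * \<phi> h + r / (t + r) * \<phi> k" unfolding w_def
        using h k t r sum1 by (intro conv') auto
      then have "(t + r) * \<phi> w \<le> (t + r) * (t / (t + r) * \<phi> h + r / (t + r) * \<phi> k)"
        using tr by (intro mult_left_mono) auto
      also have "\<dots> = t * \<phi> h + r * \<phi> k" using tr by (simp add: distrib_left)
      finally have 1: "(t + r) * \<phi> w \<le> t * \<phi> h + r * \<phi> k" .
      have "(t + r) *\<^sub>R w = t *\<^sub>R h + r *\<^sub>R k"
        unfolding w_def using tr by (simp add: scaleR_add_right)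
      then have "u + v - (t + r) *\<^sub>R w = (u - t *\<^sub>R h) + (v - r *\<^sub>R k)" by simp
      then have "norm (u + v - (t + r) *\<^sub>R w) \<le> norm (u - t *\<^sub>R h) + norm (v - r *\<^sub>R k)"
        by (metis norm_triangle_ineq)
      from mult_left_mono[OF this eps] 1 le[of "t + r" w "u + v"] tr w show ?thesis
        by (simp add: algebra_simps)
    qed
    have "q (u + v) - (\<epsilon> * norm (u - t *\<^sub>R h) + t * \<phi> h) \<le> q v" if "0 \<le> t" "h \<in> C" for t h
      by (rule ge) (use *[OF that] in \<open>simp add: algebra_simps\<close>)
    then have "q (u + v) - q v \<le> q u" by (intro ge) (simp add: algebra_simps)
    then show "q (u + v) \<le> q u + q v" by simp
  next
    fix a :: real and u assume a: "0 < a"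
    have "q (a *\<^sub>R u) / a \<le> q u"
    proof (rule ge)
      fix t :: real and h assume th: "0 \<le> t" "h \<in> C"
      have "q (a *\<^sub>R u) \<le> \<epsilon> * norm (a *\<^sub>R u - (a * t) *\<^sub>R h) + a * t * \<phi> h"
        using th a by (intro le) auto
      also have "a *\<^sub>R u - (a * t) *\<^sub>R h = a *\<^sub>R (u - t *\<^sub>R h)" by (simp add: algebra_simps)
      also have "norm \<dots> = a * norm (u - t *\<^sub>R h)" using a by simp
      finally show "q (a *\<^sub>R u) / a \<le> \<epsilon> * norm (u - t *\<^sub>R h) + t * \<phi> h"
        using a by (simp add: field_simps)
    qed
    then show "q (a *\<^sub>R u) \<le> a * q u" using a by (simp add: field_simps)
  next
    show "q 0 = 0"
    proof (rule antisym)
      show "q 0 \<le> 0" using q_norm[of 0] by simp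
      have "0 \<le> \<epsilon> * norm (0 - t *\<^sub>R h) + t * \<phi> h" if "0 \<le> t" "h \<in> C" for t h
        using low[OF that, of 0] by simp
      then show "0 \<le> q 0" by (rule ge)
    qed
  qed
  then obtain l where l: "linear l" "\<And>u. l u \<le> q u" by (rule sublinear_dominates_linear) auto
  have bound: "\<bar>l u\<bar> \<le> \<epsilon> * norm u" for u
    using l(2)[of u] l(2)[of "- u"] q_norm[of u] q_norm[of "- u"] linear_neg[OF l(1), of u] by simp
  have "bounded_linear l"
    by (rule bounded_linear_intro[where K = \<epsilon>])
      (use bound linear_add[OF l(1)] linear_scale[OF l(1)] in \<open>auto simp: mult.commute\<close>)
  then have app: "blinfun_apply (Blinfun l) = l" by (rule bounded_linear_Blinfun_apply)
  show ?thesis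
  proof (rule that)
    show "norm (Blinfun l) \<le> \<epsilon>" by (rule norm_blinfun_bound[OF eps]) (use bound app in auto)
    show "blinfun_apply (Blinfun l) h \<le> \<phi> h" if "h \<in> C" for h
      using l(2)[of h] q_phi[OF that] app by simp
  qed
qed

text \<open>A sandwich over the single point \<open>- v\<close>: an upper bound
  \<open>- norm v\<close> there is the lower bound \<open>norm v\<close> at
  \<open>v\<close>.\<close>

corollary norming_functional:
  fixes v :: "'a::real_normed_vector"
  obtains j :: "'a \<Rightarrow>\<^sub>L real" where "norm j \<le> 1" "blinfun_apply j v = norm v"
proof -
  have "convex_on {- v} (\<lambda>_. - norm v)" by (simp add: convex_on_const)
  then obtain j :: "'a \<Rightarrow>\<^sub>L real"
    where j: "norm j \<le> 1" "\<And>h. h \<in> {- v} \<Longrightarrow> blinfun_apply j h \<le> - norm v"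
    by (rule convex_sandwich[where \<epsilon> = 1]) auto
  have "blinfun_apply j v \<le> norm v"
    using norm_blinfun[of j v] mult_right_mono[OF j(1) norm_ge_zero[of v]] by simp
  then have "blinfun_apply j v = norm v" using j(2)[of "- v"] by (simp add: blinfun.minus_right)
  then show ?thesis using that j(1) by blast
qed

corollary blinfun_separates:
  fixes u v :: "'a::real_normed_vector"
  assumes "\<And>h :: 'a \<Rightarrow>\<^sub>L real. blinfun_apply h u = blinfun_apply h v"
  shows "u = v"
proof -
  obtain j :: "'a \<Rightarrow>\<^sub>L real" where "blinfun_apply j (u - v) = norm (u - v)"
    by (rule norming_functional)
  then show ?thesis using assms[of j] by (simp add: blinfun.diff_right)
qed

section \<open>The duality mapping of a uniformly smooth space\<close>

text \<open>The supremum of an unbounded set of reals is unspecified, so boundedness by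
  \<open>max 0 t\<close> has to come before any use of \<open>Sup\<close>.\<close>

lemma smoothness_modulus_upper:
  fixes u v :: "'a::real_normed_vector"
  assumes "norm u = 1" "norm v \<le> t"
  shows "norm (u + v) + norm (u - v) \<le> 2 + 2 * smoothness_modulus TYPE('a) t"
proof -
  let ?S = "insert 0 {(norm (u + v) + norm (u - v)) / 2 - 1 | u v :: 'a. norm u = 1 \<and> norm v \<le> t}"
  have "bdd_above ?S"
  proof (rule bdd_aboveI[of _ "max 0 t"])
    fix a assume "a \<in> ?S"
    then consider "a = 0"
      | u v :: 'a where "a = (norm (u + v) + norm (u - v)) / 2 - 1" "norm u = 1" "norm v \<le> t"
      by auto
    then show "a \<le> max 0 t"
    proof cases
      case (2 u v)
      then show ?thesis 
        using norm_triangle_ineq[of u v] norm_triangle_ineq4[of u v] max.cobounded2[of t 0]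
        unfolding add_divide_distrib by linarith
    qed simp
  qed
  then have "(norm (u + v) + norm (u - v)) / 2 - 1 \<le> Sup ?S"
    by (intro cSup_upper) (use assms in auto)
  then show ?thesis by (simp add: smoothness_modulus_def field_simps)
qed

text \<open>\<open>j\<close> is tested at \<open>u + v\<close> and \<open>k\<close> at
  \<open>u - v\<close>, where \<open>k u\<close> is at least \<open>1 - norm (u - w)\<close>. For
  \<open>u = w\<close> and \<open>t\<close> tending to 0 this gives uniqueness of the duality
  mapping, and for \<open>w\<close> tending to \<open>u\<close> its continuity.\<close>

lemma norming_functionals_dist:
  fixes u w :: "'a::real_normed_vector" and j k :: "'a \<Rightarrow>\<^sub>L real"
  assumes u: "norm u = 1" and w: "norm w = 1" and j: "norm j \<le> 1" "blinfun_apply j u = 1"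
    and k: "norm k \<le> 1" "blinfun_apply k w = 1" and t: "0 < t"
  shows "norm (j - k) \<le> 2 * (smoothness_modulus TYPE('a) t / t) + norm (u - w) / t"
proof -
  let ?B = "2 * smoothness_modulus TYPE('a) t + norm (u - w)"
  have le: "blinfun_apply l a \<le> norm a" if "norm l \<le> 1" for l :: "'a \<Rightarrow>\<^sub>L real" and a
    using norm_blinfun[of l a] mult_right_mono[OF that norm_ge_zero[of a]] by simp
  have B: "blinfun_apply (j - k) v \<le> ?B" if v: "norm v \<le> t" for v
  proof -
    have "blinfun_apply j (u + v) \<le> norm (u + v)" "blinfun_apply k (u - v) \<le> norm (u - v)"
      using le j(1) k(1) by blast+
    moreover have "blinfun_apply k (w - u) \<le> norm (u - w)"
      using le[OF k(1), of "w - u"] by (simp add: norm_minus_commute)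
    ultimately show ?thesis
      using smoothness_modulus_upper[OF u v] j(2) k(2)
      by (simp add: blinfun.add_right blinfun.diff_right blinfun.diff_left)
  qed
  have "norm (j - k) \<le> ?B / t"
  proof (rule norm_blinfun_bound)
    show "0 \<le> ?B / t" using B[of 0] t by (simp add: blinfun.zero_right)
    fix a show "norm (blinfun_apply (j - k) a) \<le> ?B / t * norm a"
    proof (cases "a = 0")
      case False
      let ?v = "(t / norm a) *\<^sub>R a"
      have "norm ?v \<le> t" "norm (- ?v) \<le> t" using False t by auto
      from B[OF this(1)] B[OF this(2)]
      have "\<bar>blinfun_apply (j - k) ?v\<bar> \<le> ?B" by (simp only: blinfun.minus_right)
      then have "t / norm a * \<bar>blinfun_apply (j - k) a\<bar> \<le> ?B"
        using t by (simp only: blinfun.scaleR_right) (simp add: abs_mult)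
      then show ?thesis using False t by (simp add: field_simps)
    qed (simp add: blinfun.zero_right)
  qed
  then show ?thesis by (simp add: add_divide_distrib)
qed

lemma duality_map_normalize:
  fixes v :: "'a::real_normed_vector" and j :: "'a \<Rightarrow>\<^sub>L real"
  assumes "v \<noteq> 0" "norm j = norm v powr (s - 1)" "blinfun_apply j v = norm v powr s"
  shows "norm ((1 / norm v powr (s - 1)) *\<^sub>R j) \<le> 1"
    and "blinfun_apply ((1 / norm v powr (s - 1)) *\<^sub>R j) (sgn v) = 1"
  using assms by (auto simp: sgn_div_norm blinfun.scaleR_left blinfun.scaleR_right powr_diff)

text \<open>\<open>duality_map\<close> is a definite description and becomes usable only through
  this. Existence rescales a norming functional; two candidates, once normalised, differ by at most
  twice the modulus over \<open>t\<close>, for every positive \<open>t\<close>.\<close>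

lemma ex1_duality_map:
  fixes v :: "'a::real_normed_vector"
  assumes smooth: "uniformly_smooth TYPE('a)" and s: "s > 1"
  shows "\<exists>!j. norm j = norm v powr (s - 1) \<and> blinfun_apply j v = norm v powr s"
proof (cases "v = 0")
  case True
  then show ?thesis using s by (auto intro!: ex1I[of _ 0])
next
  case False
  obtain j0 :: "'a \<Rightarrow>\<^sub>L real" where j0: "norm j0 \<le> 1" "blinfun_apply j0 v = norm v"
    by (rule norming_functional)
  have "norm v \<le> norm j0 * norm v" using norm_blinfun[of j0 v] j0(2) by simp
  then have "norm j0 = 1" using False j0(1) by simp
  then have "norm (norm v powr (s - 1) *\<^sub>R j0) = norm v powr (s - 1)"
    "blinfun_apply (norm v powr (s - 1) *\<^sub>R j0) v = norm v powr s"
    using j0(2) False by (auto simp: blinfun.scaleR_left powr_diff)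
  moreover have "j = k"
    if j: "norm j = norm v powr (s - 1)" "blinfun_apply j v = norm v powr s"
      and k: "norm k = norm v powr (s - 1)" "blinfun_apply k v = norm v powr s"
    for j k :: "'a \<Rightarrow>\<^sub>L real"
  proof -
    let ?c = "1 / norm v powr (s - 1)"
    note nj = duality_map_normalize[OF False j] and nk = duality_map_normalize[OF False k]
    have "norm (?c *\<^sub>R j - ?c *\<^sub>R k) \<le> 0"
    proof (rule tendsto_lowerbound)
      show "((\<lambda>t. 2 * (smoothness_modulus TYPE('a) t / t)) \<longlongrightarrow> 0) (at_right 0)"
        using tendsto_mult_right_zero[OF smooth[unfolded uniformly_smooth_def], of 2] .
      show "\<forall>\<^sub>F t in at_right 0. norm (?c *\<^sub>R j - ?c *\<^sub>R k) \<le> 2 * (smoothness_modulus TYPE('a) t / t)"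
        using eventually_at_right_less[of "0::real"]
      proof eventually_elim
        case (elim t)
        show ?case
          using norming_functionals_dist[OF _ _ nj nk elim] False by (simp add: norm_sgn)
      qed
    qed simp
    then show ?thesis using False by simp
  qed
  ultimately show ?thesis by blast
qed

lemma
  fixes v :: "'a::real_normed_vector"
  assumes "uniformly_smooth TYPE('a)" and "s > 1"
  shows norm_duality_map: "norm (duality_map s v) = norm v powr (s - 1)"
    and duality_map_apply: "blinfun_apply (duality_map s v) v = norm v powr s"
  unfolding duality_map_def using theI'[OF ex1_duality_map[OF assms, of v]] by auto

text \<open>The values are normalised to norm at most 1, compared there, and rescaled by the gauge.
  At 0 the normalisation breaks down; vanishing residuals are treated in
  \<open>gradient_step_lim_solved\<close>.\<close>

lemma isCont_duality_map:
  fixes v :: "'a::real_normed_vector"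
  assumes smooth: "uniformly_smooth TYPE('a)" and s: "s > 1" and v: "v \<noteq> 0"
  shows "isCont (duality_map s) v"
proof -
  define N where "N w = (1 / norm w powr (s - 1)) *\<^sub>R duality_map s w" for w :: 'a
  have N: "norm (N w) \<le> 1" "blinfun_apply (N w) (sgn w) = 1" if "w \<noteq> 0" for w
    unfolding N_def
    using duality_map_normalize[OF that norm_duality_map[OF smooth s] duality_map_apply[OF smooth s]]
    by auto
  have ne: "\<forall>\<^sub>F w in at v. w \<noteq> 0"
    using tendsto_imp_eventually_ne[OF tendsto_ident_at v] .
  have "(N \<longlongrightarrow> N v) (at v)"
  proof (rule tendstoI)
    fix e :: real assume e: "0 < e"
    \<comment> \<open>\<open>t\<close> is fixed before \<open>w\<close> moves: the modulus term
      takes one half of \<open>e\<close>, the distance term divided by this \<open>t\<close> the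
      other.\<close>
    have "\<forall>\<^sub>F t in at_right 0. smoothness_modulus TYPE('a) t / t < e / 4"
      using smooth[unfolded uniformly_smooth_def] e by (intro order_tendstoD(2)) auto
    with eventually_at_right_less[of "0::real"]
    have "\<forall>\<^sub>F t in at_right 0. smoothness_modulus TYPE('a) t / t < e / 4 \<and> 0 < t"
      by eventually_elim simp
    then obtain t where t: "smoothness_modulus TYPE('a) t / t < e / 4" "0 < t"
      using eventually_happens'[OF trivial_limit_at_right_real] by blast
    have "((\<lambda>w. norm (sgn w - sgn v) / t) \<longlongrightarrow> norm (sgn v - sgn v) / t) (at v)"
      using t(2) v by (intro tendsto_intros) auto
    then have "\<forall>\<^sub>F w in at v. norm (sgn w - sgn v) / t < e / 2"
      using e by (intro order_tendstoD(2)) auto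
    with ne show "\<forall>\<^sub>F w in at v. dist (N w) (N v) < e"
    proof eventually_elim
      case (elim w)
      then have "norm (N w - N v)
          \<le> 2 * (smoothness_modulus TYPE('a) t / t) + norm (sgn w - sgn v) / t"
        using N v t(2) by (intro norming_functionals_dist) (auto simp: norm_sgn)
      then show ?case using t(1) elim unfolding dist_norm by linarith
    qed
  qed
  then have "((\<lambda>w. norm w powr (s - 1) *\<^sub>R N w) \<longlongrightarrow> norm v powr (s - 1) *\<^sub>R N v) (at v)"
    using v by (intro tendsto_intros) auto
  moreover have "norm w powr (s - 1) *\<^sub>R N w = duality_map s w" if "w \<noteq> 0" for w
    using that by (simp add: N_def)
  ultimately have "(duality_map s \<longlongrightarrow> duality_map s v) (at v)"
    using v by (auto intro: Lim_transform_eventually eventually_mono[OF ne])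
  then show ?thesis by (simp add: isCont_def)
qed

section \<open>Ekeland's variational principle\<close>

text \<open>Closed sublevel sets express lower semicontinuity of \<open>h\<close> extended by
  infinity outside \<open>C\<close>. So \<open>C\<close> itself may fail to be closed, as an
  effective domain can.\<close>

theorem ekeland_variational_principle:
  fixes h :: "'a::complete_space \<Rightarrow> real"
  assumes closed: "\<And>c. closed {x \<in> C. h x \<le> c}" and lower: "\<And>x. x \<in> C \<Longrightarrow> m \<le> h x"
    and ne: "C \<noteq> {}" and eps: "0 < \<epsilon>"
  obtains x where "x \<in> C" "\<And>z. z \<in> C \<Longrightarrow> h x \<le> h z + \<epsilon> * dist z x"
proof -
  define S where "S x = {z \<in> C. h z + \<epsilon> * dist z x \<le> h x}" for x
  have trans: "w \<in> S x" if "z \<in> S x" "w \<in> S z" for x z w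
  proof -
    have "\<epsilon> * dist w x \<le> \<epsilon> * (dist w z + dist z x)"
      using eps by (intro mult_left_mono dist_triangle) auto
    then show ?thesis using that by (simp add: S_def algebra_simps)
  qed
  have refl: "x \<in> S x" if "x \<in> C" for x using that by (simp add: S_def)
  obtain f where fC: "\<And>n. f n \<in> C"
    and fS: "\<And>n. f (Suc n) \<in> S (f n)"
    and finf: "\<And>n z. z \<in> S (f n) \<Longrightarrow> h (f (Suc n)) \<le> h z + 1 / real (Suc n)"
  proof -
    have "\<exists>f. \<forall>n. f n \<in> C \<and>
      (f (Suc n) \<in> S (f n) \<and> (\<forall>z\<in>S (f n). h (f (Suc n)) \<le> h z + 1 / real (Suc n)))"
    proof (rule dependent_nat_choice)
      show "\<exists>x. x \<in> C" using ne by auto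
      fix x n assume x: "x \<in> C"
      let ?I = "Inf (h ` S x)"
      have bdd: "bdd_below (h ` S x)"
        using lower by (intro bdd_belowI[of _ m]) (auto simp: S_def)
      have "\<exists>a\<in>h ` S x. a < ?I + 1 / real (Suc n)"
        by (rule cInf_lessD) (use refl[OF x] in auto)
      then obtain w where w: "w \<in> S x" "h w < ?I + 1 / real (Suc n)" by auto
      have "h w \<le> h z + 1 / real (Suc n)" if "z \<in> S x" for z
        using cInf_lower[OF imageI[OF that, of h] bdd] w(2) by simp
      then show "\<exists>y. y \<in> C \<and> y \<in> S x \<and> (\<forall>z\<in>S x. h y \<le> h z + 1 / real (Suc n))"
        using w(1) by (auto simp: S_def)
    qed
    then show ?thesis using that by auto
  qed
  have chain: "f k \<in> S (f n)" if "n \<le> k" for n k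
    using that
  proof (induction k rule: dec_induct)
    case base
    show ?case using refl fC by blast
  next
    case (step k)
    show ?case by (rule trans[OF step.IH fS])
  qed
  have dec: "h (f k) + \<epsilon> * dist (f k) (f n) \<le> h (f n)" if "n \<le> k" for n k
    using chain[OF that] by (simp add: S_def)
  have "decseq (\<lambda>n. h (f n))"
    unfolding decseq_def using dec eps by (smt (verit) mult_nonneg_nonneg zero_le_dist)
  then obtain l where l: "(\<lambda>n. h (f n)) \<longlonglongrightarrow> l"
    by (rule decseq_convergent[of _ m]) (use lower fC in auto)
  have "Cauchy f"
  proof (rule metric_CauchyI)
    fix e :: real assume e: "0 < e"
    obtain N where N: "\<And>k n. k \<ge> N \<Longrightarrow> n \<ge> N \<Longrightarrow> dist (h (f k)) (h (f n)) < \<epsilon> * e"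
      using metric_CauchyD[OF LIMSEQ_imp_Cauchy[OF l], of "\<epsilon> * e"] eps e by auto
    have le: "dist (f k) (f n) < e" if "n \<ge> N" "n \<le> k" for k n
    proof -
      have "\<epsilon> * dist (f k) (f n) < \<epsilon> * e"
        using dec[OF that(2)] N[of k n] that by (auto simp: dist_real_def)
      then show ?thesis using eps by simp
    qed
    show "\<exists>M. \<forall>k\<ge>M. \<forall>n\<ge>M. dist (f k) (f n) < e"
      using le by (metis dist_commute linear)
  qed
  then obtain x where x: "f \<longlonglongrightarrow> x" using Cauchy_convergent convergent_def by blast
  have xS: "x \<in> S (f n)" for n
  proof -
    \<comment> \<open>A sublevel set needs a fixed level, but the distance to \<open>f n\<close>
      still varies with \<open>k\<close>; the slack \<open>e\<close> absorbs this.\<close>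
    have approx: "x \<in> C \<and> h x \<le> h (f n) - \<epsilon> * dist x (f n) + e" if e: "0 < e" for e
    proof -
      have "(\<lambda>k. \<epsilon> * dist (f k) (f n)) \<longlonglongrightarrow> \<epsilon> * dist x (f n)" using x by (intro tendsto_intros)
      then have "\<forall>\<^sub>F k in sequentially. \<epsilon> * dist x (f n) - e < \<epsilon> * dist (f k) (f n)"
        using e by (intro order_tendstoD(1)) auto
      with eventually_ge_at_top[of n]
      have "\<forall>\<^sub>F k in sequentially. f k \<in> {a \<in> C. h a \<le> h (f n) - \<epsilon> * dist x (f n) + e}"
      proof eventually_elim
        case (elim k)
        then show ?case using dec[of n k] fC by simp
      qed
      then have "x \<in> {a \<in> C. h a \<le> h (f n) - \<epsilon> * dist x (f n) + e}"
        using closed x by (intro Lim_in_closed_set[of _ f]) auto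
      then show ?thesis by simp
    qed
    have "h x \<le> h (f n) - \<epsilon> * dist x (f n)"
      by (rule field_le_epsilon) (rule approx[THEN conjunct2])
    then show ?thesis using approx[of 1] by (simp add: S_def)
  qed
  show ?thesis
  proof (rule that)
    show "x \<in> C" using xS by (simp add: S_def)
    fix z assume z: "z \<in> C"
    show "h x \<le> h z + \<epsilon> * dist z x"
    proof (rule ccontr)
      assume not: "\<not> ?thesis"
      then have "z \<in> S x" using z by (simp add: S_def)
      \<comment> \<open>Such a \<open>z\<close> competes in every near-minimisation, and the errors
        tend to 0, so it cannot lie strictly below \<open>h x\<close>.\<close>
      then have zS: "z \<in> S (f n)" for n using trans xS by blast
      have "h x \<le> h z + 1 / real (Suc n)" for n
        using finf[OF zS, of n] xS[of "Suc n"] eps by (smt (verit) S_def mem_Collect_eq mult_nonneg_nonneg zero_le_dist)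
      then have "h x \<le> h z"
        using LIMSEQ_inverse_real_of_nat_add[of "h z"]
        by (intro LIMSEQ_le_const[of "\<lambda>n. h z + inverse (real (Suc n))"]) (auto simp: inverse_eq_divide)
      then show False using not eps by (smt (verit) mult_nonneg_nonneg zero_le_dist)
    qed
  qed
qed

section \<open>The conjugate of a p-convex functional\<close>

text \<open>\<open>p_convex\<close> says nothing where there are no subgradients; one subgradient
  somewhere starts the growth estimate. In the iteration \<open>\<xi>0\<close> provides it.\<close>

locale p_convex_functional =
  fixes \<Theta> :: "'x::banach \<Rightarrow> ereal" and p c0 :: real
  assumes proper: "proper_functional \<Theta>" and convex: "convex_functional \<Theta>"
    and lsc: "weakly_lsc \<Theta>" and p_convex: "p_convex \<Theta> p c0"
    and p_gt_1: "1 < p" and c0_pos: "0 < c0"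
    and subdifferentiable: "\<exists>x \<xi>. \<xi> \<in> subdifferential \<Theta> x"
begin

abbreviation "edom \<equiv> eff_domain \<Theta>"

text \<open>Off the effective domain \<open>real_of_ereal\<close> gives the default 0, so the
  subgradient inequality for \<open>val\<close> has to be restricted to \<open>edom\<close>.\<close>

definition val :: "'x \<Rightarrow> real" where "val z = real_of_ereal (\<Theta> z)"

definition conjv :: "('x \<Rightarrow>\<^sub>L real) \<Rightarrow> real" where "conjv \<xi> = real_of_ereal (conjugate \<Theta> \<xi>)"

abbreviation grad :: "('x \<Rightarrow>\<^sub>L real) \<Rightarrow> 'x" where "grad \<equiv> grad_conjugate \<Theta>"

text \<open>The Bregman distance from \<open>grad \<xi>\<close> to \<open>z\<close> with respect to \<open>\<xi>\<close>, see \<open>bregman_grad\<close>.\<close>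

definition breg :: "('x \<Rightarrow>\<^sub>L real) \<Rightarrow> 'x \<Rightarrow> real" where
  "breg \<xi> z = val z + conjv \<xi> - blinfun_apply \<xi> z"

lemma ereal_val: "z \<in> edom \<Longrightarrow> \<Theta> z = ereal (val z)"
  using proper unfolding proper_functional_def eff_domain_def val_def
  by (cases "\<Theta> z") auto

lemma not_dom: "z \<notin> edom \<Longrightarrow> \<Theta> z = \<infinity>"
  by (simp add: eff_domain_def)

lemma domI: "\<Theta> z \<le> ereal c \<Longrightarrow> z \<in> edom"
  using not_dom[of z] by (cases "z \<in> edom") auto

lemma dom_nonempty: "edom \<noteq> {}"
  using proper unfolding proper_functional_def eff_domain_def by auto

section \<open>Subgradients and p-convexity in terms of real values\<close>

lemma subdifferential_iff:
  "\<xi> \<in> subdifferential \<Theta> x \<longleftrightarrow>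
     x \<in> edom \<and> (\<forall>z\<in>edom. val x + blinfun_apply \<xi> (z - x) \<le> val z)"
proof
  assume \<xi>: "\<xi> \<in> subdifferential \<Theta> x"
  have *: "\<Theta> x + ereal (blinfun_apply \<xi> (z - x)) \<le> \<Theta> z" for z
    using \<xi> by (simp add: subdifferential_def)
  have x: "x \<in> edom"
  proof (rule ccontr)
    assume "x \<notin> edom"
    then have "\<Theta> z = \<infinity>" for z using *[of z] not_dom[of x] by simp
    then show False using proper by (auto simp: proper_functional_def)
  qed
  then show "x \<in> edom \<and> (\<forall>z\<in>edom. val x + blinfun_apply \<xi> (z - x) \<le> val z)"
    using * ereal_val by (metis ereal_less_eq(3) plus_ereal.simps(1))
next
  assume \<xi>: "x \<in> edom \<and> (\<forall>z\<in>edom. val x + blinfun_apply \<xi> (z - x) \<le> val z)"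
  have "\<Theta> x + ereal (blinfun_apply \<xi> (z - x)) \<le> \<Theta> z" for z
    using \<xi> by (cases "z \<in> edom") (auto simp: ereal_val not_dom)
  then show "\<xi> \<in> subdifferential \<Theta> x" by (simp add: subdifferential_def)
qed

lemma subgradientD:
  assumes "\<xi> \<in> subdifferential \<Theta> x"
  shows "x \<in> edom" and "z \<in> edom \<Longrightarrow> val x + blinfun_apply \<xi> (z - x) \<le> val z"
  using assms by (auto simp: subdifferential_iff)

lemma bregman_eq:
  assumes "x \<in> edom" "z \<in> edom"
  shows "bregman \<Theta> \<xi> z x = ereal (val z - val x - blinfun_apply \<xi> (z - x))"
  using assms by (simp add: bregman_def ereal_val)

lemma p_convexD:
  assumes "\<xi> \<in> subdifferential \<Theta> x" "z \<in> edom"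
  shows "c0 * norm (z - x) powr p \<le> val z - val x - blinfun_apply \<xi> (z - x)"
proof -
  have "ereal (c0 * norm (z - x) powr p) \<le> bregman \<Theta> \<xi> z x"
    using p_convex assms(1) by (auto simp: p_convex_def)
  then show ?thesis using bregman_eq[OF subgradientD(1)[OF assms(1)] assms(2)] by simp
qed

lemma powr_split: "0 \<le> d \<Longrightarrow> d powr p = d * d powr (p - 1)" for d :: real
  by (cases "d = 0") (auto simp: powr_diff)

text \<open>The p-convexity inequalities at both points are added and the values cancel. This is the
  origin of \<open>2 * c0\<close> in the Hoelder bound and in \<open>\<kappa>\<close>.\<close>

lemma subdifferential_strongly_monotone:
  assumes \<xi>: "\<xi> \<in> subdifferential \<Theta> x" and \<omega>: "\<omega> \<in> subdifferential \<Theta> z"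
  shows "2 * c0 * norm (x - z) powr (p - 1) \<le> norm (\<xi> - \<omega>)"
proof (cases "x = z")
  case False
  let ?d = "norm (x - z)"
  have "blinfun_apply \<xi> (z - x) = - blinfun_apply \<xi> (x - z)"
    by (metis blinfun.minus_right minus_diff_eq)
  then have "2 * c0 * ?d powr p \<le> blinfun_apply (\<xi> - \<omega>) (x - z)"
    using p_convexD[OF \<xi> subgradientD(1)[OF \<omega>]] p_convexD[OF \<omega> subgradientD(1)[OF \<xi>]]
    by (simp add: norm_minus_commute blinfun.diff_left)
  also have "\<dots> \<le> norm (\<xi> - \<omega>) * ?d"
    using norm_blinfun[of "\<xi> - \<omega>" "x - z"] by simp
  finally have "(2 * c0 * ?d powr (p - 1)) * ?d \<le> norm (\<xi> - \<omega>) * ?d"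
    using powr_split[of ?d] by (simp add: mult_ac)
  then show ?thesis using False by simp
qed simp

lemma subdifferential_inverse_Holder:
  assumes "\<xi> \<in> subdifferential \<Theta> x" and "\<omega> \<in> subdifferential \<Theta> z"
  shows "norm (x - z) \<le> (norm (\<xi> - \<omega>) / (2 * c0)) powr (1 / (p - 1))"
proof -
  have "norm (x - z) = (norm (x - z) powr (p - 1)) powr (1 / (p - 1))"
    using p_gt_1 by (simp add: powr_powr)
  also have "\<dots> \<le> (norm (\<xi> - \<omega>) / (2 * c0)) powr (1 / (p - 1))"
    using subdifferential_strongly_monotone[OF assms] c0_pos p_gt_1
    by (intro powr_mono2) (auto simp: field_simps)
  finally show ?thesis .
qed

text \<open>The bound may depend on \<open>n\<close>, so that linear terms evaluated along the
  sequence can be kept on its side.\<close>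

lemma val_lsc:
  assumes u: "u \<longlonglongrightarrow> x" and edom: "\<And>n. u n \<in> edom" and le: "\<And>n. val (u n) \<le> v n"
    and v: "v \<longlonglongrightarrow> c"
  shows "x \<in> edom" and "val x \<le> c"
proof -
  have "weakly_converges u x"
    unfolding weakly_converges_def using u by (auto intro!: tendsto_intros)
  then have "\<Theta> x \<le> liminf (\<lambda>n. \<Theta> (u n))" using lsc by (simp add: weakly_lsc_def)
  also have "\<dots> \<le> liminf (\<lambda>n. ereal (v n))"
    by (rule Liminf_mono) (use le edom ereal_val in auto)
  also have "\<dots> = ereal c"
    using v by (intro lim_imp_Liminf) auto
  finally have "\<Theta> x \<le> ereal c" .
  then show "x \<in> edom" by (rule domI)
  then show "val x \<le> c" using \<open>\<Theta> x \<le> ereal c\<close> ereal_val by simp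
qed

lemma convex_on_val: "convex_on edom val"
proof -
  have le: "\<Theta> ((1 - t) *\<^sub>R x + t *\<^sub>R y) \<le> ereal ((1 - t) * val x + t * val y)"
    if "0 \<le> t" "t \<le> 1" "x \<in> edom" "y \<in> edom" for t x y
  proof -
    have "\<Theta> ((1 - t) *\<^sub>R x + t *\<^sub>R y) \<le> ereal (1 - t) * \<Theta> x + ereal t * \<Theta> y"
      using convex that(1,2) unfolding convex_functional_def by blast
    then show ?thesis using that(3,4) by (simp add: ereal_val)
  qed
  have "convex edom"
    unfolding convex_alt using le domI by blast
  moreover have "val ((1 - t) *\<^sub>R x + t *\<^sub>R y) \<le> (1 - t) * val x + t * val y"
    if "0 < t" "t < 1" "x \<in> edom" "y \<in> edom" for t x y
    using le[of t x y] that ereal_val[OF domI[OF le[of t x y]]] by simp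
  ultimately show ?thesis by (intro convex_onI)
qed

section \<open>Every functional is a subgradient\<close>

lemma tilted_bounded_below:
  obtains m where "\<And>z. z \<in> edom \<Longrightarrow> m \<le> val z - blinfun_apply \<xi> z"
proof -
  obtain x1 \<xi>1 where 1: "\<xi>1 \<in> subdifferential \<Theta> x1" using subdifferentiable by blast
  define N where "N = norm (\<xi>1 - \<xi>)"
  \<comment> \<open>At the radius \<open>R\<close> the growth \<open>c0 * r powr p\<close> balances
    the linear term \<open>N * r\<close>; beyond it the growth wins, inside it the linear term costs
    at most \<open>N * R\<close>.\<close>
  define R where "R = (N / c0) powr (1 / (p - 1))"
  show ?thesis
  proof (rule that)
    fix z assume z: "z \<in> edom"
    define r where "r = norm (z - x1)"
    have "- (N * r) \<le> blinfun_apply (\<xi>1 - \<xi>) (z - x1)"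
      unfolding N_def r_def using norm_blinfun[of "\<xi>1 - \<xi>" "z - x1"] by simp
    then have "val x1 - blinfun_apply \<xi> x1 + (c0 * r powr p - N * r) \<le> val z - blinfun_apply \<xi> z"
      using p_convexD[OF 1 z] by (simp add: r_def blinfun.diff_left blinfun.diff_right)
    moreover have "- (N * R) \<le> c0 * r powr p - N * r"
    proof (cases "r \<le> R")
      case True
      then have "N * r \<le> N * R" by (intro mult_left_mono) (auto simp: N_def)
      moreover have "0 \<le> c0 * r powr p" using c0_pos by simp
      ultimately show ?thesis by simp
    next
      case False
      then have "R powr (p - 1) \<le> r powr (p - 1)"
        using p_gt_1 by (intro powr_mono2) (auto simp: R_def)
      then have "N / c0 \<le> r powr (p - 1)"
        using p_gt_1 c0_pos by (simp add: R_def powr_powr N_def)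
      then have "N * r \<le> c0 * r powr (p - 1) * r"
        using c0_pos by (intro mult_right_mono) (auto simp: field_simps r_def)
      then have "N * r \<le> c0 * r powr p"
        using powr_split[of r] by (simp add: r_def mult_ac)
      moreover have "0 \<le> N * R" by (simp add: N_def R_def)
      ultimately show ?thesis by simp
    qed
    ultimately show "val x1 - blinfun_apply \<xi> x1 - N * R \<le> val z - blinfun_apply \<xi> z" by simp
  qed
qed

text \<open>At an Ekeland point the convex increment \<open>\<phi>\<close> of the tilted functional
  lies above \<open>- \<epsilon> * norm k\<close>. A functional squeezed between the two, supplied
  by the sandwich theorem, is the perturbation \<open>e\<close>.\<close>

lemma nearby_subgradient:
  assumes eps: "0 < \<epsilon>"
  obtains x e where "\<xi> + e \<in> subdifferential \<Theta> x" "norm e \<le> \<epsilon>"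
proof -
  define h where "h z = val z - blinfun_apply \<xi> z" for z
  obtain m where m: "\<And>z. z \<in> edom \<Longrightarrow> m \<le> h z"
    using tilted_bounded_below[of \<xi>] unfolding h_def by blast
  have "closed {x \<in> edom. h x \<le> c}" for c
  proof (unfold closed_sequential_limits, intro allI impI)
    fix u x assume u: "(\<forall>n. u n \<in> {x \<in> edom. h x \<le> c}) \<and> u \<longlonglongrightarrow> x"
    then have "(\<lambda>n. c + blinfun_apply \<xi> (u n)) \<longlonglongrightarrow> c + blinfun_apply \<xi> x"
      by (intro tendsto_intros) auto
    then show "x \<in> {x \<in> edom. h x \<le> c}"
      using val_lsc[of u x "\<lambda>n. c + blinfun_apply \<xi> (u n)"] u by (auto simp: h_def algebra_simps)
  qed
  then obtain x where x: "x \<in> edom" "\<And>z. z \<in> edom \<Longrightarrow> h x \<le> h z + \<epsilon> * dist z x"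
    by (rule ekeland_variational_principle[of edom h m \<epsilon>]) (use m dom_nonempty eps in auto)
  define \<phi> where "\<phi> k = h (x + k) - h x" for k
  let ?C = "(\<lambda>z. z - x) ` edom"
  have C: "k \<in> ?C \<longleftrightarrow> x + k \<in> edom" for k by (auto simp: image_iff algebra_simps)
  have comb: "x + (a *\<^sub>R k + b *\<^sub>R l) = a *\<^sub>R (x + k) + b *\<^sub>R (x + l)"
    if "a + b = 1" for a b :: real and k l
  proof -
    have "a *\<^sub>R x + b *\<^sub>R x = x" using that by (metis scaleR_add_left scaleR_one)
    then show ?thesis by (simp add: scaleR_add_right algebra_simps)
  qed
  have "convex_on ?C \<phi>"
    unfolding convex_on_def
  proof (intro conjI ballI allI impI)
    show "convex ?C"
      using convex_translation[OF convex_on_imp_convex[OF convex_on_val], of "- x"] by simp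
    fix k l and a b :: real
    assume kl: "k \<in> ?C" "l \<in> ?C" and ab: "0 \<le> a" "0 \<le> b" "a + b = 1"
    have "val (a *\<^sub>R (x + k) + b *\<^sub>R (x + l)) \<le> a * val (x + k) + b * val (x + l)"
      using convex_on_val kl ab by (auto simp: convex_on_def C)
    moreover have "h x = a * h x + b * h x" using ab(3) by (metis distrib_right mult_1)
    ultimately show "\<phi> (a *\<^sub>R k + b *\<^sub>R l) \<le> a * \<phi> k + b * \<phi> l"
      unfolding \<phi>_def comb[OF ab(3)]
      by (simp add: h_def blinfun.add_right blinfun.scaleR_right algebra_simps)
  qed
  moreover have "?C \<noteq> {}" using dom_nonempty by auto
  moreover have "- \<epsilon> * norm k \<le> \<phi> k" if "k \<in> ?C" for k
    using x(2)[of "x + k"] that by (simp add: C \<phi>_def dist_norm)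
  ultimately obtain e :: "'x \<Rightarrow>\<^sub>L real"
    where e: "norm e \<le> \<epsilon>" "\<And>k. k \<in> ?C \<Longrightarrow> blinfun_apply e k \<le> \<phi> k"
    by (rule convex_sandwich[where \<epsilon> = \<epsilon>]) (use eps in auto)
  have "val x + blinfun_apply (\<xi> + e) (z - x) \<le> val z" if "z \<in> edom" for z
    using e(2)[of "z - x"] that
    by (simp add: \<phi>_def h_def blinfun.add_left blinfun.diff_right)
  then show ?thesis using that[of e x] e(1) x(1) by (simp add: subdifferential_iff)
qed

text \<open>Strong monotonicity makes the points of \<open>nearby_subgradient\<close> a Cauchy family as \<open>\<epsilon> \<rightarrow> 0\<close>, so
  no weak compactness is involved.\<close>

theorem ex_subgradient_point: "\<exists>x. \<xi> \<in> subdifferential \<Theta> x"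
proof -
  have "\<exists>x e. \<xi> + e \<in> subdifferential \<Theta> x \<and> norm e \<le> inverse (real (Suc n))" for n
  proof -
    have "0 < inverse (real (Suc n))" by simp
    then show ?thesis by (rule nearby_subgradient[of _ \<xi>]) blast
  qed
  then obtain u e where ue: "\<And>n. \<xi> + e n \<in> subdifferential \<Theta> (u n)"
    and e: "\<And>n. norm (e n) \<le> inverse (real (Suc n))" by metis
  have "e \<longlonglongrightarrow> 0"
    by (rule Lim_null_comparison[OF _ LIMSEQ_inverse_real_of_nat]) (use e in auto)
  have "Cauchy u"
  proof (rule metric_CauchyI)
    fix d :: real assume d: "0 < d"
    have "0 < 2 * c0 * d powr (p - 1)" using d c0_pos by simp
    then obtain M where M: "\<And>m n. m \<ge> M \<Longrightarrow> n \<ge> M \<Longrightarrow> dist (e m) (e n) < 2 * c0 * d powr (p - 1)"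
      using metric_CauchyD[OF LIMSEQ_imp_Cauchy[OF \<open>e \<longlonglongrightarrow> 0\<close>]] by blast
    have "dist (u m) (u n) < d" if "m \<ge> M" "n \<ge> M" for m n
    proof (rule ccontr)
      assume "\<not> ?thesis"
      then have "d powr (p - 1) \<le> norm (u m - u n) powr (p - 1)"
        using d p_gt_1 by (intro powr_mono2) (auto simp: dist_norm)
      then have "2 * c0 * d powr (p - 1) \<le> 2 * c0 * norm (u m - u n) powr (p - 1)"
        using c0_pos by simp
      then show False
        using subdifferential_strongly_monotone[OF ue ue, of m n] M[OF that] by (simp add: dist_norm)
    qed
    then show "\<exists>M. \<forall>m\<ge>M. \<forall>n\<ge>M. dist (u m) (u n) < d" by blast
  qed
  then obtain x where x: "u \<longlonglongrightarrow> x" using Cauchy_convergent convergent_def by blast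
  \<comment> \<open>The subgradient inequality is solved for \<open>val (u n)\<close>, so that lower
    semicontinuity applies with a convergent upper bound.\<close>
  have *: "x \<in> edom \<and> val x \<le> val z - blinfun_apply (\<xi> + 0) (z - x)" if z: "z \<in> edom" for z
  proof -
    have "(\<lambda>n. val z - blinfun_apply (\<xi> + e n) (z - u n)) \<longlonglongrightarrow> val z - blinfun_apply (\<xi> + 0) (z - x)"
      using x \<open>e \<longlonglongrightarrow> 0\<close> by (intro tendsto_intros)
    moreover have "val (u n) \<le> val z - blinfun_apply (\<xi> + e n) (z - u n)" for n
      using subgradientD(2)[OF ue z, of n] by simp
    ultimately show ?thesis
      using val_lsc[OF x subgradientD(1)[OF ue], of "\<lambda>n. val z - blinfun_apply (\<xi> + e n) (z - u n)"]
      by blast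
  qed
  then have "\<xi> \<in> subdifferential \<Theta> x"
    using dom_nonempty by (fastforce simp: subdifferential_iff)
  then show ?thesis ..
qed

section \<open>Differentiability of the conjugate\<close>

lemma conjugate_subgradient:
  assumes \<xi>: "\<xi> \<in> subdifferential \<Theta> x"
  shows "conjugate \<Theta> \<xi> = ereal (blinfun_apply \<xi> x - val x)"
  unfolding conjugate_def
proof (rule antisym)
  show "(SUP z. ereal (blinfun_apply \<xi> z) - \<Theta> z) \<le> ereal (blinfun_apply \<xi> x - val x)"
  proof (rule SUP_least)
    fix z
    show "ereal (blinfun_apply \<xi> z) - \<Theta> z \<le> ereal (blinfun_apply \<xi> x - val x)"
      using subgradientD(2)[OF \<xi>, of z]
      by (cases "z \<in> edom") (auto simp: ereal_val not_dom blinfun.diff_right)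
  qed
  have "ereal (blinfun_apply \<xi> x) - \<Theta> x \<le> (SUP z. ereal (blinfun_apply \<xi> z) - \<Theta> z)"
    by (rule SUP_upper) simp
  then show "ereal (blinfun_apply \<xi> x - val x) \<le> (SUP z. ereal (blinfun_apply \<xi> z) - \<Theta> z)"
    by (simp add: ereal_val[OF subgradientD(1)[OF \<xi>]])
qed

lemma conj_subgradient: "\<xi> \<in> subdifferential \<Theta> x \<Longrightarrow> conjv \<xi> = blinfun_apply \<xi> x - val x"
  by (simp add: conjv_def conjugate_subgradient)

text \<open>The remainder of the linearisation is squeezed by the subgradient inequality at
  \<open>z\<close> tested at \<open>x\<close> and the one at \<open>x\<close> tested at
  \<open>z\<close>.\<close>

lemma conj_increment:
  assumes \<xi>: "\<xi> \<in> subdifferential \<Theta> x" and \<omega>: "\<omega> \<in> subdifferential \<Theta> z"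
  shows "0 \<le> conjv \<omega> - conjv \<xi> - blinfun_apply (\<omega> - \<xi>) x"
    and "conjv \<omega> - conjv \<xi> - blinfun_apply (\<omega> - \<xi>) x \<le> norm (\<omega> - \<xi>) * norm (z - x)"
proof -
  show "0 \<le> conjv \<omega> - conjv \<xi> - blinfun_apply (\<omega> - \<xi>) x"
    using subgradientD(2)[OF \<omega> subgradientD(1)[OF \<xi>]]
    by (simp add: conj_subgradient[OF \<xi>] conj_subgradient[OF \<omega>] blinfun.diff_left blinfun.diff_right)
  have "conjv \<omega> - conjv \<xi> - blinfun_apply (\<omega> - \<xi>) x \<le> blinfun_apply (\<omega> - \<xi>) (z - x)"
    using subgradientD(2)[OF \<xi> subgradientD(1)[OF \<omega>]]
    by (simp add: conj_subgradient[OF \<xi>] conj_subgradient[OF \<omega>] blinfun.diff_left blinfun.diff_right)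
  also have "\<dots> \<le> norm (\<omega> - \<xi>) * norm (z - x)"
    using norm_blinfun[of "\<omega> - \<xi>" "z - x"] by simp
  finally show "conjv \<omega> - conjv \<xi> - blinfun_apply (\<omega> - \<xi>) x \<le> norm (\<omega> - \<xi>) * norm (z - x)" .
qed

text \<open>The remainder is at most \<open>norm h * norm (z - x)\<close>, where \<open>z\<close>
  belongs to the displaced functional \<open>\<xi> + h\<close>; such a \<open>z\<close> always
  exists and tends to \<open>x\<close> at a Hoelder rate.\<close>

lemma conj_has_derivative:
  assumes \<xi>: "\<xi> \<in> subdifferential \<Theta> x"
  shows "(conjv has_derivative (\<lambda>h. blinfun_apply h x)) (at \<xi>)"
  unfolding has_derivative_at
proof
  show "bounded_linear (\<lambda>h. blinfun_apply h x)" by (rule blinfun.bounded_linear_left)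
  have "((\<lambda>h :: 'x \<Rightarrow>\<^sub>L real. (norm h / (2 * c0)) powr (1 / (p - 1))) \<longlongrightarrow>
      (norm (0 :: 'x \<Rightarrow>\<^sub>L real) / (2 * c0)) powr (1 / (p - 1))) (at 0)"
    using c0_pos p_gt_1
    by (intro tendsto_powr' tendsto_divide tendsto_norm tendsto_ident_at tendsto_const) auto
  then have lim: "((\<lambda>h :: 'x \<Rightarrow>\<^sub>L real. (norm h / (2 * c0)) powr (1 / (p - 1))) \<longlongrightarrow> 0) (at 0)" by simp
  show "(\<lambda>h. norm (conjv (\<xi> + h) - conjv \<xi> - blinfun_apply h x) / norm h) \<midarrow>0\<rightarrow> 0"
  proof (rule Lim_null_comparison[OF always_eventually[OF allI] lim])
    fix h :: "'x \<Rightarrow>\<^sub>L real"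
    obtain z where z: "\<xi> + h \<in> subdifferential \<Theta> z" using ex_subgradient_point by blast
    have "norm (z - x) \<le> (norm h / (2 * c0)) powr (1 / (p - 1))"
      using subdifferential_inverse_Holder[OF z \<xi>] by simp
    then have "norm h * norm (z - x) \<le> norm h * (norm h / (2 * c0)) powr (1 / (p - 1))"
      by (intro mult_left_mono) auto
    with conj_increment[OF \<xi> z]
    have "norm (conjv (\<xi> + h) - conjv \<xi> - blinfun_apply h x)
        \<le> norm h * (norm h / (2 * c0)) powr (1 / (p - 1))" by simp
    then show "norm (norm (conjv (\<xi> + h) - conjv \<xi> - blinfun_apply h x) / norm h)
        \<le> (norm h / (2 * c0)) powr (1 / (p - 1))"
      by (cases "h = 0") (simp_all add: field_simps)
  qed
qed

lemma grad_eq: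
  assumes \<xi>: "\<xi> \<in> subdifferential \<Theta> x"
  shows "grad \<xi> = x"
  unfolding grad_conjugate_def
proof (rule the_equality)
  show "((\<lambda>\<omega>. real_of_ereal (conjugate \<Theta> \<omega>)) has_derivative (\<lambda>h. blinfun_apply h x)) (at \<xi>)"
    using conj_has_derivative[OF \<xi>] by (simp add: conjv_def[abs_def])
  fix z assume "((\<lambda>\<omega>. real_of_ereal (conjugate \<Theta> \<omega>)) has_derivative (\<lambda>h. blinfun_apply h z)) (at \<xi>)"
  then have "(\<lambda>h :: 'x \<Rightarrow>\<^sub>L real. blinfun_apply h z) = (\<lambda>h. blinfun_apply h x)"
    using conj_has_derivative[OF \<xi>] unfolding conjv_def by (rule has_derivative_unique)
  then show "z = x" by (metis blinfun_separates)
qed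

lemma grad_subgradient: "\<xi> \<in> subdifferential \<Theta> (grad \<xi>)"
  using ex_subgradient_point grad_eq by blast

lemma grad_dom: "grad \<xi> \<in> edom"
  using subgradientD(1)[OF grad_subgradient] .

lemma grad_Holder: "norm (grad \<xi> - grad \<omega>) \<le> (norm (\<xi> - \<omega>) / (2 * c0)) powr (1 / (p - 1))"
  by (rule subdifferential_inverse_Holder[OF grad_subgradient grad_subgradient])

lemma tendsto_grad:
  assumes "(f \<longlongrightarrow> \<xi>) A"
  shows "((\<lambda>t. grad (f t)) \<longlongrightarrow> grad \<xi>) A"
proof (rule Lim_null[THEN iffD2], rule Lim_null_comparison[OF always_eventually[OF allI]])
  show "norm (grad (f t) - grad \<xi>) \<le> (norm (f t - \<xi>) / (2 * c0)) powr (1 / (p - 1))" for t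
    by (rule grad_Holder)
  have "((\<lambda>t. (norm (f t - \<xi>) / (2 * c0)) powr (1 / (p - 1))) \<longlongrightarrow>
      (norm (\<xi> - \<xi>) / (2 * c0)) powr (1 / (p - 1))) A"
    using c0_pos p_gt_1 assms by (intro tendsto_powr' tendsto_intros) auto
  then show "((\<lambda>t. (norm (f t - \<xi>) / (2 * c0)) powr (1 / (p - 1))) \<longlongrightarrow> 0) A" by simp
qed

lemma tendsto_conj:
  assumes "(f \<longlongrightarrow> \<xi>) A"
  shows "((\<lambda>t. conjv (f t)) \<longlongrightarrow> conjv \<xi>) A"
  using isCont_tendsto_compose[OF has_derivative_continuous[OF conj_has_derivative[OF grad_subgradient]] assms] .

lemma tendsto_breg:
  assumes "(f \<longlongrightarrow> \<xi>) A"
  shows "((\<lambda>t. breg (f t) z) \<longlongrightarrow> breg \<xi> z) A"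
  unfolding breg_def using assms by (intro tendsto_intros tendsto_conj)

section \<open>The Bregman distance as a function of the dual variable\<close>

lemma breg_eq: "breg \<xi> z = val z - val (grad \<xi>) - blinfun_apply \<xi> (z - grad \<xi>)"
  by (simp add: breg_def conj_subgradient[OF grad_subgradient] blinfun.diff_right)

lemma bregman_grad: "z \<in> edom \<Longrightarrow> bregman \<Theta> \<xi> z (grad \<xi>) = ereal (breg \<xi> z)"
  by (simp add: bregman_eq grad_dom breg_eq)

lemma breg_lower: "z \<in> edom \<Longrightarrow> c0 * norm (z - grad \<xi>) powr p \<le> breg \<xi> z"
  using p_convexD[OF grad_subgradient] by (simp add: breg_eq)

lemma breg_nonneg: "z \<in> edom \<Longrightarrow> 0 \<le> breg \<xi> z"
  using breg_lower[of z \<xi>] c0_pos by (smt (verit) mult_nonneg_nonneg powr_ge_zero)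

lemma breg_tendsto_0_imp:
  assumes z: "z \<in> edom" and lim: "((\<lambda>t. breg (f t) z) \<longlongrightarrow> 0) A"
  shows "((\<lambda>t. grad (f t)) \<longlongrightarrow> z) A"
proof (rule Lim_null[THEN iffD2], rule Lim_null_comparison[OF always_eventually[OF allI]])
  show "norm (grad (f t) - z) \<le> (breg (f t) z / c0) powr (1 / p)" for t
  proof -
    have "norm (grad (f t) - z) = (norm (z - grad (f t)) powr p) powr (1 / p)"
      using p_gt_1 by (simp add: powr_powr norm_minus_commute)
    also have "\<dots> \<le> (breg (f t) z / c0) powr (1 / p)"
      using breg_lower[OF z, of "f t"] c0_pos p_gt_1 by (intro powr_mono2) (auto simp: field_simps)
    finally show ?thesis .
  qed
  have "((\<lambda>t. (breg (f t) z / c0) powr (1 / p)) \<longlongrightarrow> (0 / c0) powr (1 / p)) A"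
    using c0_pos p_gt_1 breg_nonneg[OF z]
    by (intro tendsto_powr' tendsto_divide lim tendsto_const) auto
  then show "((\<lambda>t. (breg (f t) z / c0) powr (1 / p)) \<longlongrightarrow> 0) A" by simp
qed

text \<open>The factor \<open>k\<close> moves into the power because
  \<open>k \<le> k powr p\<close>. With \<open>k = 1\<close> and \<open>k = 2\<close> this will
  bound the distances from a solution to \<open>x n\<close> and to \<open>z n\<close>.\<close>

lemma breg_le_imp_dist:
  assumes z: "z \<in> edom" and le: "breg \<xi> z \<le> k * (c0 * r powr p)" and r: "0 \<le> r" and k: "1 \<le> k"
  shows "norm (z - grad \<xi>) \<le> k * r"
proof -
  have "c0 * norm (z - grad \<xi>) powr p \<le> c0 * (k * r powr p)"
    using breg_lower[OF z, of \<xi>] le by (simp add: mult_ac)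
  then have "norm (z - grad \<xi>) powr p \<le> k * r powr p" using c0_pos by simp
  also have "\<dots> \<le> k powr p * r powr p"
    using powr_mono[of 1 p k] p_gt_1 k by (intro mult_right_mono) auto
  also have "\<dots> = (k * r) powr p" using r k by (simp add: powr_mult)
  finally show ?thesis
    using p_gt_1 r k by (smt (verit) powr_less_mono2 norm_ge_zero mult_nonneg_nonneg)
qed

definition q :: real where "q = p / (p - 1)"

text \<open>This is the factor in the conditions on the combination parameters; its
  \<open>1 / q\<close> is the integral of \<open>t powr (q - 1)\<close> over the unit
  interval.\<close>

definition \<kappa> :: real where "\<kappa> = 1 / (q * (2 * c0) powr (q - 1))"

lemma q_minus_1: "q - 1 = 1 / (p - 1)"
  using p_gt_1 by (simp add: q_def field_simps)

lemma q_gt_1: "1 < q"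
  using q_minus_1 p_gt_1 by (smt (verit) divide_pos_pos)

lemma \<kappa>_pos: "0 < \<kappa>"
  using q_gt_1 c0_pos by (simp add: \<kappa>_def)

text \<open>The Hoelder bound of \<open>grad\<close> is integrated along the segment from
  \<open>\<xi>\<close> to \<open>\<omega>\<close>. In place of an integral, the difference
  \<open>\<psi>\<close> of the two sides is shown not to increase.\<close>

lemma conj_upper:
  "conjv \<omega> - conjv \<xi> - blinfun_apply (\<omega> - \<xi>) (grad \<xi>) \<le> \<kappa> * norm (\<omega> - \<xi>) powr q"
proof (cases "\<omega> = \<xi>")
  case False
  define h where "h = \<omega> - \<xi>"
  define N where "N = norm h"
  have N: "0 < N" using False by (simp add: N_def h_def)
  define \<psi> where "\<psi> t = conjv (\<xi> + t *\<^sub>R h) - t * blinfun_apply h (grad \<xi>) - \<kappa> * (t * N) powr q" for t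
  have "\<psi> 1 \<le> \<psi> 0"
  \<comment> \<open>The power is differentiated for positive \<open>t\<close> only; at the ends of
    the interval continuity is enough.\<close>
  proof (rule DERIV_nonpos_imp_decreasing_open[of 0 1 \<psi>])
    fix t :: real assume t: "0 < t" "t < 1"
    let ?D = "blinfun_apply h (grad (\<xi> + t *\<^sub>R h)) - blinfun_apply h (grad \<xi>) - \<kappa> * (q * (t * N) powr (q - 1) * N)"
    have "((\<lambda>t. \<xi> + t *\<^sub>R h) has_derivative (\<lambda>a. a *\<^sub>R h)) (at t)"
      by (auto intro!: derivative_eq_intros)
    from has_derivative_compose[OF this conj_has_derivative[OF grad_subgradient]]
    have 1: "((\<lambda>t. conjv (\<xi> + t *\<^sub>R h)) has_real_derivative blinfun_apply h (grad (\<xi> + t *\<^sub>R h))) (at t)"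
      by (simp add: has_field_derivative_def blinfun.scaleR_left mult_commute_abs)
    have "((\<lambda>t. (t * N) powr q) has_real_derivative q * (t * N) powr (q - 1) * N) (at t)"
      using t N by (auto intro!: derivative_eq_intros)
    moreover have "((\<lambda>t. t * blinfun_apply h (grad \<xi>)) has_real_derivative blinfun_apply h (grad \<xi>)) (at t)"
      by (auto intro!: derivative_eq_intros)
    ultimately have "(\<psi> has_real_derivative ?D) (at t)"
      unfolding \<psi>_def using 1 by (intro DERIV_diff DERIV_cmult)
    moreover have "?D \<le> 0"
    proof -
      have "blinfun_apply h (grad (\<xi> + t *\<^sub>R h)) - blinfun_apply h (grad \<xi>)
          \<le> N * norm (grad (\<xi> + t *\<^sub>R h) - grad \<xi>)"
        unfolding N_def using norm_blinfun[of h "grad (\<xi> + t *\<^sub>R h) - grad \<xi>"]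
        by (simp add: blinfun.diff_right)
      also have "\<dots> \<le> N * (norm (t *\<^sub>R h) / (2 * c0)) powr (1 / (p - 1))"
        using grad_Holder[of "\<xi> + t *\<^sub>R h" \<xi>] N by (intro mult_left_mono) auto
      also have "\<dots> = N * ((t * N) powr (q - 1) / (2 * c0) powr (q - 1))"
        using t c0_pos by (simp add: N_def powr_divide q_minus_1)
      also have "\<dots> = \<kappa> * (q * (t * N) powr (q - 1) * N)"
        using q_gt_1 by (simp add: \<kappa>_def)
      finally show ?thesis by simp
    qed
    ultimately show "\<exists>D. (\<psi> has_real_derivative D) (at t) \<and> D \<le> 0" by blast
  next
    have "((\<lambda>s. conjv (\<xi> + s *\<^sub>R h)) \<longlongrightarrow> conjv (\<xi> + t *\<^sub>R h)) (at t within {0..1})" for t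
      by (intro tendsto_conj tendsto_intros)
    then show "continuous_on {0..1} \<psi>"
      unfolding \<psi>_def using N q_gt_1
      by (intro continuous_intros continuous_on_powr') (auto simp: continuous_on_def)
  qed simp
  then show ?thesis using N by (simp add: \<psi>_def h_def N_def)
qed (simp)

lemma breg_diff:
  "breg \<omega> z - breg \<xi> z \<le> \<kappa> * norm (\<omega> - \<xi>) powr q + blinfun_apply (\<omega> - \<xi>) (grad \<xi> - z)"
  using conj_upper[of \<omega> \<xi>] by (simp add: breg_def blinfun.diff_left blinfun.diff_right)

text \<open>Solved for \<open>breg \<xi> (grad \<omega>)\<close>, this expresses the distance
  between two iterates by a pairing of dual increments and a difference of convergent Bregman
  distances.\<close>

lemma breg_three_point:
  "breg \<omega> z - breg \<xi> z = blinfun_apply (\<omega> - \<xi>) (grad \<omega> - z) - breg \<xi> (grad \<omega>)"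
  by (simp add: breg_def conj_subgradient[OF grad_subgradient] blinfun.diff_left blinfun.diff_right)

text \<open>\<open>breg_diff\<close> enters twice. From \<open>\<xi>\<close> to the extrapolated
  functional it gives the summand \<open>l powr q\<close> and leaves a pairing with
  \<open>grad \<xi> - z\<close>; from \<open>\<xi>\<close> to \<open>\<xi>'\<close> it bounds this
  pairing by the latest change of the distance, which gives the summand \<open>l\<close>.\<close>

lemma breg_inertial:
  assumes l: "0 \<le> l"
  shows "breg (\<xi> + l *\<^sub>R (\<xi> - \<xi>')) z - breg \<xi> z
    \<le> l * (breg \<xi> z - breg \<xi>' z) + \<kappa> * (l powr q + l) * norm (\<xi> - \<xi>') powr q"
proof -
  have "breg \<xi>' z - breg \<xi> z \<le> \<kappa> * norm (\<xi> - \<xi>') powr q - blinfun_apply (\<xi> - \<xi>') (grad \<xi> - z)"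
    using breg_diff[of \<xi>' z \<xi>]
    by (simp add: norm_minus_commute blinfun.diff_left algebra_simps)
  from mult_left_mono[OF this l]
  have "l * blinfun_apply (\<xi> - \<xi>') (grad \<xi> - z)
      \<le> l * (breg \<xi> z - breg \<xi>' z) + l * (\<kappa> * norm (\<xi> - \<xi>') powr q)" by (simp add: algebra_simps)
  moreover have "breg (\<xi> + l *\<^sub>R (\<xi> - \<xi>')) z - breg \<xi> z
      \<le> \<kappa> * (l powr q * norm (\<xi> - \<xi>') powr q) + l * blinfun_apply (\<xi> - \<xi>') (grad \<xi> - z)"
    using breg_diff[of "\<xi> + l *\<^sub>R (\<xi> - \<xi>')" z \<xi>] l
    by (simp add: powr_mult blinfun.scaleR_left)
  ultimately show ?thesis by (simp add: algebra_simps)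
qed

end

section \<open>The two-point gradient iteration\<close>

text \<open>The domain of \<open>F\<close> has dropped out: the iterates and the relevant solutions
  will be shown to lie in the ball, where the cone condition holds.\<close>

locale tpg_setting = p_convex_functional \<Theta> p c0
  for \<Theta> :: "'x::banach \<Rightarrow> ereal" and p c0 :: real +
  fixes F :: "'x \<Rightarrow> 'y::banach" and L :: "'x \<Rightarrow> ('x \<Rightarrow>\<^sub>L 'y)" and y :: 'y and x0 :: 'x
    and \<xi>0 :: "'x \<Rightarrow>\<^sub>L real" and \<rho> \<eta> C0 s \<tau> \<mu>0 \<mu>1 c1 \<nu> :: real
  assumes smooth: "uniformly_smooth TYPE('y)"
    and \<rho>_pos: "0 < \<rho>"
    and \<xi>0: "\<xi>0 \<in> subdifferential \<Theta> x0"
    and solvable: "\<exists>xs\<in>eff_domain \<Theta>. F xs = y \<and> bregman \<Theta> \<xi>0 xs x0 \<le> ereal (c0 * \<rho> powr p)"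
    and L_cont: "continuous_on (cball x0 (3 * \<rho>)) L"
    and \<eta>: "0 \<le> \<eta>" "\<eta> < 1"
    and cone: "\<And>u v. u \<in> cball x0 (3 * \<rho>) \<Longrightarrow> v \<in> cball x0 (3 * \<rho>) \<Longrightarrow>
                 norm (F u - F v - blinfun_apply (L v) (u - v)) \<le> \<eta> * norm (F u - F v)"
    and C0_pos: "0 < C0"
    and L_bound: "\<And>u. u \<in> cball x0 (3 * \<rho>) \<Longrightarrow> norm (L u) \<le> C0"
    and s_gt_1: "1 < s" and \<tau>_gt_1: "1 < \<tau>" and \<mu>0_pos: "0 < \<mu>0" and \<mu>1_pos: "0 < \<mu>1"
    and c1: "c1 = 1 - \<eta> - (1 + \<eta>) / \<tau> - 1 / q * (\<mu>0 / (2 * c0)) powr (q - 1)"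
    and c1_pos: "0 < c1" and \<nu>_gt_1: "1 < \<nu>"
begin

abbreviation "B \<equiv> cball x0 (3 * \<rho>)"

abbreviation "J \<equiv> duality_map s :: 'y \<Rightarrow> ('y \<Rightarrow>\<^sub>L real)"

abbreviation "step \<equiv> tpg_step_size p s \<tau> \<mu>0 \<mu>1"

definition sol :: "'x \<Rightarrow> bool" where "sol w \<longleftrightarrow> w \<in> edom \<and> w \<in> B \<and> F w = y"

section \<open>Estimates for the operator, the residual and the step size\<close>

lemma J_norm: "norm (J r) = norm r powr (s - 1)"
  by (rule norm_duality_map[OF smooth s_gt_1])

lemma J_apply_self: "blinfun_apply (J r) r = norm r powr s"
  by (rule duality_map_apply[OF smooth s_gt_1])

lemma J_apply_le: "blinfun_apply (J r) w \<le> norm r powr (s - 1) * norm w"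
  using norm_blinfun[of "J r" w] by (simp add: J_norm)

lemma powr_s_split: "norm r powr (s - 1) * norm r = norm r powr s" for r :: 'y
  by (cases "r = 0") (use s_gt_1 in \<open>auto simp: powr_diff\<close>)

lemma L_apply_le:
  assumes "u \<in> B" "v \<in> B"
  shows "norm (blinfun_apply (L v) (u - v)) \<le> (1 + \<eta>) * norm (F u - F v)"
  using cone[OF assms] norm_triangle_ineq2[of "blinfun_apply (L v) (u - v)" "F u - F v"]
  by (simp add: norm_minus_commute algebra_simps)

text \<open>As \<open>\<eta> < 1\<close>, the nonlinear error in the cone condition is absorbed on
  the left, so continuity of \<open>F\<close> follows from the bound on \<open>L\<close>.\<close>

lemma F_Lipschitz:
  assumes "u \<in> B" "v \<in> B"
  shows "norm (F u - F v) \<le> C0 / (1 - \<eta>) * norm (u - v)"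
proof -
  have "norm (blinfun_apply (L v) (u - v)) \<le> C0 * norm (u - v)"
    using norm_blinfun[of "L v" "u - v"] mult_right_mono[OF L_bound[OF assms(2)] norm_ge_zero[of "u - v"]]
    by simp
  then have "(1 - \<eta>) * norm (F u - F v) \<le> C0 * norm (u - v)"
    using cone[OF assms] norm_triangle_ineq2[of "F u - F v" "blinfun_apply (L v) (u - v)"]
    by (simp add: algebra_simps)
  then show ?thesis using \<eta> by (simp add: field_simps)
qed

lemma continuous_on_F: "continuous_on B F"
proof (rule continuous_onI)
  fix u e assume u: "u \<in> B" and e: "0 < (e::real)"
  have "dist (F v) (F u) \<le> e" if "v \<in> B" "dist v u < e * (1 - \<eta>) / C0" for v
  proof -
    have "C0 / (1 - \<eta>) * norm (v - u) \<le> e"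
      using that(2) C0_pos \<eta> by (simp add: dist_norm field_simps)
    then show ?thesis using F_Lipschitz[OF that(1) u] by (simp add: dist_norm)
  qed
  then show "\<exists>d>0. \<forall>v\<in>B. dist v u < d \<longrightarrow> dist (F v) (F u) \<le> e"
    using e C0_pos \<eta> by (intro exI[of _ "e * (1 - \<eta>) / C0"]) auto
qed

lemma tendsto_in_B:
  assumes "(f \<longlongrightarrow> w) A" "A \<noteq> bot" "\<forall>\<^sub>F t in A. f t \<in> B"
  shows "w \<in> B" "((\<lambda>t. F (f t)) \<longlongrightarrow> F w) A" "((\<lambda>t. L (f t)) \<longlongrightarrow> L w) A"
proof -
  show w: "w \<in> B" by (rule Lim_in_closed_set[OF closed_cball assms(3,2,1)])
  show "((\<lambda>t. F (f t)) \<longlongrightarrow> F w) A" "((\<lambda>t. L (f t)) \<longlongrightarrow> L w) A"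
    by (rule continuous_on_tendsto_compose[OF _ assms(1) w assms(3)], rule continuous_on_F L_cont)+
qed

lemma compose_norm_le: "z \<in> B \<Longrightarrow> norm (J r o\<^sub>L L z) \<le> C0 * norm r powr (s - 1)"
  using norm_blinfun_compose[of "J r" "L z"] mult_left_mono[OF L_bound[of z], of "norm (J r)"]
  by (simp add: J_norm mult.commute)

lemma step_nonneg: "0 \<le> step \<delta> r A"
  using \<mu>0_pos \<mu>1_pos by (auto simp: tpg_step_size_def Let_def)

lemma step_upper: "step \<delta> r A \<le> \<mu>1 * norm r powr (p - s)"
  using \<mu>1_pos by (auto simp: tpg_step_size_def Let_def intro!: mult_right_mono)

lemma step_residual_upper: "step \<delta> r A * norm r powr a \<le> \<mu>1 * norm r powr (p - s + a)"
  using mult_right_mono[OF step_upper, of "norm r powr a"] by (simp add: powr_add mult.assoc)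

text \<open>The gradient norm is at most \<open>C0 * norm r powr (s - 1)\<close>, so the quotient in
  the step size is at least \<open>\<mu>0 / C0 powr p\<close>. Hence summable decrements force the
  residual to 0 for exact data and below \<open>\<tau> * \<delta>\<close> for noisy data.\<close>

lemma step_residual_lower:
  assumes r: "\<tau> * \<delta> < norm r" and \<delta>: "0 \<le> \<delta>" and z: "z \<in> B"
  shows "min (\<mu>0 / C0 powr p) \<mu>1 * norm r powr p \<le> step \<delta> r (L z) * norm r powr s"
proof -
  define g where "g = norm (J r o\<^sub>L L z)"
  define R where "R = norm r"
  have "0 \<le> \<tau> * \<delta>" using \<delta> \<tau>_gt_1 by simp
  then have R: "0 < R" unfolding R_def using r by linarith
  have "min (\<mu>0 / C0 powr p) \<mu>1 \<le> (if g = 0 then \<mu>1 else min (\<mu>0 * R powr (p * (s - 1)) / g powr p) \<mu>1)"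
  proof (cases "g = 0")
    case False
    then have g: "0 < g" by (simp add: g_def)
    have "g powr p \<le> (C0 * R powr (s - 1)) powr p"
      using compose_norm_le[OF z, of r] g p_gt_1 by (intro powr_mono2) (auto simp: g_def R_def)
    also have "\<dots> = C0 powr p * R powr (p * (s - 1))"
      using C0_pos by (simp add: powr_mult powr_powr mult.commute)
    finally have "\<mu>0 * R powr (p * (s - 1)) / (C0 powr p * R powr (p * (s - 1)))
        \<le> \<mu>0 * R powr (p * (s - 1)) / g powr p"
      using \<mu>0_pos g by (intro divide_left_mono) (auto intro!: mult_pos_pos)
    then have "\<mu>0 / C0 powr p \<le> \<mu>0 * R powr (p * (s - 1)) / g powr p" using R by simp
    then show ?thesis using False by auto
  qed auto
  then have "min (\<mu>0 / C0 powr p) \<mu>1 * (R powr (p - s) * R powr s)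
      \<le> (if g = 0 then \<mu>1 else min (\<mu>0 * R powr (p * (s - 1)) / g powr p) \<mu>1)
         * (R powr (p - s) * R powr s)"
    by (intro mult_right_mono) auto
  also have "\<dots> = step \<delta> r (L z) * norm r powr s"
    using r by (auto simp: tpg_step_size_def Let_def g_def R_def)
  finally show ?thesis by (simp add: R_def flip: powr_add)
qed

text \<open>Here the choice of the step size enters: \<open>m g\<^sup>p \<le> \<mu>0 \<parallel>r\<parallel>\<^bsup>s (p - 1)\<^esup>\<close>,
  and the power \<open>q - 1 = 1 / (p - 1)\<close> of this bounds \<open>(m g)\<^sup>q / m\<close>.\<close>

lemma step_quadratic_bound:
  "\<kappa> * (step \<delta> r A * norm (J r o\<^sub>L A)) powr q
     \<le> 1 / q * (\<mu>0 / (2 * c0)) powr (q - 1) * (step \<delta> r A * norm r powr s)"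
proof -
  define g where "g = norm (J r o\<^sub>L A)"
  define m where "m = step \<delta> r A"
  define R where "R = norm r"
  have m0: "0 \<le> m" unfolding m_def by (rule step_nonneg)
  have \<kappa>: "\<kappa> * \<mu>0 powr (q - 1) = 1 / q * (\<mu>0 / (2 * c0)) powr (q - 1)"
    using \<mu>0_pos c0_pos by (simp add: \<kappa>_def powr_divide)
  have "\<kappa> * (m * g) powr q \<le> \<kappa> * (\<mu>0 powr (q - 1) * (m * R powr s))"
  \<comment> \<open>For \<open>g = 0\<close> a positive step size is not given by the quotient, but
    then the left-hand side vanishes.\<close>
  proof (cases "m = 0 \<or> g = 0")
    case True
    then show ?thesis using \<kappa>_pos m0 by auto
  next
    case False
    then have m: "0 < m" and g: "0 < g" using m0 by (auto simp: g_def)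
    have "m = min (\<mu>0 * R powr (p * (s - 1)) / g powr p) \<mu>1 * R powr (p - s)"
      using m g by (auto simp: m_def tpg_step_size_def Let_def g_def R_def split: if_splits)
    also have "\<dots> \<le> \<mu>0 * R powr (p * (s - 1)) / g powr p * R powr (p - s)"
      by (intro mult_right_mono) auto
    finally have "m \<le> \<mu>0 * R powr (p * (s - 1)) / g powr p * R powr (p - s)" .
    then have "m * g powr p \<le> \<mu>0 * (R powr (p * (s - 1)) * R powr (p - s))"
      using g by (simp add: field_simps)
    also have "R powr (p * (s - 1)) * R powr (p - s) = R powr (s * (p - 1))"
      by (simp add: algebra_simps flip: powr_add)
    finally have "(m * g powr p) powr (q - 1) \<le> (\<mu>0 * R powr (s * (p - 1))) powr (q - 1)"
      using m q_gt_1 by (intro powr_mono2) auto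
    also have "\<dots> = \<mu>0 powr (q - 1) * R powr (s * ((p - 1) * (q - 1)))"
      using \<mu>0_pos by (simp add: powr_mult powr_powr mult.assoc)
    also have "(p - 1) * (q - 1) = 1" using p_gt_1 by (simp add: q_minus_1)
    finally have 1: "m powr (q - 1) * g powr (p * (q - 1)) \<le> \<mu>0 powr (q - 1) * R powr s"
      using m by (simp add: powr_mult powr_powr)
    have "p * (q - 1) = q" using p_gt_1 by (simp add: q_minus_1) (simp add: q_def)
    with 1 have "m * (m powr (q - 1) * g powr q) \<le> m * (\<mu>0 powr (q - 1) * R powr s)"
      using m by (intro mult_left_mono) auto
    moreover have "m * m powr (q - 1) = m powr q" using m by (simp add: powr_diff)
    then have "m * (m powr (q - 1) * g powr q) = (m * g) powr q"
      using m by (simp add: powr_mult flip: mult.assoc)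
    ultimately have "(m * g) powr q \<le> \<mu>0 powr (q - 1) * (m * R powr s)"
      by (simp add: mult_ac)
    then show ?thesis using \<kappa>_pos by simp
  qed
  then show ?thesis using \<kappa> by (simp add: m_def g_def R_def flip: mult.assoc)
qed

text \<open>\<open>L z (w - z)\<close> splits into noise, minus the residual, and the cone error.
  The residual contributes \<open>- norm r powr s\<close>; since \<open>\<delta>\<close> is below
  \<open>norm r / \<tau>\<close>, the others contribute at most the fractions
  \<open>1 / \<tau>\<close> and \<open>\<eta> * (1 + 1 / \<tau>)\<close> of this.\<close>

lemma residual_pairing:
  assumes w: "sol w" and z: "z \<in> B" and v: "norm (v - y) \<le> \<delta>" and \<delta>: "\<tau> * \<delta> < norm (F z - v)"
  shows "blinfun_apply (J (F z - v)) (blinfun_apply (L z) (w - z))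
    \<le> - (1 - \<eta> - (1 + \<eta>) / \<tau>) * norm (F z - v) powr s"
proof -
  define r where "r = F z - v"
  define R where "R = norm r"
  define e where "e = F w - F z - blinfun_apply (L z) (w - z)"
  have Fw: "F w - F z = (y - v) - r" using w by (simp add: sol_def r_def)
  have yv: "norm (y - v) \<le> \<delta>" using v by (simp add: norm_minus_commute)
  have "norm (F w - F z) \<le> R + \<delta>"
    unfolding Fw R_def using norm_triangle_ineq4[of "y - v" r] yv by simp
  then have e: "norm e \<le> \<eta> * (R + \<delta>)"
    using cone[of w z] w z \<eta>(1) mult_left_mono[of "norm (F w - F z)" "R + \<delta>" \<eta>]
    by (simp add: sol_def e_def)
  have \<delta>R: "\<delta> \<le> R / \<tau>" using \<delta> \<tau>_gt_1 by (simp add: R_def r_def field_simps)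
  have "blinfun_apply (L z) (w - z) = (y - v) - r - e" using Fw by (simp add: e_def)
  then have "blinfun_apply (J r) (blinfun_apply (L z) (w - z))
      = blinfun_apply (J r) (y - v) - R powr s + blinfun_apply (J r) (- e)"
    by (simp add: blinfun.diff_right blinfun.minus_right J_apply_self R_def)
  also have "\<dots> \<le> R powr (s - 1) * norm (y - v) - R powr s + R powr (s - 1) * norm e"
    using J_apply_le[of r "y - v"] J_apply_le[of r "- e"] by (simp add: R_def)
  also have "\<dots> \<le> R powr (s - 1) * (R / \<tau>) - R powr s + R powr (s - 1) * (\<eta> * (R + R / \<tau>))"
  proof -
    have "\<eta> * (R + \<delta>) \<le> \<eta> * (R + R / \<tau>)" using \<delta>R \<eta>(1) by (intro mult_left_mono) auto
    then have "R powr (s - 1) * norm e \<le> R powr (s - 1) * (\<eta> * (R + R / \<tau>))"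
      using e by (intro mult_left_mono) auto
    moreover have "R powr (s - 1) * norm (y - v) \<le> R powr (s - 1) * (R / \<tau>)"
      using yv \<delta>R by (intro mult_left_mono) auto
    ultimately show ?thesis by simp
  qed
  also have "\<dots> = (R powr (s - 1) * R) * (1 / \<tau> + \<eta> * (1 + 1 / \<tau>)) - R powr s"
    by (simp add: algebra_simps)
  also have "\<dots> = - (1 - \<eta> - (1 + \<eta>) / \<tau>) * R powr s"
    using powr_s_split[of r] \<tau>_gt_1 by (simp add: R_def field_simps)
  finally show ?thesis by (simp add: r_def R_def)
qed

lemma contraction_const_pos: "0 < 1 - \<eta> - (1 + \<eta>) / \<tau>"
proof -
  have "0 \<le> 1 / q * (\<mu>0 / (2 * c0)) powr (q - 1)" using q_gt_1 by simp
  then show ?thesis using c1 c1_pos by linarith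
qed

text \<open>The pairing with \<open>w - z\<close> is strictly negative. So the quotient in the step
  size has a nonzero denominator wherever it is evaluated, as continuity in \<open>\<delta>\<close>
  requires.\<close>

lemma gradient_nonzero:
  assumes w: "sol w" and z: "z \<in> B" and v: "norm (v - y) \<le> \<delta>" and \<delta>: "\<tau> * \<delta> < norm (F z - v)"
  shows "J (F z - v) o\<^sub>L L z \<noteq> 0"
proof
  assume "J (F z - v) o\<^sub>L L z = 0"
  then have "blinfun_apply (J (F z - v)) (blinfun_apply (L z) (w - z)) = 0"
    by (metis blinfun_compose.rep_eq comp_apply zero_blinfun.rep_eq)
  moreover have "0 \<le> \<tau> * \<delta>" using \<tau>_gt_1 order_trans[OF norm_ge_zero v] by simp
  then have "0 < norm (F z - v)" using \<delta> by linarith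
  then have "0 < norm (F z - v) powr s" by simp
  ultimately show False
    using residual_pairing[OF assms] contraction_const_pos
    by (smt (verit) mult_minus_left mult_pos_pos)
qed

text \<open>\<open>breg_diff\<close> leaves a power of the step, bounded by
  \<open>step_quadratic_bound\<close>, and a pairing, bounded by \<open>residual_pairing\<close>;
  \<open>c1\<close> is the difference of the two constants. At or below the discrepancy level the
  step is zero.\<close>

lemma gradient_step_descent:
  fixes z v \<delta>
  defines "r \<equiv> F z - v"
  assumes w: "sol w" and z: "z = grad \<zeta>" "z \<in> B" and v: "norm (v - y) \<le> \<delta>"
  shows "breg (\<zeta> - step \<delta> r (L z) *\<^sub>R (J r o\<^sub>L L z)) w
    \<le> breg \<zeta> w - c1 * (step \<delta> r (L z) * norm r powr s)"
proof (cases "\<tau> * \<delta> < norm r")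
  case False
  then show ?thesis by (simp add: tpg_step_size_def)
next
  case True
  define m where "m = step \<delta> r (L z)"
  have m: "0 \<le> m" unfolding m_def by (rule step_nonneg)
  have "breg (\<zeta> - m *\<^sub>R (J r o\<^sub>L L z)) w - breg \<zeta> w
      \<le> \<kappa> * (m * norm (J r o\<^sub>L L z)) powr q + m * blinfun_apply (J r) (blinfun_apply (L z) (w - z))"
    using breg_diff[of "\<zeta> - m *\<^sub>R (J r o\<^sub>L L z)" w \<zeta>] m z(1)
    by (simp add: blinfun.minus_left blinfun.scaleR_left blinfun.diff_right algebra_simps)
  also have "\<dots> \<le> 1 / q * (\<mu>0 / (2 * c0)) powr (q - 1) * (m * norm r powr s)
      + m * (- (1 - \<eta> - (1 + \<eta>) / \<tau>) * norm r powr s)"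
    unfolding m_def
    using step_quadratic_bound residual_pairing[OF w z(2) v True[unfolded r_def]] step_nonneg
    by (intro add_mono mult_left_mono) (auto simp: r_def)
  also have "\<dots> = - c1 * (m * norm r powr s)" unfolding c1 by (simp add: algebra_simps)
  finally show ?thesis by (simp add: m_def)
qed

lemma solvable_breg: obtains w where "sol w" "breg \<xi>0 w \<le> c0 * \<rho> powr p" "norm (w - x0) \<le> \<rho>"
proof -
  obtain w where w: "w \<in> edom" "F w = y" and b: "bregman \<Theta> \<xi>0 w x0 \<le> ereal (c0 * \<rho> powr p)"
    using solvable by blast
  have le: "breg \<xi>0 w \<le> c0 * \<rho> powr p"
    using b bregman_grad[OF w(1), of \<xi>0] grad_eq[OF \<xi>0] by simp
  then have d: "norm (w - x0) \<le> \<rho>"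
    using breg_le_imp_dist[OF w(1), of \<xi>0 1 \<rho>] \<rho>_pos grad_eq[OF \<xi>0] by simp
  then have "sol w" using w \<rho>_pos by (simp add: sol_def dist_norm norm_minus_commute)
  then show ?thesis using that le d by blast
qed

end

section \<open>Monotonicity and termination of a single run\<close>

locale tpg_run = tpg_setting \<Theta> p c0 F L y x0 \<xi>0 \<rho> \<eta> C0 s \<tau> \<mu>0 \<mu>1 c1 \<nu>
  for \<Theta> :: "'x::banach \<Rightarrow> ereal" and p c0 :: real
    and F :: "'x \<Rightarrow> 'y::banach" and L :: "'x \<Rightarrow> ('x \<Rightarrow>\<^sub>L 'y)" and y :: 'y and x0 :: 'x
    and \<xi>0 :: "'x \<Rightarrow>\<^sub>L real" and \<rho> \<eta> C0 s \<tau> \<mu>0 \<mu>1 c1 \<nu> :: real +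
  fixes v :: 'y and \<delta> :: real and lam :: "nat \<Rightarrow> real" and \<xi> :: "nat \<Rightarrow> ('x \<Rightarrow>\<^sub>L real)"
    and x :: "nat \<Rightarrow> 'x" and \<zeta> :: "nat \<Rightarrow> ('x \<Rightarrow>\<^sub>L real)" and z :: "nat \<Rightarrow> 'x" and \<mu> :: "nat \<Rightarrow> real"
  assumes iterates: "tpg_iterates \<Theta> F L p s \<tau> \<mu>0 \<mu>1 x0 \<xi>0 v \<delta> lam \<xi> x \<zeta> z \<mu>"
    and noise: "norm (v - y) \<le> \<delta>"
    and lam_nonneg: "\<And>n. 0 \<le> lam n"
    and lam_bound: "\<And>n. \<kappa> * (lam n powr q + lam n) * norm (\<xi> n - \<xi> (n - 1)) powr q \<le> c0 * \<rho> powr p"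
    and lam_descent: "\<And>n. \<kappa> * (lam n powr q + lam n) * norm (\<xi> n - \<xi> (n - 1)) powr q
          \<le> c1 / \<nu> * (\<mu> n * norm (F (z n) - v) powr s)"
begin

lemma \<delta>_nonneg: "0 \<le> \<delta>"
  using order_trans[OF norm_ge_zero noise] .

lemma
  shows \<xi>_0: "\<xi> 0 = \<xi>0"
    and \<zeta>_eq: "\<zeta> n = \<xi> n + lam n *\<^sub>R (\<xi> n - \<xi> (n - 1))"
    and z_eq: "z n = grad (\<zeta> n)"
    and \<mu>_eq: "\<mu> n = step \<delta> (F (z n) - v) (L (z n))"
    and \<xi>_Suc: "\<xi> (Suc n) = \<zeta> n - \<mu> n *\<^sub>R (J (F (z n) - v) o\<^sub>L L (z n))"
  using iterates by (auto simp: tpg_iterates_def)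

lemma x_eq: "x n = grad (\<xi> n)"
  using iterates grad_eq[OF \<xi>0] by (cases n) (auto simp: tpg_iterates_def)

lemma \<mu>_nonneg: "0 \<le> \<mu> n"
  unfolding \<mu>_eq by (rule step_nonneg)

lemma decrement_nonneg: "0 \<le> \<mu> n * norm (F (z n) - v) powr s"
  using \<mu>_nonneg by simp

text \<open>A descent in the previous step makes the first term of \<open>breg_inertial\<close>
  nonpositive, however large \<open>lam n\<close> is.\<close>

lemma breg_\<zeta>_le:
  assumes "breg (\<xi> n) w \<le> breg (\<xi> (n - 1)) w"
  shows "breg (\<zeta> n) w \<le> breg (\<xi> n) w + \<kappa> * (lam n powr q + lam n) * norm (\<xi> n - \<xi> (n - 1)) powr q"
  using breg_inertial[OF lam_nonneg, of "\<xi> n" n "\<xi> (n - 1)" w]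
    mult_left_mono[OF assms lam_nonneg[of n]]
  unfolding \<zeta>_eq by (simp add: algebra_simps)

lemma breg_\<xi>_Suc_le:
  assumes "sol w" "z n \<in> B"
  shows "breg (\<xi> (Suc n)) w \<le> breg (\<zeta> n) w - c1 * (\<mu> n * norm (F (z n) - v) powr s)"
  using gradient_step_descent[OF assms(1) z_eq assms(2) noise] by (simp add: \<xi>_Suc \<mu>_eq)

text \<open>The extrapolation uses up at most the fraction \<open>1 / \<nu>\<close> of the gradient
  decrement.\<close>

lemma breg_step:
  assumes "sol w" "z n \<in> B" "breg (\<xi> n) w \<le> breg (\<xi> (n - 1)) w"
  shows "breg (\<xi> (Suc n)) w \<le> breg (\<xi> n) w - c1 * (1 - 1 / \<nu>) * (\<mu> n * norm (F (z n) - v) powr s)"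
  using breg_\<xi>_Suc_le[OF assms(1,2)] breg_\<zeta>_le[OF assms(3)] lam_descent[of n]
  by (simp add: algebra_simps)

lemma descent_const_pos: "0 < c1 * (1 - 1 / \<nu>)"
  using c1_pos \<nu>_gt_1 by simp

text \<open>Descent needs \<open>z n\<close> in the ball and ball membership needs descent, so both
  are run in one induction, for a solution \<open>w\<close> within \<open>\<rho>\<close> of
  \<open>x0\<close>. The distance to \<open>\<zeta> n\<close> is at most twice the initial bound,
  which puts \<open>z n\<close> within \<open>2 * \<rho>\<close> of \<open>w\<close>; hence the
  radius \<open>3 * \<rho>\<close>.\<close>

lemma z_in_ball: "z n \<in> B" and x_in_ball: "x n \<in> cball x0 (2 * \<rho>)"
proof -
  obtain w where w: "sol w" and b0: "breg \<xi>0 w \<le> c0 * \<rho> powr p" and d: "norm (w - x0) \<le> \<rho>"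
    by (rule solvable_breg)
  have we: "w \<in> edom" using w by (simp add: sol_def)
  have zB: "z n \<in> B"
    if b: "breg (\<xi> n) w \<le> c0 * \<rho> powr p" and mono: "breg (\<xi> n) w \<le> breg (\<xi> (n - 1)) w" for n
  proof -
    have "breg (\<zeta> n) w \<le> 2 * (c0 * \<rho> powr p)"
      using breg_\<zeta>_le[OF mono] lam_bound[of n] b by linarith
    then have "norm (w - z n) \<le> 2 * \<rho>"
      using breg_le_imp_dist[OF we, of "\<zeta> n" 2 \<rho>] \<rho>_pos by (simp add: z_eq)
    then show ?thesis
      using d norm_triangle_ineq[of "x0 - w" "w - z n"] by (simp add: dist_norm norm_minus_commute)
  qed
  have *: "breg (\<xi> n) w \<le> c0 * \<rho> powr p \<and> breg (\<xi> n) w \<le> breg (\<xi> (n - 1)) w" for n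
  proof (induction n)
    case 0
    show ?case using b0 by (simp add: \<xi>_0)
  next
    case (Suc n)
    then have "breg (\<xi> (Suc n)) w \<le> breg (\<xi> n) w - c1 * (1 - 1 / \<nu>) * (\<mu> n * norm (F (z n) - v) powr s)"
      using breg_step[OF w zB] by blast
    also have "\<dots> \<le> breg (\<xi> n) w" using descent_const_pos decrement_nonneg[of n] by simp
    finally show ?case using Suc by simp
  qed
  show "z n \<in> B" using zB * by blast
  have "norm (w - x n) \<le> \<rho>"
    using breg_le_imp_dist[OF we, of "\<xi> n" 1 \<rho>] *[of n] \<rho>_pos by (simp add: x_eq)
  then show "x n \<in> cball x0 (2 * \<rho>)"
    using d norm_triangle_ineq[of "x0 - w" "w - x n"] by (simp add: dist_norm norm_minus_commute)
qed

text \<open>With ball membership settled, the induction works for every solution in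
  \<open>B\<close>, without a bound on its initial Bregman distance. It will be applied to the
  limit.\<close>

lemma breg_descent:
  assumes w: "sol w"
  shows "breg (\<xi> (Suc n)) w \<le> breg (\<xi> n) w - c1 * (1 - 1 / \<nu>) * (\<mu> n * norm (F (z n) - v) powr s)"
proof (rule breg_step[OF w z_in_ball])
  show "breg (\<xi> n) w \<le> breg (\<xi> (n - 1)) w"
  proof (induction n)
    case (Suc n)
    have "breg (\<xi> (Suc n)) w \<le> breg (\<xi> n) w - c1 * (1 - 1 / \<nu>) * (\<mu> n * norm (F (z n) - v) powr s)"
      by (rule breg_step[OF w z_in_ball Suc])
    also have "\<dots> \<le> breg (\<xi> n) w" using descent_const_pos decrement_nonneg[of n] by simp
    finally show ?case by simp
  qed simp
qed

lemma decseq_breg: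
  assumes w: "sol w"
  shows "decseq (\<lambda>n. breg (\<xi> n) w)"
proof (rule decseq_SucI)
  fix n
  have "0 \<le> c1 * (1 - 1 / \<nu>) * (\<mu> n * norm (F (z n) - v) powr s)"
    using descent_const_pos decrement_nonneg[of n] by simp
  then show "breg (\<xi> (Suc n)) w \<le> breg (\<xi> n) w" using breg_descent[OF w, of n] by linarith
qed

lemma summable_decrement: "summable (\<lambda>n. \<mu> n * norm (F (z n) - v) powr s)"
proof -
  obtain w where w: "sol w" by (rule solvable_breg)
  let ?a = "\<lambda>n. \<mu> n * norm (F (z n) - v) powr s" and ?c = "c1 * (1 - 1 / \<nu>)"
  have "?c * (\<Sum>k<n. ?a k) \<le> breg (\<xi> 0) w - breg (\<xi> n) w" for n
  proof (induction n)
    case (Suc n)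
    then show ?case using breg_descent[OF w, of n] by (simp add: distrib_left)
  qed simp
  moreover have "0 \<le> breg (\<xi> n) w" for n using breg_nonneg w by (simp add: sol_def)
  ultimately have "?c * (\<Sum>k<n. ?a k) \<le> breg (\<xi> 0) w" for n by (smt (verit))
  then have "(\<Sum>k<n. ?a k) \<le> breg (\<xi> 0) w / ?c" for n
    using descent_const_pos by (simp add: pos_le_divide_eq mult.commute)
  then show ?thesis
    using decrement_nonneg by (intro summableI_nonneg_bounded)
qed

text \<open>Otherwise all decrements exceed a fixed positive number, against their
  summability.\<close>

lemma discrepancy_reached:
  assumes "0 < \<delta>"
  shows "\<exists>n. norm (F (z n) - v) \<le> \<tau> * \<delta>"
proof (rule ccontr)
  assume "\<not> ?thesis"
  then have gt: "\<tau> * \<delta> < norm (F (z n) - v)" for n by (simp add: not_le)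
  define c where "c = min (\<mu>0 / C0 powr p) \<mu>1"
  have c: "0 < c" using \<mu>0_pos \<mu>1_pos C0_pos by (simp add: c_def)
  have \<tau>\<delta>: "0 < \<tau> * \<delta>" using assms \<tau>_gt_1 by simp
  have "c * (\<tau> * \<delta>) powr p \<le> \<mu> n * norm (F (z n) - v) powr s" for n
  proof -
    have "(\<tau> * \<delta>) powr p \<le> norm (F (z n) - v) powr p"
      using gt[of n] \<tau>\<delta> p_gt_1 by (intro powr_mono2) auto
    then have "c * (\<tau> * \<delta>) powr p \<le> c * norm (F (z n) - v) powr p" using c by simp
    also have "\<dots> \<le> \<mu> n * norm (F (z n) - v) powr s"
      unfolding c_def \<mu>_eq by (rule step_residual_lower[OF gt \<delta>_nonneg z_in_ball])
    finally show ?thesis .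
  qed
  then have "c * (\<tau> * \<delta>) powr p \<le> 0"
    by (intro LIMSEQ_le_const[OF summable_LIMSEQ_zero[OF summable_decrement]]) auto
  moreover have "0 < (\<tau> * \<delta>) powr p" using \<tau>\<delta> by (metis powr_gt_zero less_irrefl)
  then have "0 < c * (\<tau> * \<delta>) powr p" by (rule mult_pos_pos[OF c])
  ultimately show False by simp
qed

lemma discrepancy_index_residual:
  assumes "0 < \<delta>"
  shows "norm (F (z (discrepancy_index F z v \<tau> \<delta>)) - v) \<le> \<tau> * \<delta>"
proof -
  let ?P = "\<lambda>n. norm (F (z n) - v) \<le> \<tau> * \<delta>"
  obtain m where "?P m" using discrepancy_reached[OF assms] by blast
  then have least: "?P (LEAST n. ?P n)" by (rule LeastI)
  have "discrepancy_index F z v \<tau> \<delta> = (LEAST n. ?P n)"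
    unfolding discrepancy_index_def
  proof (rule the_equality)
    show "?P (LEAST n. ?P n) \<and> (\<forall>n<LEAST n. ?P n. \<tau> * \<delta> < norm (F (z n) - v))"
      using least not_less_Least by (metis not_le)
  next
    fix N assume "?P N \<and> (\<forall>n<N. \<tau> * \<delta> < norm (F (z n) - v))"
    then show "N = (LEAST n. ?P n)" by (intro Least_equality[symmetric]) (auto simp: not_less[symmetric])
  qed
  then show ?thesis using least by simp
qed

end

section \<open>Convergence for exact data\<close>

text \<open>If \<open>R\<close> has infinitely many zeros, these serve. Otherwise \<open>R\<close>
  is positive beyond some \<open>N\<close>, and tending to 0 it attains new minima arbitrarily
  late.\<close>

lemma ex_record_subsequence:
  fixes R :: "nat \<Rightarrow> real"
  assumes R: "R \<longlonglongrightarrow> 0" and nonneg: "\<And>n. 0 \<le> R n"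
  obtains \<sigma> :: "nat \<Rightarrow> nat" where "strict_mono \<sigma>" "\<And>i j n. i \<le> j \<Longrightarrow> \<sigma> i \<le> n \<Longrightarrow> n \<le> \<sigma> j \<Longrightarrow> R (\<sigma> j) \<le> R n"
proof (cases "infinite {n. R n = 0}")
  case True
  then obtain \<sigma> :: "nat \<Rightarrow> nat" where "strict_mono \<sigma>" "\<And>n. \<sigma> n \<in> {n. R n = 0}"
    using infinite_enumerate by blast
  then show ?thesis using nonneg by (intro that) auto
next
  case False
  then obtain N where N: "\<And>n. R n = 0 \<Longrightarrow> n \<le> N"
    using finite_nat_set_iff_bounded_le by auto
  have pos: "0 < R n" if "N < n" for n
    using N[of n] that nonneg[of n] by (cases "R n = 0") auto
  let ?S = "{k. N < k \<and> (\<forall>n. N < n \<longrightarrow> n \<le> k \<longrightarrow> R k \<le> R n)}"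
  have "\<exists>k\<in>?S. M < k" for M
  proof -
    \<comment> \<open>Any index beyond \<open>N\<close> with a value below this minimum lies beyond
      the window, hence beyond \<open>M\<close>.\<close>
    define e where "e = Min (R ` {Suc N..Suc (N + M)})"
    have e: "0 < e" unfolding e_def using pos by (subst Min_gr_iff) auto
    have e_le: "e \<le> R n" if "N < n" "n \<le> Suc (N + M)" for n
      unfolding e_def using that by (intro Min_le) auto
    have "\<forall>\<^sub>F n in sequentially. R n < e \<and> N < n"
      using order_tendstoD(2)[OF R e] eventually_gt_at_top[of N] by eventually_elim simp
    then have ex: "\<exists>n. R n < e \<and> N < n" using eventually_happens'[OF sequentially_bot] by blast
    \<comment> \<open>Being the first index with a value below \<open>e\<close>, \<open>k\<close> is
      a record: all earlier values beyond \<open>N\<close> are at least \<open>e\<close>.\<close>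
    define k where "k = (LEAST n. R n < e \<and> N < n)"
    have k: "R k < e" "N < k" using LeastI_ex[OF ex] by (auto simp: k_def)
    have "R k \<le> R n" if "N < n" "n \<le> k" for n
    proof (cases "n = k")
      case False
      then have "\<not> (R n < e \<and> N < n)" 
        using that not_less_Least[of n "\<lambda>n. R n < e \<and> N < n"] by (simp add: k_def)
      then show ?thesis using k that by simp
    qed simp
    moreover have "M < k" using k e_le[of k] by (meson leD le_add2 le_SucI leI order_trans)
    ultimately show ?thesis using k(2) by blast
  qed
  then have "infinite ?S" by (auto simp: infinite_nat_iff_unbounded)
  then obtain \<sigma> :: "nat \<Rightarrow> nat" where \<sigma>: "strict_mono \<sigma>" "\<And>n. \<sigma> n \<in> ?S"
    using infinite_enumerate by blast
  then show ?thesis by (intro that[of \<sigma>]) (auto intro: less_le_trans)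
qed

locale tpg_exact_run = tpg_run \<Theta> p c0 F L y x0 \<xi>0 \<rho> \<eta> C0 s \<tau> \<mu>0 \<mu>1 c1 \<nu> y 0 lam \<xi> x \<zeta> z \<mu>
  for \<Theta> :: "'x::banach \<Rightarrow> ereal" and p c0 :: real
    and F :: "'x \<Rightarrow> 'y::banach" and L :: "'x \<Rightarrow> ('x \<Rightarrow>\<^sub>L 'y)" and y :: 'y and x0 :: 'x
    and \<xi>0 :: "'x \<Rightarrow>\<^sub>L real" and \<rho> \<eta> C0 s \<tau> \<mu>0 \<mu>1 c1 \<nu> :: real
    and lam :: "nat \<Rightarrow> real" and \<xi> \<zeta> :: "nat \<Rightarrow> ('x \<Rightarrow>\<^sub>L real)" and x z :: "nat \<Rightarrow> 'x"
    and \<mu> :: "nat \<Rightarrow> real" +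
  assumes lam_summable: "summable (\<lambda>n. lam n * norm (\<xi> n - \<xi> (n - 1)))"
begin

lemma residual_tendsto_0: "(\<lambda>n. norm (F (z n) - y)) \<longlonglongrightarrow> 0"
proof -
  define c where "c = min (\<mu>0 / C0 powr p) \<mu>1"
  have c: "0 < c" using \<mu>0_pos \<mu>1_pos C0_pos by (simp add: c_def)
  have le: "c * norm (F (z n) - y) powr p \<le> \<mu> n * norm (F (z n) - y) powr s" for n
    using step_residual_lower[of 0 "F (z n) - y" "z n"] z_in_ball[of n]
    by (cases "F (z n) = y") (auto simp: c_def \<mu>_eq)
  have "(\<lambda>n. c * norm (F (z n) - y) powr p) \<longlonglongrightarrow> 0"
    by (rule tendsto_sandwich[OF _ _ tendsto_const summable_LIMSEQ_zero[OF summable_decrement]])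
      (use le c in auto)
  then have "(\<lambda>n. inverse c * (c * norm (F (z n) - y) powr p)) \<longlonglongrightarrow> inverse c * 0"
    by (intro tendsto_intros)
  then have "(\<lambda>n. (norm (F (z n) - y) powr p) powr (1 / p)) \<longlonglongrightarrow> 0 powr (1 / p)"
    using c p_gt_1 by (intro tendsto_powr') auto
  then show ?thesis using p_gt_1 by (simp add: powr_powr)
qed

text \<open>The size of the extrapolation, \<open>norm (\<zeta> n - \<xi> n)\<close>.\<close>

definition b :: "nat \<Rightarrow> real" where "b n = lam n * norm (\<xi> n - \<xi> (n - 1))"

lemma b_nonneg: "0 \<le> b n"
  using lam_nonneg by (simp add: b_def)

lemma b_tendsto_0: "b \<longlonglongrightarrow> 0"
  using summable_LIMSEQ_zero[OF lam_summable] by (simp add: b_def[abs_def])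

text \<open>A summable bound for the pairing of a dual increment: \<open>6 * \<rho>\<close> is the
  diameter bound of \<open>B\<close>, and 3 counts residuals at index \<open>n\<close>, two from
  \<open>F (z k) - F (z n)\<close> and one from \<open>F w - F (z n)\<close>.\<close>

definition a :: "nat \<Rightarrow> real" where
  "a n = 6 * \<rho> * b n + 3 * (1 + \<eta>) * (\<mu> n * norm (F (z n) - y) powr s)"

lemma summable_a: "summable a"
  unfolding a_def[abs_def] b_def[abs_def]
  by (intro summable_add summable_mult lam_summable summable_decrement)

lemma norm_B_diff: "u \<in> B \<Longrightarrow> w \<in> B \<Longrightarrow> norm (u - w) \<le> 6 * \<rho>"
  using dist_triangle2[of u w x0] by (simp add: dist_norm norm_minus_commute)

text \<open>If the residual at \<open>k\<close> is not larger than the one at \<open>n\<close>, then the tangential cone condition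
  bounds \<open>L (z n) (z k - w)\<close> by the residual at \<open>n\<close> alone. This is why the Cauchy property is shown
  along record indices of the residual.\<close>

lemma increment_pairing:
  assumes w: "sol w" and n: "norm (F (z k) - y) \<le> norm (F (z n) - y)"
  shows "blinfun_apply (\<xi> (Suc n) - \<xi> n) (z k - w) \<le> a n"
proof -
  define r where "r = F (z n) - y"
  have wB: "w \<in> B" and Fw: "F w = y" using w by (auto simp: sol_def)
  have "z k - w = (z k - z n) - (w - z n)" by simp
  then have "norm (blinfun_apply (L (z n)) (z k - w))
      \<le> norm (blinfun_apply (L (z n)) (z k - z n)) + norm (blinfun_apply (L (z n)) (w - z n))"
    by (metis blinfun.diff_right norm_triangle_ineq4)
  also have "\<dots> \<le> (1 + \<eta>) * norm (F (z k) - F (z n)) + (1 + \<eta>) * norm (F w - F (z n))"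
    by (intro add_mono L_apply_le wB z_in_ball)
  also have "\<dots> = (1 + \<eta>) * (norm (F (z k) - F (z n)) + norm r)"
    by (simp add: Fw r_def norm_minus_commute distrib_left)
  also have "\<dots> \<le> (1 + \<eta>) * (3 * norm r)"
    using n \<eta>(1) norm_triangle_ineq4[of "F (z k) - y" r]
    by (intro mult_left_mono) (auto simp: r_def)
  finally have "norm r powr (s - 1) * norm (blinfun_apply (L (z n)) (z k - w))
      \<le> norm r powr (s - 1) * ((1 + \<eta>) * (3 * norm r))"
    by (intro mult_left_mono) auto
  also have "\<dots> = 3 * (1 + \<eta>) * (norm r powr (s - 1) * norm r)" by (simp add: mult_ac)
  also have "\<dots> = 3 * (1 + \<eta>) * norm r powr s" unfolding powr_s_split ..
  finally have "- blinfun_apply (J r) (blinfun_apply (L (z n)) (z k - w)) \<le> 3 * (1 + \<eta>) * norm r powr s"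
    using J_apply_le[of r "- blinfun_apply (L (z n)) (z k - w)"]
    by (simp add: blinfun.minus_right)
  from mult_left_mono[OF this \<mu>_nonneg[of n]]
  have 1: "- (\<mu> n * blinfun_apply (J r) (blinfun_apply (L (z n)) (z k - w)))
      \<le> 3 * (1 + \<eta>) * (\<mu> n * norm r powr s)" by (simp add: mult_ac)
  have "blinfun_apply (\<xi> n - \<xi> (n - 1)) (z k - w) \<le> norm (\<xi> n - \<xi> (n - 1)) * norm (z k - w)"
    using norm_blinfun[of "\<xi> n - \<xi> (n - 1)" "z k - w"] by simp
  also have "\<dots> \<le> norm (\<xi> n - \<xi> (n - 1)) * (6 * \<rho>)"
    using norm_B_diff[OF z_in_ball wB] by (intro mult_left_mono) auto
  finally have "lam n * blinfun_apply (\<xi> n - \<xi> (n - 1)) (z k - w) \<le> 6 * \<rho> * b n"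
    using mult_left_mono[OF _ lam_nonneg[of n]] by (fastforce simp: b_def mult_ac)
  moreover have "\<xi> (Suc n) - \<xi> n = lam n *\<^sub>R (\<xi> n - \<xi> (n - 1)) - \<mu> n *\<^sub>R (J r o\<^sub>L L (z n))"
    by (simp add: \<xi>_Suc \<zeta>_eq r_def)
  then have "blinfun_apply (\<xi> (Suc n) - \<xi> n) (z k - w)
      = lam n * blinfun_apply (\<xi> n - \<xi> (n - 1)) (z k - w)
        - \<mu> n * blinfun_apply (J r) (blinfun_apply (L (z n)) (z k - w))"
    by (simp add: blinfun.diff_left blinfun.scaleR_left)
  ultimately show ?thesis using 1 by (simp add: a_def r_def)
qed

text \<open>The increments of \<open>\<xi>\<close> telescope; exchanging \<open>\<xi>\<close> for
  \<open>\<zeta>\<close> at the two ends costs the terms in \<open>b\<close>.\<close>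

lemma dual_increment_pairing:
  assumes w: "sol w" and lk: "l \<le> k"
    and rec: "\<And>n. l \<le> n \<Longrightarrow> n \<le> k \<Longrightarrow> norm (F (z k) - y) \<le> norm (F (z n) - y)"
  shows "blinfun_apply (\<zeta> k - \<zeta> l) (z k - w) \<le> (\<Sum>n<k. a n) - (\<Sum>n<l. a n) + 6 * \<rho> * (b k + b l)"
proof -
  have part: "blinfun_apply (\<xi> m - \<xi> l) (z k - w) \<le> (\<Sum>n<m. a n) - (\<Sum>n<l. a n)"
    if "l \<le> m" "m \<le> k" for m
    using that
  proof (induction m rule: dec_induct)
    case base
    show ?case by (simp add: blinfun.zero_left)
  next
    case (step m)
    then show ?case
      using increment_pairing[OF w rec[of m]] by (simp add: blinfun.diff_left)
  qed
  have \<zeta>\<xi>: "\<bar>blinfun_apply (\<zeta> n - \<xi> n) (z k - w)\<bar> \<le> 6 * \<rho> * b n" for n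
  proof -
    have "\<bar>blinfun_apply (\<zeta> n - \<xi> n) (z k - w)\<bar> \<le> norm (\<zeta> n - \<xi> n) * norm (z k - w)"
      using norm_blinfun[of "\<zeta> n - \<xi> n" "z k - w"] by simp
    also have "norm (\<zeta> n - \<xi> n) = b n" using lam_nonneg[of n] by (simp add: \<zeta>_eq b_def)
    also have "b n * norm (z k - w) \<le> b n * (6 * \<rho>)"
      using norm_B_diff[OF z_in_ball] w b_nonneg by (intro mult_left_mono) (auto simp: sol_def)
    finally show ?thesis by (simp add: mult_ac)
  qed
  have "blinfun_apply (\<zeta> k - \<zeta> l) (z k - w) = blinfun_apply (\<zeta> k - \<xi> k) (z k - w)
      + blinfun_apply (\<xi> k - \<xi> l) (z k - w) - blinfun_apply (\<zeta> l - \<xi> l) (z k - w)"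
    by (simp add: blinfun.diff_left)
  then show ?thesis
    using part[of k] lk \<zeta>\<xi>[of k] \<zeta>\<xi>[of l] by (simp add: distrib_left)
qed

text \<open>The distance at \<open>\<zeta> n\<close> lies between that at
  \<open>\<xi> (Suc n)\<close> and that at \<open>\<xi> n\<close> plus a null sequence. This
  transfers limits between \<open>x\<close> and \<open>z\<close>.\<close>

lemma breg_\<xi>_\<zeta>_tendsto:
  assumes w: "sol w"
  obtains d where "(\<lambda>n. breg (\<xi> n) w) \<longlonglongrightarrow> d" "(\<lambda>n. breg (\<zeta> n) w) \<longlonglongrightarrow> d"
proof -
  have we: "w \<in> edom" using w by (simp add: sol_def)
  obtain d where d: "(\<lambda>n. breg (\<xi> n) w) \<longlonglongrightarrow> d"
    using decseq_convergent[OF decseq_breg[OF w], of 0] breg_nonneg[OF we] by metis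
  let ?u = "\<lambda>n. breg (\<xi> n) w + c1 / \<nu> * (\<mu> n * norm (F (z n) - y) powr s)"
  have "?u \<longlonglongrightarrow> d + c1 / \<nu> * 0"
    by (intro tendsto_intros d summable_LIMSEQ_zero[OF summable_decrement])
  then have u: "?u \<longlonglongrightarrow> d" by simp
  have "(\<lambda>n. breg (\<zeta> n) w) \<longlonglongrightarrow> d"
  proof (rule tendsto_sandwich[OF _ _ LIMSEQ_Suc[OF d] u])
    show "\<forall>\<^sub>F n in sequentially. breg (\<xi> (Suc n)) w \<le> breg (\<zeta> n) w"
    proof (intro always_eventually allI)
      fix n
      have "0 \<le> c1 * (\<mu> n * norm (F (z n) - y) powr s)"
        using c1_pos decrement_nonneg[of n] by simp
      then show "breg (\<xi> (Suc n)) w \<le> breg (\<zeta> n) w"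
        using breg_\<xi>_Suc_le[OF w z_in_ball, of n] by linarith
    qed
    show "\<forall>\<^sub>F n in sequentially. breg (\<zeta> n) w \<le> ?u n"
    proof (intro always_eventually allI)
      fix n
      have "breg (\<xi> n) w \<le> breg (\<xi> (n - 1)) w" using decseqD[OF decseq_breg[OF w]] by simp
      then show "breg (\<zeta> n) w \<le> ?u n" using breg_\<zeta>_le lam_descent[of n] by fastforce
    qed
  qed
  then show ?thesis using that d by blast
qed

theorem exact_convergence:
  obtains w where "sol w" "w \<in> cball x0 (2 * \<rho>)" "(\<lambda>n. breg (\<xi> n) w) \<longlonglongrightarrow> 0"
proof -
  obtain w0 where w0: "sol w0" by (rule solvable_breg)
  obtain \<sigma> :: "nat \<Rightarrow> nat" where \<sigma>: "strict_mono \<sigma>"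
    and rec: "\<And>i j n. i \<le> j \<Longrightarrow> \<sigma> i \<le> n \<Longrightarrow> n \<le> \<sigma> j
      \<Longrightarrow> norm (F (z (\<sigma> j)) - y) \<le> norm (F (z n) - y)"
    by (rule ex_record_subsequence[OF residual_tendsto_0]) auto
  obtain d where d: "(\<lambda>n. breg (\<zeta> n) w0) \<longlonglongrightarrow> d" using breg_\<xi>_\<zeta>_tendsto[OF w0] by blast
  \<comment> \<open>By the three-point identity, the Bregman distance between \<open>z\<close> at
    two record indices is at most a difference of values of \<open>U\<close> plus terms in
    \<open>b\<close>. As \<open>U\<close> converges, this gives the Cauchy property.\<close>
  define U where "U n = (\<Sum>k<n. a k) - breg (\<zeta> n) w0" for n
  have "U \<longlonglongrightarrow> suminf a - d"
    unfolding U_def using summable_LIMSEQ[OF summable_a] d by (intro tendsto_intros)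
  then have U: "(\<lambda>i. U (\<sigma> i)) \<longlonglongrightarrow> suminf a - d" using LIMSEQ_subseq_LIMSEQ[OF _ \<sigma>] by (auto simp: o_def)
  have b: "(\<lambda>i. b (\<sigma> i)) \<longlonglongrightarrow> 0" using LIMSEQ_subseq_LIMSEQ[OF b_tendsto_0 \<sigma>] by (simp add: o_def)
  have zB: "z n \<in> B" for n by (rule z_in_ball)
  have zE: "z n \<in> edom" for n using grad_dom by (simp add: z_eq)
  have est: "breg (\<zeta> (\<sigma> i)) (z (\<sigma> j)) \<le> U (\<sigma> j) - U (\<sigma> i) + 6 * \<rho> * (b (\<sigma> j) + b (\<sigma> i))"
    if "i \<le> j" for i j
  proof -
    have "\<sigma> i \<le> \<sigma> j" using that \<sigma> by (simp add: strict_mono_less_eq)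
    then have "blinfun_apply (\<zeta> (\<sigma> j) - \<zeta> (\<sigma> i)) (z (\<sigma> j) - w0)
        \<le> (\<Sum>n<\<sigma> j. a n) - (\<Sum>n<\<sigma> i. a n) + 6 * \<rho> * (b (\<sigma> j) + b (\<sigma> i))"
      by (rule dual_increment_pairing[OF w0]) (rule rec[OF that])
    then show ?thesis
      using breg_three_point[of "\<zeta> (\<sigma> j)" w0 "\<zeta> (\<sigma> i)"] by (simp add: U_def z_eq)
  qed
  have "Cauchy (\<lambda>i. z (\<sigma> i))"
  proof (rule metric_CauchyI)
    fix e :: real assume e: "0 < e"
    define e' where "e' = c0 * e powr p"
    have e': "0 < e'" using e c0_pos by (simp add: e'_def)
    obtain N1 where N1: "\<And>i j. i \<ge> N1 \<Longrightarrow> j \<ge> N1 \<Longrightarrow> dist (U (\<sigma> i)) (U (\<sigma> j)) < e' / 2"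
      using metric_CauchyD[OF LIMSEQ_imp_Cauchy[OF U], of "e' / 2"] e' by auto
    \<comment> \<open>Two such terms times \<open>6 * \<rho>\<close> stay below
      \<open>e' / 2\<close>.\<close>
    have "\<forall>\<^sub>F i in sequentially. b (\<sigma> i) < e' / (24 * \<rho>)"
      using order_tendstoD(2)[OF b] e' \<rho>_pos by simp
    then obtain N2 where N2: "\<And>i. i \<ge> N2 \<Longrightarrow> b (\<sigma> i) < e' / (24 * \<rho>)"
      by (auto simp: eventually_sequentially)
    have le: "dist (z (\<sigma> j)) (z (\<sigma> i)) < e" if "i \<ge> max N1 N2" "i \<le> j" for i j
    proof (rule ccontr)
      assume "\<not> ?thesis"
      then have "e powr p \<le> norm (z (\<sigma> j) - z (\<sigma> i)) powr p"
        using e p_gt_1 by (intro powr_mono2) (auto simp: dist_norm)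
      then have "e' \<le> c0 * norm (z (\<sigma> j) - grad (\<zeta> (\<sigma> i))) powr p"
        using c0_pos by (simp add: e'_def z_eq)
      also have "\<dots> \<le> U (\<sigma> j) - U (\<sigma> i) + 6 * \<rho> * (b (\<sigma> j) + b (\<sigma> i))"
        using breg_lower[OF zE] est[OF that(2)] by (rule order_trans)
      also have "\<dots> < e' / 2 + 6 * \<rho> * (e' / (24 * \<rho>) + e' / (24 * \<rho>))"
      proof (rule add_strict_mono)
        show "U (\<sigma> j) - U (\<sigma> i) < e' / 2" 
        proof -
          have "dist (U (\<sigma> j)) (U (\<sigma> i)) < e' / 2" using that by (intro N1) auto
          then show ?thesis unfolding dist_real_def by linarith
        qed
        show "6 * \<rho> * (b (\<sigma> j) + b (\<sigma> i)) < 6 * \<rho> * (e' / (24 * \<rho>) + e' / (24 * \<rho>))"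
          using N2[of i] N2[of j] that \<rho>_pos by (intro mult_strict_left_mono add_strict_mono) auto
      qed
      also have "\<dots> = e'" using \<rho>_pos by (simp add: field_simps)
      finally show False by simp
    qed
    show "\<exists>M. \<forall>i\<ge>M. \<forall>j\<ge>M. dist (z (\<sigma> i)) (z (\<sigma> j)) < e"
      using le by (metis dist_commute linear)
  qed
  then obtain w where w: "(\<lambda>i. z (\<sigma> i)) \<longlonglongrightarrow> w" using Cauchy_convergent convergent_def by blast
  have wB: "w \<in> B" and Fz: "(\<lambda>i. F (z (\<sigma> i))) \<longlonglongrightarrow> F w"
    using tendsto_in_B[OF w] zB by auto
  have "(\<lambda>i. norm (F (z (\<sigma> i)) - y)) \<longlonglongrightarrow> 0"
    using LIMSEQ_subseq_LIMSEQ[OF residual_tendsto_0 \<sigma>] by (simp add: o_def)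
  then have "(\<lambda>i. F (z (\<sigma> i))) \<longlonglongrightarrow> y" using LIM_zero_iff tendsto_norm_zero_iff by blast
  then have Fw: "F w = y" using Fz LIMSEQ_unique by blast
  \<comment> \<open>In \<open>est\<close>, \<open>i\<close> is kept fixed while \<open>j\<close>
    tends to infinity; lower semicontinuity puts \<open>w\<close> into the effective domain and
    passes the bound on to it.\<close>
  have lim: "w \<in> edom \<and> breg (\<zeta> (\<sigma> i)) w \<le> suminf a - d - U (\<sigma> i) + 6 * \<rho> * b (\<sigma> i)" for i
  proof -
    let ?v = "\<lambda>j. U (\<sigma> j) - U (\<sigma> i) + 6 * \<rho> * (b (\<sigma> j) + b (\<sigma> i)) - conjv (\<zeta> (\<sigma> i))
        + blinfun_apply (\<zeta> (\<sigma> i)) (z (\<sigma> j))"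
    have v: "?v \<longlonglongrightarrow> (suminf a - d) - U (\<sigma> i) + 6 * \<rho> * (0 + b (\<sigma> i)) - conjv (\<zeta> (\<sigma> i))
        + blinfun_apply (\<zeta> (\<sigma> i)) w"
      by (intro tendsto_intros U b w)
    have le: "val (z (\<sigma> (j + i))) \<le> ?v (j + i)" for j
      using est[of i "j + i"] by (simp add: breg_def)
    note val_lsc[OF LIMSEQ_ignore_initial_segment[OF w, of i] zE le
        LIMSEQ_ignore_initial_segment[OF v, of i]]
    then show ?thesis by (simp add: breg_def)
  qed
  have sol: "sol w" using lim wB Fw by (simp add: sol_def)
  obtain d' where d': "(\<lambda>n. breg (\<xi> n) w) \<longlonglongrightarrow> d'" "(\<lambda>n. breg (\<zeta> n) w) \<longlonglongrightarrow> d'"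
    by (rule breg_\<xi>_\<zeta>_tendsto[OF sol])
  have "(\<lambda>i. breg (\<zeta> (\<sigma> i)) w) \<longlonglongrightarrow> d'"
    using LIMSEQ_subseq_LIMSEQ[OF d'(2) \<sigma>] by (simp add: o_def)
  \<comment> \<open>The bound tends to 0 because \<open>U\<close> converges along the records. Since
    \<open>d'\<close> is the limit of the whole sequence, it must be 0.\<close>
  moreover have "(\<lambda>i. suminf a - d - U (\<sigma> i) + 6 * \<rho> * b (\<sigma> i)) \<longlonglongrightarrow> suminf a - d - (suminf a - d) + 6 * \<rho> * 0"
    by (intro tendsto_intros U b)
  ultimately have "d' \<le> 0" using lim LIMSEQ_le by fastforce
  moreover have "0 \<le> d'"
    using LIMSEQ_le_const[OF d'(1)] breg_nonneg lim by blast
  ultimately have b0: "(\<lambda>n. breg (\<xi> n) w) \<longlonglongrightarrow> 0" using d'(1) by simp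
  have "(\<lambda>n. x n) \<longlonglongrightarrow> w"
    using breg_tendsto_0_imp[OF _ b0] lim by (simp add: x_eq)
  then have "w \<in> cball x0 (2 * \<rho>)"
    by (intro Lim_in_closed_set[OF closed_cball always_eventually[OF allI[OF x_in_ball]]]) auto
  then show ?thesis using that sol b0 by blast
qed

end

section \<open>Stability and convergence for noisy data\<close>

context tpg_run
begin

text \<open>Without a decrement, \<open>lam_descent\<close> leaves no room for an extrapolation.
  This keeps the exact run from leaving a solution once it is hit.\<close>

lemma inertia_vanishes:
  assumes "\<mu> n = 0"
  shows "\<zeta> n = \<xi> n"
proof (cases "lam n = 0 \<or> \<xi> n = \<xi> (n - 1)")
  case False
  then have "0 < lam n" using lam_nonneg[of n] by simp
  then have "0 < \<kappa> * (lam n powr q + lam n) * norm (\<xi> n - \<xi> (n - 1)) powr q"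
    using False \<kappa>_pos by (intro mult_pos_pos add_pos_pos) auto
  then show ?thesis using lam_descent[of n] assms by simp
qed (auto simp: \<zeta>_eq)

end

context tpg_exact_run
begin

lemma stationary:
  assumes "F (z n) = y" and "n \<le> m"
  shows "\<xi> m = \<xi> n"
proof -
  have "F (z m) = y \<and> \<xi> m = \<xi> n"
    using \<open>n \<le> m\<close>
  proof (induction m rule: dec_induct)
    case (step m)
    then have "\<mu> m = 0" by (simp add: \<mu>_eq tpg_step_size_def)
    then have "\<zeta> m = \<xi> m" "\<xi> (Suc m) = \<xi> m"
      using inertia_vanishes by (auto simp: \<xi>_Suc)
    \<comment> \<open>\<open>\<xi> (Suc m) = \<xi> m\<close> cancels the next extrapolation whatever
      \<open>lam (Suc m)\<close> is.\<close>
    then have "z (Suc m) = z m" by (simp add: z_eq \<zeta>_eq[of "Suc m"])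
    with step \<open>\<xi> (Suc m) = \<xi> m\<close> show ?case by simp
  qed (use assms(1) in simp)
  then show ?thesis ..
qed

lemma breg_zero_if_solved:
  assumes "F (z n) = y" and lim: "(\<lambda>n. breg (\<xi> n) w) \<longlonglongrightarrow> 0"
  shows "breg (\<xi> n) w = 0"
proof -
  have "\<forall>\<^sub>F m in sequentially. breg (\<xi> m) w = breg (\<xi> n) w"
    using eventually_ge_at_top[of n] by eventually_elim (metis stationary[OF assms(1)])
  then show ?thesis by (rule LIMSEQ_unique[OF tendsto_eventually lim])
qed

text \<open>The kernel condition makes \<open>\<xi> n - \<xi>0\<close> vanish at \<open>w - u\<close>, so the Bregman distances to
  \<open>w\<close> and \<open>u\<close> differ by a constant, whose sign is given by the minimality of \<open>u\<close>.\<close>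

lemma limit_eq_minimizer:
  assumes w: "sol w" "(\<lambda>n. breg (\<xi> n) w) \<longlonglongrightarrow> 0" and u: "sol u" and min: "breg \<xi>0 u \<le> breg \<xi>0 w"
    and ker: "\<And>t. t \<in> B \<Longrightarrow> blinfun_kernel (L u) \<subseteq> blinfun_kernel (L t)"
  shows "w = u"
proof -
  have we: "w \<in> edom" and ue: "u \<in> edom" using w(1) u by (auto simp: sol_def)
  \<comment> \<open>\<open>F w = F u\<close> makes the right-hand side of the cone condition
    vanish.\<close>
  have "blinfun_apply (L u) (w - u) = 0"
    using cone[of w u] w(1) u by (simp add: sol_def)
  then have "blinfun_apply (L (z n)) (w - u) = 0" for n
    using ker[OF z_in_ball[of n]] by (auto simp: blinfun_kernel_def)
  \<comment> \<open>The recursion reaches back two indices, so the claim is carried for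
    \<open>n - 1\<close> as well; at 0 both indices coincide.\<close>
  then have eq: "blinfun_apply (\<xi> n) (w - u) = blinfun_apply \<xi>0 (w - u)
      \<and> blinfun_apply (\<xi> (n - 1)) (w - u) = blinfun_apply \<xi>0 (w - u)" for n
    by (induction n)
      (auto simp: \<xi>_0 \<xi>_Suc \<zeta>_eq blinfun.diff_left blinfun.add_left blinfun.scaleR_left)
  have "breg (\<xi> n) u \<le> breg (\<xi> n) w" for n
    using min eq[of n] by (simp add: breg_def blinfun.diff_right)
  then have "(\<lambda>n. breg (\<xi> n) u) \<longlonglongrightarrow> 0"
    using breg_nonneg[OF ue] by (intro tendsto_sandwich[OF _ _ tendsto_const w(2)]) auto
  then show ?thesis
    using breg_tendsto_0_imp[OF we w(2)] breg_tendsto_0_imp[OF ue] LIMSEQ_unique by blast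
qed

end

section \<open>Continuity of one gradient step as the noise level tends to 0\<close>

context tpg_setting
begin

lemma step_exact_zero: "step 0 0 A = 0"
  by (simp add: tpg_step_size_def)

context
  fixes zd :: "real \<Rightarrow> 'x" and vd :: "real \<Rightarrow> 'y" and z :: 'x and rd md
  assumes zd_lim: "(zd \<longlongrightarrow> z) (at_right 0)"
    and zd_B: "\<And>\<delta>. 0 < \<delta> \<Longrightarrow> zd \<delta> \<in> B"
    and vd_noise: "\<And>\<delta>. 0 < \<delta> \<Longrightarrow> norm (vd \<delta> - y) \<le> \<delta>"
  defines "rd \<equiv> \<lambda>\<delta>. F (zd \<delta>) - vd \<delta>"
    and "md \<equiv> \<lambda>\<delta>. step \<delta> (rd \<delta>) (L (zd \<delta>))"
begin

lemma eventually_pos: "\<forall>\<^sub>F \<delta> in at_right 0. 0 < (\<delta>::real)"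
  by (rule eventually_at_right_less)

lemma eventually_zd_B: "\<forall>\<^sub>F \<delta> in at_right 0. zd \<delta> \<in> B"
  using eventually_pos by eventually_elim (rule zd_B)

lemma z_B: "z \<in> B"
  by (rule tendsto_in_B(1)[OF zd_lim _ eventually_zd_B]) simp

lemma L_zd_lim: "((\<lambda>\<delta>. L (zd \<delta>)) \<longlongrightarrow> L z) (at_right 0)"
  by (rule tendsto_in_B(3)[OF zd_lim _ eventually_zd_B]) simp

lemma vd_lim: "(vd \<longlongrightarrow> y) (at_right 0)"
proof (rule Lim_null[THEN iffD2], rule Lim_null_comparison[OF _ tendsto_ident_at])
  show "\<forall>\<^sub>F \<delta> in at_right 0. norm (vd \<delta> - y) \<le> \<delta>"
    using eventually_pos by eventually_elim (rule vd_noise)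
qed

lemma rd_lim: "(rd \<longlongrightarrow> F z - y) (at_right 0)"
  unfolding rd_def by (intro tendsto_diff vd_lim tendsto_in_B(2)[OF zd_lim _ eventually_zd_B]) simp

text \<open>The step size itself is not claimed to converge. Its cap bounds the update by a multiple
  of \<open>norm r powr (p - 1)\<close> and the decrement by a multiple of
  \<open>norm r powr p\<close>, both with positive exponents.\<close>

lemma gradient_step_lim_solved:
  assumes "F z = y"
  shows "((\<lambda>\<delta>. md \<delta> *\<^sub>R (J (rd \<delta>) o\<^sub>L L (zd \<delta>))) \<longlongrightarrow> 0) (at_right 0)"
    and "((\<lambda>\<delta>. md \<delta> * norm (rd \<delta>) powr s) \<longlongrightarrow> 0) (at_right 0)"
proof -
  have r: "((\<lambda>\<delta>. norm (rd \<delta>)) \<longlongrightarrow> 0) (at_right 0)"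
    using tendsto_norm[OF rd_lim] assms by simp
  have lim: "((\<lambda>\<delta>. c * (\<mu>1 * norm (rd \<delta>) powr a)) \<longlongrightarrow> 0) (at_right 0)" if "0 < a" for a c
  proof -
    have "((\<lambda>\<delta>. c * (\<mu>1 * norm (rd \<delta>) powr a)) \<longlongrightarrow> c * (\<mu>1 * 0 powr a)) (at_right 0)"
      using that by (intro tendsto_mult tendsto_const tendsto_powr' r) auto
    then show ?thesis by simp
  qed
  have "0 < p - s + (s - 1)" "0 < p - s + s" using p_gt_1 by auto
  note lims = this[THEN lim]
  show "((\<lambda>\<delta>. md \<delta> *\<^sub>R (J (rd \<delta>) o\<^sub>L L (zd \<delta>))) \<longlongrightarrow> 0) (at_right 0)"
  proof (rule Lim_null_comparison[OF _ lims(1)[of C0]])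
    show "\<forall>\<^sub>F \<delta> in at_right 0. norm (md \<delta> *\<^sub>R (J (rd \<delta>) o\<^sub>L L (zd \<delta>)))
        \<le> C0 * (\<mu>1 * norm (rd \<delta>) powr (p - s + (s - 1)))"
      using eventually_zd_B
    proof eventually_elim
      case (elim \<delta>)
      have "norm (md \<delta> *\<^sub>R (J (rd \<delta>) o\<^sub>L L (zd \<delta>))) \<le> md \<delta> * (C0 * norm (rd \<delta>) powr (s - 1))"
        using mult_left_mono[OF compose_norm_le[OF elim] step_nonneg]
          step_nonneg[of \<delta> "rd \<delta>" "L (zd \<delta>)"] by (simp add: md_def)
      also have "\<dots> = C0 * (md \<delta> * norm (rd \<delta>) powr (s - 1))" by (simp add: mult_ac)
      also have "\<dots> \<le> C0 * (\<mu>1 * norm (rd \<delta>) powr (p - s + (s - 1)))"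
        unfolding md_def by (intro mult_left_mono step_residual_upper) (use C0_pos in auto)
      finally show ?case .
    qed
  qed
  show "((\<lambda>\<delta>. md \<delta> * norm (rd \<delta>) powr s) \<longlongrightarrow> 0) (at_right 0)"
  proof (rule Lim_null_comparison[OF always_eventually[OF allI] lims(2)[of 1]])
    show "norm (md \<delta> * norm (rd \<delta>) powr s) \<le> 1 * (\<mu>1 * norm (rd \<delta>) powr (p - s + s))" for \<delta>
      using step_residual_upper[of \<delta> "rd \<delta>" "L (zd \<delta>)" s] step_nonneg[of \<delta> "rd \<delta>" "L (zd \<delta>)"]
      by (simp add: md_def abs_mult)
  qed
qed

text \<open>Away from solutions the residual eventually exceeds \<open>\<tau> * \<delta>\<close> and
  the limiting gradient is nonzero, so the step size is eventually given by one continuous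
  formula.\<close>

lemma gradient_step_lim:
  shows "((\<lambda>\<delta>. md \<delta> *\<^sub>R (J (rd \<delta>) o\<^sub>L L (zd \<delta>)))
      \<longlongrightarrow> step 0 (F z - y) (L z) *\<^sub>R (J (F z - y) o\<^sub>L L z)) (at_right 0)" (is ?A)
    and "((\<lambda>\<delta>. md \<delta> * norm (rd \<delta>) powr s)
      \<longlongrightarrow> step 0 (F z - y) (L z) * norm (F z - y) powr s) (at_right 0)" (is ?B)
proof -
  have "?A \<and> ?B"
  proof (cases "F z = y")
    case True
    then show ?thesis using gradient_step_lim_solved by (simp add: step_exact_zero)
  next
    case False
    let ?r = "F z - y"
    define g where "g = norm (J ?r o\<^sub>L L z)"
    have r0: "?r \<noteq> 0" using False by simp
    obtain w where w: "sol w" by (rule solvable_breg)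
    have g0: "0 < g"
      unfolding g_def using gradient_nonzero[OF w z_B, of y 0] r0 by simp
    have JL: "((\<lambda>\<delta>. J (rd \<delta>) o\<^sub>L L (zd \<delta>)) \<longlongrightarrow> J ?r o\<^sub>L L z) (at_right 0)"
      by (intro bounded_bilinear.tendsto[OF bounded_bilinear_blinfun_compose] L_zd_lim
          isCont_tendsto_compose[OF isCont_duality_map[OF smooth s_gt_1 r0] rd_lim])
    note gl = tendsto_norm[OF JL]
    note rl = tendsto_norm[OF rd_lim]
    let ?m = "\<lambda>R g. min (\<mu>0 * R powr (p * (s - 1)) / g powr p) \<mu>1 * R powr (p - s)"
    have ml: "((\<lambda>\<delta>. ?m (norm (rd \<delta>)) (norm (J (rd \<delta>) o\<^sub>L L (zd \<delta>)))) \<longlongrightarrow> ?m (norm ?r) g) (at_right 0)"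
      using r0 g0 by (intro tendsto_intros rl gl[folded g_def]) auto
    have "((\<lambda>\<delta>. norm (rd \<delta>) - \<tau> * \<delta>) \<longlongrightarrow> norm ?r - \<tau> * 0) (at_right 0)"
      by (intro tendsto_intros rl)
    then have "\<forall>\<^sub>F \<delta> in at_right 0. 0 < norm (rd \<delta>) - \<tau> * \<delta>"
      using r0 by (intro order_tendstoD(1)) auto
    moreover have "\<forall>\<^sub>F \<delta> in at_right 0. 0 < norm (J (rd \<delta>) o\<^sub>L L (zd \<delta>))"
      using gl[folded g_def] g0 by (rule order_tendstoD(1))
    ultimately have "\<forall>\<^sub>F \<delta> in at_right 0. ?m (norm (rd \<delta>)) (norm (J (rd \<delta>) o\<^sub>L L (zd \<delta>))) = md \<delta>"
      by eventually_elim (simp add: md_def tpg_step_size_def Let_def)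
    from Lim_transform_eventually[OF ml this]
    have "(md \<longlongrightarrow> ?m (norm ?r) g) (at_right 0)" .
    moreover have "?m (norm ?r) g = step 0 ?r (L z)"
      using r0 g0 by (simp add: tpg_step_size_def Let_def g_def)
    ultimately have "(md \<longlongrightarrow> step 0 ?r (L z)) (at_right 0)" by simp
    then show ?thesis 
      using r0 by (intro conjI tendsto_scaleR JL tendsto_mult tendsto_powr rl tendsto_const) auto
  qed
  then show ?A ?B by auto
qed

end

end

section \<open>Passage from the noisy runs to the exact run\<close>

locale tpg_family = tpg_setting \<Theta> p c0 F L y x0 \<xi>0 \<rho> \<eta> C0 s \<tau> \<mu>0 \<mu>1 c1 \<nu>
  for \<Theta> :: "'x::banach \<Rightarrow> ereal" and p c0 :: real
    and F :: "'x \<Rightarrow> 'y::banach" and L :: "'x \<Rightarrow> ('x \<Rightarrow>\<^sub>L 'y)" and y :: 'y and x0 :: 'x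
    and \<xi>0 :: "'x \<Rightarrow>\<^sub>L real" and \<rho> \<eta> C0 s \<tau> \<mu>0 \<mu>1 c1 \<nu> :: real +
  fixes yd :: "real \<Rightarrow> 'y" and lamd :: "real \<Rightarrow> nat \<Rightarrow> real"
    and \<xi>d \<zeta>d :: "real \<Rightarrow> nat \<Rightarrow> ('x \<Rightarrow>\<^sub>L real)" and xd zd :: "real \<Rightarrow> nat \<Rightarrow> 'x"
    and \<mu>d :: "real \<Rightarrow> nat \<Rightarrow> real"
    and lam :: "nat \<Rightarrow> real" and \<xi> \<zeta> :: "nat \<Rightarrow> ('x \<Rightarrow>\<^sub>L real)" and x z :: "nat \<Rightarrow> 'x"
    and \<mu> :: "nat \<Rightarrow> real"
  assumes runs: "\<And>\<delta>. 0 < \<delta> \<Longrightarrow> tpg_run \<Theta> p c0 F L y x0 \<xi>0 \<rho> \<eta> C0 s \<tau> \<mu>0 \<mu>1 c1 \<nu>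
      (yd \<delta>) \<delta> (lamd \<delta>) (\<xi>d \<delta>) (xd \<delta>) (\<zeta>d \<delta>) (zd \<delta>) (\<mu>d \<delta>)"
    and exact: "tpg_iterates \<Theta> F L p s \<tau> \<mu>0 \<mu>1 x0 \<xi>0 y 0 lam \<xi> x \<zeta> z \<mu>"
    and exact_lam_nonneg: "\<And>n. 0 \<le> lam n"
    and lam_lim: "\<And>n. ((\<lambda>\<delta>. lamd \<delta> n) \<longlongrightarrow> lam n) (at_right 0)"
    and exact_lam_summable: "summable (\<lambda>n. lam n * norm (\<xi> n - \<xi> (n - 1)))"
begin

lemma pos_eventuallyI: "(\<And>\<delta>. 0 < \<delta> \<Longrightarrow> P \<delta>) \<Longrightarrow> \<forall>\<^sub>F \<delta> in at_right (0::real). P \<delta>"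
  using eventually_at_right_less[of "0::real"] by (rule eventually_mono)

lemma \<zeta>d_lim:
  assumes "((\<lambda>\<delta>. \<xi>d \<delta> n) \<longlongrightarrow> \<xi> n) (at_right 0)"
    and "((\<lambda>\<delta>. \<xi>d \<delta> (n - 1)) \<longlongrightarrow> \<xi> (n - 1)) (at_right 0)"
  shows "((\<lambda>\<delta>. \<zeta>d \<delta> n) \<longlongrightarrow> \<zeta> n) (at_right 0)" and "((\<lambda>\<delta>. zd \<delta> n) \<longlongrightarrow> z n) (at_right 0)"
proof -
  have "((\<lambda>\<delta>. \<xi>d \<delta> n + lamd \<delta> n *\<^sub>R (\<xi>d \<delta> n - \<xi>d \<delta> (n - 1)))
      \<longlongrightarrow> \<xi> n + lam n *\<^sub>R (\<xi> n - \<xi> (n - 1))) (at_right 0)"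
    by (intro tendsto_intros assms lam_lim)
  moreover have "\<forall>\<^sub>F \<delta> in at_right 0.
      \<xi>d \<delta> n + lamd \<delta> n *\<^sub>R (\<xi>d \<delta> n - \<xi>d \<delta> (n - 1)) = \<zeta>d \<delta> n"
    by (rule pos_eventuallyI) (simp add: tpg_run.\<zeta>_eq[OF runs])
  ultimately show \<zeta>: "((\<lambda>\<delta>. \<zeta>d \<delta> n) \<longlongrightarrow> \<zeta> n) (at_right 0)"
    using exact by (simp add: tpg_iterates_def Lim_transform_eventually)
  have "\<forall>\<^sub>F \<delta> in at_right 0. grad (\<zeta>d \<delta> n) = zd \<delta> n"
    by (rule pos_eventuallyI) (simp add: tpg_run.z_eq[OF runs])
  from Lim_transform_eventually[OF tendsto_grad[OF \<zeta>] this]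
  show "((\<lambda>\<delta>. zd \<delta> n) \<longlongrightarrow> z n) (at_right 0)"
    using exact by (simp add: tpg_iterates_def)
qed

lemma zd_in_B: "0 < \<delta> \<Longrightarrow> zd \<delta> n \<in> B"
  by (rule tpg_run.z_in_ball[OF runs])

lemma yd_noise: "0 < \<delta> \<Longrightarrow> norm (yd \<delta> - y) \<le> \<delta>"
  by (rule tpg_run.noise[OF runs])

lemma \<xi>d_lim:
  "((\<lambda>\<delta>. \<xi>d \<delta> n) \<longlongrightarrow> \<xi> n) (at_right 0) \<and> ((\<lambda>\<delta>. \<xi>d \<delta> (n - 1)) \<longlongrightarrow> \<xi> (n - 1)) (at_right 0)"
proof (induction n)
  case 0
  have "\<forall>\<^sub>F \<delta> in at_right 0. \<xi>d \<delta> 0 = \<xi> 0"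
    using exact by (intro pos_eventuallyI) (simp add: tpg_run.\<xi>_0[OF runs] tpg_iterates_def)
  then show ?case by (simp add: tendsto_eventually)
next
  case (Suc n)
  then have \<zeta>: "((\<lambda>\<delta>. \<zeta>d \<delta> n) \<longlongrightarrow> \<zeta> n) (at_right 0)" and z: "((\<lambda>\<delta>. zd \<delta> n) \<longlongrightarrow> z n) (at_right 0)"
    using \<zeta>d_lim by auto
  have "((\<lambda>\<delta>. \<zeta>d \<delta> n - step \<delta> (F (zd \<delta> n) - yd \<delta>) (L (zd \<delta> n)) *\<^sub>R
        (J (F (zd \<delta> n) - yd \<delta>) o\<^sub>L L (zd \<delta> n)))
      \<longlongrightarrow> \<zeta> n - step 0 (F (z n) - y) (L (z n)) *\<^sub>R (J (F (z n) - y) o\<^sub>L L (z n))) (at_right 0)"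
    by (rule tendsto_diff[OF \<zeta> gradient_step_lim(1)[OF z zd_in_B yd_noise]])
  moreover have "\<forall>\<^sub>F \<delta> in at_right 0. \<zeta>d \<delta> n - step \<delta> (F (zd \<delta> n) - yd \<delta>) (L (zd \<delta> n)) *\<^sub>R
        (J (F (zd \<delta> n) - yd \<delta>) o\<^sub>L L (zd \<delta> n)) = \<xi>d \<delta> (Suc n)"
    by (rule pos_eventuallyI) (simp add: tpg_run.\<xi>_Suc[OF runs] tpg_run.\<mu>_eq[OF runs])
  ultimately have "((\<lambda>\<delta>. \<xi>d \<delta> (Suc n)) \<longlongrightarrow> \<xi> (Suc n)) (at_right 0)"
    using exact by (simp add: tpg_iterates_def Lim_transform_eventually)
  then show ?case using Suc by simp
qed

lemmas zd_lim = \<zeta>d_lim(2)[OF \<xi>d_lim[THEN conjunct1] \<xi>d_lim[THEN conjunct2]]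

lemma inertia_lim:
  "((\<lambda>\<delta>. \<kappa> * (lamd \<delta> n powr q + lamd \<delta> n) * norm (\<xi>d \<delta> n - \<xi>d \<delta> (n - 1)) powr q)
    \<longlongrightarrow> \<kappa> * (lam n powr q + lam n) * norm (\<xi> n - \<xi> (n - 1)) powr q) (at_right 0)"
proof -
  \<comment> \<open>The limit may be 0, where continuity of \<open>powr\<close> relies on
    nonnegative bases and a positive exponent.\<close>
  have "((\<lambda>\<delta>. lamd \<delta> n powr q) \<longlongrightarrow> lam n powr q) (at_right 0)"
    using q_gt_1 exact_lam_nonneg tpg_run.lam_nonneg[OF runs]
    by (intro tendsto_powr' lam_lim tendsto_const) (auto intro: pos_eventuallyI)
  moreover have "((\<lambda>\<delta>. norm (\<xi>d \<delta> n - \<xi>d \<delta> (n - 1)) powr q)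
      \<longlongrightarrow> norm (\<xi> n - \<xi> (n - 1)) powr q) (at_right 0)"
    using q_gt_1 \<xi>d_lim[of n] by (intro tendsto_powr' tendsto_norm tendsto_diff tendsto_const) auto
  ultimately show ?thesis by (intro tendsto_mult tendsto_add tendsto_const lam_lim)
qed

sublocale exact: tpg_exact_run \<Theta> p c0 F L y x0 \<xi>0 \<rho> \<eta> C0 s \<tau> \<mu>0 \<mu>1 c1 \<nu> lam \<xi> \<zeta> x z \<mu>
proof unfold_locales
  show "tpg_iterates \<Theta> F L p s \<tau> \<mu>0 \<mu>1 x0 \<xi>0 y 0 lam \<xi> x \<zeta> z \<mu>" by (rule exact)
  show "0 \<le> lam n" for n by (rule exact_lam_nonneg)
  show "summable (\<lambda>n. lam n * norm (\<xi> n - \<xi> (n - 1)))" by (rule exact_lam_summable)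
  show "\<kappa> * (lam n powr q + lam n) * norm (\<xi> n - \<xi> (n - 1)) powr q \<le> c0 * \<rho> powr p" for n
    by (rule tendsto_upperbound[OF inertia_lim pos_eventuallyI[OF tpg_run.lam_bound[OF runs]]]) simp_all
  show "\<kappa> * (lam n powr q + lam n) * norm (\<xi> n - \<xi> (n - 1)) powr q
      \<le> c1 / \<nu> * (\<mu> n * norm (F (z n) - y) powr s)" for n
  proof (rule tendsto_le[OF _ _ inertia_lim])
    have \<mu>: "\<mu> n = step 0 (F (z n) - y) (L (z n))" using exact by (simp add: tpg_iterates_def)
    show "((\<lambda>\<delta>. c1 / \<nu> * (step \<delta> (F (zd \<delta> n) - yd \<delta>) (L (zd \<delta> n)) * norm (F (zd \<delta> n) - yd \<delta>) powr s))
        \<longlongrightarrow> c1 / \<nu> * (\<mu> n * norm (F (z n) - y) powr s)) (at_right 0)"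
      unfolding \<mu> by (intro tendsto_mult tendsto_const gradient_step_lim(2)[OF zd_lim zd_in_B yd_noise])
    show "\<forall>\<^sub>F \<delta> in at_right 0. \<kappa> * (lamd \<delta> n powr q + lamd \<delta> n) * norm (\<xi>d \<delta> n - \<xi>d \<delta> (n - 1)) powr q
        \<le> c1 / \<nu> * (step \<delta> (F (zd \<delta> n) - yd \<delta>) (L (zd \<delta> n)) * norm (F (zd \<delta> n) - yd \<delta>) powr s)"
      by (rule pos_eventuallyI) (use tpg_run.lam_descent[OF runs] in \<open>simp add: tpg_run.\<mu>_eq[OF runs]\<close>)
  qed simp
qed simp

text \<open>If \<open>nd \<delta> \<ge> N\<close>, monotonicity reduces to the fixed index \<open>N\<close>. An index \<open>n < N\<close> can be
  \<open>nd \<delta>\<close> for arbitrarily small \<open>\<delta>\<close> only if \<open>z n\<close> is a solution, and then the exact iteration is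
  already stationary at its limit.\<close>

theorem noisy_convergence:
  fixes nd
  defines "nd \<equiv> \<lambda>\<delta>. discrepancy_index F (zd \<delta>) (yd \<delta>) \<tau> \<delta>"
  assumes w: "sol w" "(\<lambda>n. breg (\<xi> n) w) \<longlonglongrightarrow> 0"
  shows "((\<lambda>\<delta>. breg (\<xi>d \<delta> (nd \<delta>)) w) \<longlongrightarrow> 0) (at_right 0)"
proof (rule tendstoI)
  fix e :: real assume e: "0 < e"
  have we: "w \<in> edom" using w(1) by (simp add: sol_def)
  have lt: "\<forall>\<^sub>F \<delta> in at_right 0. breg (\<xi>d \<delta> n) w < e" if "breg (\<xi> n) w < e" for n
    using order_tendstoD(2)[OF tendsto_breg[OF \<xi>d_lim[THEN conjunct1]] that] .
  obtain N where N: "breg (\<xi> N) w < e"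
    using eventually_happens'[OF sequentially_bot order_tendstoD(2)[OF w(2) e]] by blast
  have "\<forall>\<^sub>F \<delta> in at_right 0. nd \<delta> = n \<longrightarrow> breg (\<xi>d \<delta> n) w < e" for n
  proof (cases "F (z n) = y")
    case True
    then have "breg (\<xi> n) w < e" using exact.breg_zero_if_solved[OF True w(2)] e by simp
    from lt[OF this] show ?thesis by eventually_elim simp
  next
    case False
    have "((\<lambda>\<delta>. norm (F (zd \<delta> n) - yd \<delta>) - \<tau> * \<delta>) \<longlongrightarrow> norm (F (z n) - y) - \<tau> * 0) (at_right 0)"
      by (intro tendsto_intros rd_lim[OF zd_lim zd_in_B yd_noise])
    then have "\<forall>\<^sub>F \<delta> in at_right 0. 0 < norm (F (zd \<delta> n) - yd \<delta>) - \<tau> * \<delta>"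
      using False by (intro order_tendstoD(1)) auto
    with eventually_at_right_less[of "0::real"] show ?thesis
    proof eventually_elim
      case (elim \<delta>)
      then show ?case
        using tpg_run.discrepancy_index_residual[OF runs[OF elim(1)] elim(1)] by (auto simp: nd_def)
    qed
  qed
  \<comment> \<open>Only finitely many indices lie below \<open>N\<close>, so one range of
    \<open>\<delta>\<close> works for all of them.\<close>
  then have "\<forall>\<^sub>F \<delta> in at_right 0. \<forall>n\<in>{..<N}. nd \<delta> = n \<longrightarrow> breg (\<xi>d \<delta> n) w < e"
    by (intro eventually_ball_finite) auto
  with lt[OF N] eventually_at_right_less[of "0::real"]
  show "\<forall>\<^sub>F \<delta> in at_right 0. dist (breg (\<xi>d \<delta> (nd \<delta>)) w) 0 < e"
  proof eventually_elim
    case (elim \<delta>)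
    have "breg (\<xi>d \<delta> (nd \<delta>)) w < e"
    proof (cases "nd \<delta> < N")
      case True
      then show ?thesis using elim by auto
    next
      case False
      then have "breg (\<xi>d \<delta> (nd \<delta>)) w \<le> breg (\<xi>d \<delta> N) w"
        using decseqD[OF tpg_run.decseq_breg[OF runs[OF elim(2)] w(1)], of N "nd \<delta>"] by simp
      then show ?thesis using elim by simp
    qed
    then show ?case using breg_nonneg[OF we] by simp
  qed
qed

end

theorem theorem3p11:
  fixes \<Theta> :: "'x::banach \<Rightarrow> ereal"
    and F :: "'x \<Rightarrow> 'y::banach"
    and D :: "'x set"
    and L :: "'x \<Rightarrow> ('x \<Rightarrow>\<^sub>L 'y)"
    and y :: 'y
    and x0 :: 'x
    and \<xi>0 :: "'x \<Rightarrow>\<^sub>L real"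
    and p pstar c0 \<rho> \<eta> C0 s \<tau> \<mu>0 \<mu>1 c1 \<nu> :: real
    and yd :: "real \<Rightarrow> 'y"
    and lamd :: "real \<Rightarrow> nat \<Rightarrow> real"
    and \<xi>d \<zeta>d :: "real \<Rightarrow> nat \<Rightarrow> ('x \<Rightarrow>\<^sub>L real)"
    and xd zd :: "real \<Rightarrow> nat \<Rightarrow> 'x"
    and \<mu>d :: "real \<Rightarrow> nat \<Rightarrow> real"
    and lam :: "nat \<Rightarrow> real"
    and \<xi> \<zeta> :: "nat \<Rightarrow> ('x \<Rightarrow>\<^sub>L real)"
    and x z :: "nat \<Rightarrow> 'x"
    and \<mu> :: "nat \<Rightarrow> real"
    and nd :: "real \<Rightarrow> nat"
  assumes reflexive: "reflexive_space TYPE('x)"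
    and smooth: "uniformly_smooth TYPE('y)"
    and p: "p \<ge> 2"
    and pstar: "pstar = p / (p - 1)"
    and c0: "c0 > 0"
    and \<Theta>: "proper_functional \<Theta>" "convex_functional \<Theta>" "weakly_lsc \<Theta>" "p_convex \<Theta> p c0"
    and \<rho>: "\<rho> > 0"
    and \<xi>0: "\<xi>0 \<in> subdifferential \<Theta> x0"
    and ball: "cball x0 (3 * \<rho>) \<subseteq> D"
    and solvable: "\<exists>xs \<in> eff_domain \<Theta> \<inter> solutions F D y. bregman \<Theta> \<xi>0 xs x0 \<le> ereal (c0 * \<rho> powr p)"
    and F_closed: "weakly_closed_operator F D"
    and L_cont: "continuous_on (cball x0 (3 * \<rho>)) L"
    and \<eta>: "0 \<le> \<eta>" "\<eta> < 1"
    and cone: "\<And>u v. u \<in> cball x0 (3 * \<rho>) \<Longrightarrow> v \<in> cball x0 (3 * \<rho>) \<Longrightarrow>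
                 norm (F u - F v - blinfun_apply (L v) (u - v)) \<le> \<eta> * norm (F u - F v)"
    and C0: "C0 > 0"
    and L_bound: "\<And>u. u \<in> cball x0 (3 * \<rho>) \<Longrightarrow> norm (L u) \<le> C0"
    and s: "s > 1"
    and \<tau>: "\<tau> > 1"
    and \<mu>0: "\<mu>0 > 0"
    and \<mu>1: "\<mu>1 > 0"
    and c1: "c1 = 1 - \<eta> - (1 + \<eta>) / \<tau> - 1 / pstar * (\<mu>0 / (2 * c0)) powr (pstar - 1)"
    and c1_pos: "c1 > 0"
    and \<nu>: "\<nu> > 1"
    and noise: "\<And>\<delta>. \<delta> > 0 \<Longrightarrow> norm (yd \<delta> - y) \<le> \<delta>"
    and iterates: "\<And>\<delta>. \<delta> > 0 \<Longrightarrow>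
          tpg_iterates \<Theta> F L p s \<tau> \<mu>0 \<mu>1 x0 \<xi>0 (yd \<delta>) \<delta> (lamd \<delta>) (\<xi>d \<delta>) (xd \<delta>) (\<zeta>d \<delta>) (zd \<delta>) (\<mu>d \<delta>)"
    and lamd_nonneg: "\<And>\<delta> n. \<delta> > 0 \<Longrightarrow> lamd \<delta> n \<ge> 0"
    and lamd_bound: "\<And>\<delta> n. \<delta> > 0 \<Longrightarrow>
          1 / (pstar * (2 * c0) powr (pstar - 1)) * (lamd \<delta> n powr pstar + lamd \<delta> n)
            * norm (\<xi>d \<delta> n - \<xi>d \<delta> (n - 1)) powr pstar \<le> c0 * \<rho> powr p"
    and lamd_descent: "\<And>\<delta> n. \<delta> > 0 \<Longrightarrow>
          1 / (pstar * (2 * c0) powr (pstar - 1)) * (lamd \<delta> n powr pstar + lamd \<delta> n)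
            * norm (\<xi>d \<delta> n - \<xi>d \<delta> (n - 1)) powr pstar
          - c1 / \<nu> * \<mu>d \<delta> n * norm (F (zd \<delta> n) - yd \<delta>) powr s \<le> 0"
    and lam_nonneg: "\<And>n. lam n \<ge> 0"
    and lam_lim: "\<And>n. ((\<lambda>\<delta>. lamd \<delta> n) \<longlongrightarrow> lam n) (at_right 0)"
    and exact_iterates: "tpg_iterates \<Theta> F L p s \<tau> \<mu>0 \<mu>1 x0 \<xi>0 y 0 lam \<xi> x \<zeta> z \<mu>"
    and lam_summable: "summable (\<lambda>n. lam n * norm (\<xi> n - \<xi> (n - 1)))"
    and nd: "\<And>\<delta>. \<delta> > 0 \<Longrightarrow> nd \<delta> = discrepancy_index F (zd \<delta>) (yd \<delta>) \<tau> \<delta>"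
  shows "\<exists>xs \<in> solutions F D y \<inter> cball x0 (2 * \<rho>) \<inter> eff_domain \<Theta>.
           ((\<lambda>\<delta>. norm (xd \<delta> (nd \<delta>) - xs)) \<longlongrightarrow> 0) (at_right 0) \<and>
           ((\<lambda>\<delta>. bregman \<Theta> (\<xi>d \<delta> (nd \<delta>)) xs (xd \<delta> (nd \<delta>))) \<longlongrightarrow> 0) (at_right 0) \<and>
           (\<forall>xdag. bregman_min_solution \<Theta> F D y \<xi>0 x0 xdag \<and>
                   (\<forall>u \<in> cball x0 (3 * \<rho>). blinfun_kernel (L xdag) \<subseteq> blinfun_kernel (L u))
                   \<longrightarrow> xs = xdag)"
proof -
  obtain t where t: "t \<in> eff_domain \<Theta> \<inter> solutions F D y" "bregman \<Theta> \<xi>0 t x0 \<le> ereal (c0 * \<rho> powr p)"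
    using solvable by blast
  interpret p_convex_functional \<Theta> p c0
    using \<Theta> p c0 \<xi>0 by unfold_locales auto
  have q: "q = pstar" by (simp add: q_def pstar)
  interpret tpg_setting \<Theta> p c0 F L y x0 \<xi>0 \<rho> \<eta> C0 s \<tau> \<mu>0 \<mu>1 c1 \<nu>
    using smooth \<rho> \<xi>0 t L_cont \<eta> cone C0 L_bound s \<tau> \<mu>0 \<mu>1 c1 c1_pos \<nu>
    by unfold_locales (auto simp: q solutions_def)
  have runs: "tpg_run \<Theta> p c0 F L y x0 \<xi>0 \<rho> \<eta> C0 s \<tau> \<mu>0 \<mu>1 c1 \<nu>
      (yd \<delta>) \<delta> (lamd \<delta>) (\<xi>d \<delta>) (xd \<delta>) (\<zeta>d \<delta>) (zd \<delta>) (\<mu>d \<delta>)" if "0 < \<delta>" for \<delta>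
    using iterates[OF that] noise[OF that] lamd_nonneg[OF that] lamd_bound[OF that] lamd_descent[OF that]
    by unfold_locales (auto simp: q \<kappa>_def mult.assoc)
  interpret tpg_family \<Theta> p c0 F L y x0 \<xi>0 \<rho> \<eta> C0 s \<tau> \<mu>0 \<mu>1 c1 \<nu>
    yd lamd \<xi>d \<zeta>d xd zd \<mu>d lam \<xi> \<zeta> x z \<mu>
    by (intro tpg_family.intro tpg_family_axioms.intro tpg_setting_axioms runs exact_iterates
        lam_nonneg lam_lim lam_summable)
  obtain w where w: "sol w" "w \<in> cball x0 (2 * \<rho>)" "(\<lambda>n. breg (\<xi> n) w) \<longlonglongrightarrow> 0"
    by (rule exact.exact_convergence)
  have we: "w \<in> edom" and wB: "w \<in> B" and Fw: "F w = y" using w(1) by (auto simp: sol_def)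
  have xd: "xd \<delta> (nd \<delta>) = grad (\<xi>d \<delta> (nd \<delta>))" if "0 < \<delta>" for \<delta>
    by (rule tpg_run.x_eq[OF runs[OF that]])
  have "((\<lambda>\<delta>. breg (\<xi>d \<delta> (discrepancy_index F (zd \<delta>) (yd \<delta>) \<tau> \<delta>)) w) \<longlongrightarrow> 0) (at_right 0)"
    by (rule noisy_convergence[OF w(1,3)])
  then have lim: "((\<lambda>\<delta>. breg (\<xi>d \<delta> (nd \<delta>)) w) \<longlongrightarrow> 0) (at_right 0)"
    by (rule Lim_transform_eventually) (simp add: pos_eventuallyI nd)
  have "((\<lambda>\<delta>. norm (grad (\<xi>d \<delta> (nd \<delta>)) - w)) \<longlongrightarrow> 0) (at_right 0)"
    using tendsto_norm_zero[OF LIM_zero[OF breg_tendsto_0_imp[OF we lim]]] .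
  then have 1: "((\<lambda>\<delta>. norm (xd \<delta> (nd \<delta>) - w)) \<longlongrightarrow> 0) (at_right 0)"
    by (rule Lim_transform_eventually) (simp add: pos_eventuallyI xd)
  have "((\<lambda>\<delta>. ereal (breg (\<xi>d \<delta> (nd \<delta>)) w)) \<longlongrightarrow> ereal 0) (at_right 0)"
    by (intro tendsto_ereal lim)
  then have "((\<lambda>\<delta>. bregman \<Theta> (\<xi>d \<delta> (nd \<delta>)) w (xd \<delta> (nd \<delta>))) \<longlongrightarrow> ereal 0) (at_right 0)"
    by (rule Lim_transform_eventually) (simp add: pos_eventuallyI xd bregman_grad[OF we])
  then have 2: "((\<lambda>\<delta>. bregman \<Theta> (\<xi>d \<delta> (nd \<delta>)) w (xd \<delta> (nd \<delta>))) \<longlongrightarrow> 0) (at_right 0)"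
    by (simp add: zero_ereal_def)
  have wD: "w \<in> eff_domain \<Theta> \<inter> solutions F D y" using we wB Fw ball by (auto simp: solutions_def)
  have 3: "w = u" if u: "bregman_min_solution \<Theta> F D y \<xi>0 x0 u"
    and ker: "\<forall>t\<in>B. blinfun_kernel (L u) \<subseteq> blinfun_kernel (L t)" for u
  proof -
    have breg0: "bregman \<Theta> \<xi>0 t x0 = ereal (breg \<xi>0 t)" if "t \<in> edom" for t
      using bregman_grad[OF that, of \<xi>0] grad_eq[OF \<xi>0] by simp
    have uD: "u \<in> edom" "F u = y" using u by (auto simp: bregman_min_solution_def is_arg_min_def solutions_def)
    have min: "breg \<xi>0 u \<le> breg \<xi>0 t" if "t \<in> eff_domain \<Theta> \<inter> solutions F D y" for t
    proof -
      have "\<not> bregman \<Theta> \<xi>0 t x0 < bregman \<Theta> \<xi>0 u x0"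
        using u that by (auto simp: bregman_min_solution_def is_arg_min_def)
      then show ?thesis using that by (simp add: breg0 uD(1))
    qed
    \<comment> \<open>The solution \<open>t\<close> is a competitor, so the minimiser inherits its
      bound and lies in the ball where the cone condition holds.\<close>
    have "breg \<xi>0 u \<le> c0 * \<rho> powr p" using min[OF t(1)] t by (simp add: breg0)
    then have "norm (u - x0) \<le> \<rho>"
      using breg_le_imp_dist[OF uD(1), of \<xi>0 1 \<rho>] \<rho> grad_eq[OF \<xi>0] by simp
    then have "sol u" using uD \<rho> by (simp add: sol_def dist_norm norm_minus_commute)
    then show ?thesis using exact.limit_eq_minimizer[OF w(1,3)] min[OF wD] ker by blast
  qed
  show ?thesis
  proof (intro bexI[of _ w] conjI allI impI)
    show "w = u" if "bregman_min_solution \<Theta> F D y \<xi>0 x0 u \<and>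
      (\<forall>t\<in>B. blinfun_kernel (L u) \<subseteq> blinfun_kernel (L t))" for u
      using that by (intro 3) auto
  qed (use 1 2 w(2) wD in auto)
qed

end
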